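(* Let $f_1=(x^2+y,\,y^2+x)$ and let $f\in\Omega(2,2)$. The following conditions are equivalent: 1. $C(f)$ is a hyperbola. 2. $O(f)$ is an open dense subset of $\Omega(2,2)$. 3. $O(f)=O(f_1)$, i.e. $f$ is linearly equivalent to $f_1$. Moreover, the maximal orbit $O(f_1)$ is a smooth affine variety of Euler characteristic $0$ and dimension $12$.
   Context: $\Omega(2,2)$ is the space (identified with $\mathbb{C}^{12}$ via coefficients) of polynomial mappings $f=(g,h):\mathbb{C}^2\to\mathbb{C}^2$ with $\deg g\le2$, $\deg h\le2$. $GA(2,2)$ is the group of affine automorphisms of $\mathbb{C}^2$; $GA(2,2)\times GA(2,2)$ acts on $\Omega(2,2)$ by $(L,R)f=L\circ f\circ R$ and $O(f)$ denotes the orbit of $f$. Two mappings are linearly equivalent if they lie in the same orbit. $C(f)=\{J(f)=0\}$ is the critical set of $f$, $J(f)$ being the Jacobian determinant. A hyperbola is a curve affinely equivalent to $\{xy=1\}\subset\mathbb{C}^2$. *)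

theory Defs
  imports "HOL-Analysis.Analysis" "HOL-Homology.Homology" "HOL-Library.Extended_Nat" "HOL-Library.Function_Algebras"
begin

section \<open>Quadratic mappings of the plane\<close>

text \<open>Polynomials over the infinite field of complex numbers are identified with the
  functions they define.\<close>

definition poly2_degree_le :: "nat \<Rightarrow> (complex^2 \<Rightarrow> complex) \<Rightarrow> bool" where
  "poly2_degree_le d g \<longleftrightarrow>
     (\<exists>a :: nat \<Rightarrow> nat \<Rightarrow> complex.
        \<forall>z. g z = (\<Sum>(i, j) \<in> {(i, j). i + j \<le> d}. a i j * (z$1) ^ i * (z$2) ^ j))"

definition Omega :: "nat \<Rightarrow> nat \<Rightarrow> (complex^2 \<Rightarrow> complex^2) set" where
  "Omega d1 d2 = {f. poly2_degree_le d1 (\<lambda>z. f z $ 1) \<and> poly2_degree_le d2 (\<lambda>z. f z $ 2)}"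

definition GA2 :: "(complex^2 \<Rightarrow> complex^2) set" where
  "GA2 = {L. \<exists>A b. invertible (A :: complex^2^2) \<and> L = (\<lambda>z. A *v z + b)}"

definition orbit :: "(complex^2 \<Rightarrow> complex^2) \<Rightarrow> (complex^2 \<Rightarrow> complex^2) set" where
  "orbit f = {L \<circ> f \<circ> R | L R. L \<in> GA2 \<and> R \<in> GA2}"

definition linearly_equivalent ::
    "(complex^2 \<Rightarrow> complex^2) \<Rightarrow> (complex^2 \<Rightarrow> complex^2) \<Rightarrow> bool" where
  "linearly_equivalent f g \<longleftrightarrow> (\<exists>k \<in> Omega 2 2. f \<in> orbit k \<and> g \<in> orbit k)"

definition jacobian :: "(complex^2 \<Rightarrow> complex^2) \<Rightarrow> complex^2 \<Rightarrow> complex" where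
  "jacobian f z = det (\<chi> i j. deriv (\<lambda>t. f (\<chi> k. if k = j then t else z$k) $ i) (z$j))"

definition critical_set :: "(complex^2 \<Rightarrow> complex^2) \<Rightarrow> (complex^2) set" where
  "critical_set f = {z. jacobian f z = 0}"

definition is_hyperbola :: "(complex^2) set \<Rightarrow> bool" where
  "is_hyperbola C \<longleftrightarrow> (\<exists>L \<in> GA2. C = L ` {z. z$1 * z$2 = 1})"

definition f1 :: "complex^2 \<Rightarrow> complex^2" where
  "f1 z = vector [(z$1)^2 + z$2, (z$2)^2 + z$1]"


section \<open>Affine space and its Zariski topology\<close>

text \<open>The space \<open>\<complex>\<^sup>N\<close> for varying \<open>N\<close>, encoded as in \<^const>\<open>Euclidean_space\<close>:
  sequences vanishing from position \<open>N\<close> on. The product topology of the function type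
  restricts to the usual topology of \<open>\<complex>\<^sup>N\<close>, so \<open>top_of_set (affine_space N)\<close> is
  the Euclidean topology.\<close>

definition affine_space :: "nat \<Rightarrow> (nat \<Rightarrow> complex) set" where
  "affine_space N = {x. \<forall>i\<ge>N. x i = 0}"

inductive_set poly_funs :: "nat \<Rightarrow> ((nat \<Rightarrow> complex) \<Rightarrow> complex) set" for N :: nat where
  const: "(\<lambda>x. c) \<in> poly_funs N"
| coord: "i < N \<Longrightarrow> (\<lambda>x. x i) \<in> poly_funs N"
| add: "p \<in> poly_funs N \<Longrightarrow> q \<in> poly_funs N \<Longrightarrow> (\<lambda>x. p x + q x) \<in> poly_funs N"
| mult: "p \<in> poly_funs N \<Longrightarrow> q \<in> poly_funs N \<Longrightarrow> (\<lambda>x. p x * q x) \<in> poly_funs N"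

definition algebraic_set :: "nat \<Rightarrow> (nat \<Rightarrow> complex) set \<Rightarrow> bool" where
  "algebraic_set N Z \<longleftrightarrow>
     (\<exists>P \<subseteq> poly_funs N. Z = {x \<in> affine_space N. \<forall>p\<in>P. p x = 0})"

definition zariski :: "nat \<Rightarrow> (nat \<Rightarrow> complex) topology" where
  "zariski N = topology (\<lambda>U. U \<subseteq> affine_space N \<and> algebraic_set N (affine_space N - U))"

lemma algebraic_set_Un:
  assumes "algebraic_set N Y" "algebraic_set N Z"
  shows "algebraic_set N (Y \<union> Z)"
proof -
  obtain P where P: "P \<subseteq> poly_funs N" "Y = {x \<in> affine_space N. \<forall>p\<in>P. p x = 0}"
    using assms(1) unfolding algebraic_set_def by blast
  obtain Q where Q: "Q \<subseteq> poly_funs N" "Z = {x \<in> affine_space N. \<forall>p\<in>Q. p x = 0}"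
    using assms(2) unfolding algebraic_set_def by blast
  let ?R = "(\<lambda>(p, q) x. p x * q x) ` (P \<times> Q)"
  have "?R \<subseteq> poly_funs N"
    using P(1) Q(1) by (auto intro!: poly_funs.mult)
  moreover have "Y \<union> Z = {x \<in> affine_space N. \<forall>r\<in>?R. r x = 0}"
    unfolding P(2) Q(2) by auto
  ultimately show ?thesis
    unfolding algebraic_set_def by blast
qed

lemma algebraic_set_subset:
  assumes "algebraic_set N Z"
  shows "Z \<subseteq> affine_space N"
proof -
  obtain P where "P \<subseteq> poly_funs N" "Z = {x \<in> affine_space N. \<forall>p\<in>P. p x = 0}"
    using assms unfolding algebraic_set_def by blast
  then show ?thesis
    by simp
qed

lemma algebraic_set_separate:
  assumes "algebraic_set N Z" "x \<in> affine_space N" "x \<notin> Z"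
  shows "\<exists>p\<in>poly_funs N. (\<forall>y\<in>Z. p y = 0) \<and> p x \<noteq> 0"
proof -
  obtain P where P: "P \<subseteq> poly_funs N" and Z: "Z = {x \<in> affine_space N. \<forall>p\<in>P. p x = 0}"
    using assms(1) unfolding algebraic_set_def by blast
  obtain p where p: "p \<in> P" "p x \<noteq> 0"
    using assms(2,3) unfolding Z by blast
  have "\<forall>y\<in>Z. p y = 0"
    unfolding Z using p(1) by simp
  with p P show ?thesis
    by (intro bexI[of _ p] conjI) (simp_all add: subsetD)
qed

lemma algebraic_set_INT:
  assumes "\<And>i. i \<in> I \<Longrightarrow> algebraic_set N (Z i)"
  shows "algebraic_set N (affine_space N \<inter> (\<Inter>i\<in>I. Z i))"
proof -
  let ?P = "\<Union>i\<in>I. {p \<in> poly_funs N. \<forall>y\<in>Z i. p y = 0}"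
  have "affine_space N \<inter> (\<Inter>i\<in>I. Z i) = {x \<in> affine_space N. \<forall>p\<in>?P. p x = 0}"
  proof (intro equalityI subsetI)
    fix x assume "x \<in> affine_space N \<inter> (\<Inter>i\<in>I. Z i)"
    then show "x \<in> {x \<in> affine_space N. \<forall>p\<in>?P. p x = 0}"
      by simp
  next
    fix x assume "x \<in> {x \<in> affine_space N. \<forall>p\<in>?P. p x = 0}"
    then have xN: "x \<in> affine_space N" and x: "\<forall>p\<in>?P. p x = 0"
      by simp_all
    have "x \<in> Z i" if i: "i \<in> I" for i
    proof (rule ccontr)
      assume "x \<notin> Z i"
      from algebraic_set_separate[OF assms[OF i] xN this]
      obtain p where p: "p \<in> poly_funs N" "\<forall>y\<in>Z i. p y = 0" "p x \<noteq> 0"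
        by (elim bexE conjE)
      have "p \<in> ?P"
        using i p(1,2) by (intro UN_I CollectI conjI)
      with x have "p x = 0"
        by (rule bspec)
      with p(3) show False
        by (rule notE)
    qed
    then show "x \<in> affine_space N \<inter> (\<Inter>i\<in>I. Z i)"
      using xN by (intro IntI INT_I)
  qed
  moreover have "?P \<subseteq> poly_funs N"
    by blast
  ultimately show ?thesis
    unfolding algebraic_set_def by (intro exI[of _ ?P] conjI)
qed

lemma openin_zariski:
  "openin (zariski N) U \<longleftrightarrow> U \<subseteq> affine_space N \<and> algebraic_set N (affine_space N - U)"
proof -
  have "istopology (\<lambda>U. U \<subseteq> affine_space N \<and> algebraic_set N (affine_space N - U))"
    unfolding istopology_def
  proof (intro conjI allI impI)
    fix S T
    assume S: "S \<subseteq> affine_space N \<and> algebraic_set N (affine_space N - S)"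
      and T: "T \<subseteq> affine_space N \<and> algebraic_set N (affine_space N - T)"
    show "S \<inter> T \<subseteq> affine_space N"
      using S by blast
    show "algebraic_set N (affine_space N - S \<inter> T)"
      unfolding Diff_Int by (rule algebraic_set_Un) (simp_all only: S T)
  next
    fix \<K>
    assume K: "\<forall>K\<in>\<K>. K \<subseteq> affine_space N \<and> algebraic_set N (affine_space N - K)"
    then show "\<Union>\<K> \<subseteq> affine_space N"
      by blast
    have "affine_space N - \<Union>\<K> = affine_space N \<inter> (\<Inter>K\<in>\<K>. affine_space N - K)"
      by blast
    moreover have "algebraic_set N (affine_space N \<inter> (\<Inter>K\<in>\<K>. affine_space N - K))"
      using K by (intro algebraic_set_INT) blast
    ultimately show "algebraic_set N (affine_space N - \<Union>\<K>)"
      by simp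
  qed
  then show ?thesis
    unfolding zariski_def by (simp only: topology_inverse')
qed

lemma topspace_zariski: "topspace (zariski N) = affine_space N"
proof -
  have "algebraic_set N {}"
    unfolding algebraic_set_def
    using poly_funs.const[of 1 N] by (intro exI[of _ "{\<lambda>x. 1}"]) simp
  then have "openin (zariski N) (affine_space N)"
    by (simp add: openin_zariski)
  then have "affine_space N \<subseteq> topspace (zariski N)"
    by (rule openin_subset)
  moreover have "topspace (zariski N) \<subseteq> affine_space N"
    using openin_topspace[of "zariski N"] unfolding openin_zariski by (rule conjunct1)
  ultimately show ?thesis
    by (rule equalityI[rotated])
qed

lemma closedin_zariski: "closedin (zariski N) Z \<longleftrightarrow> algebraic_set N Z"
proof
  assume "closedin (zariski N) Z"
  then have Z: "Z \<subseteq> affine_space N" "algebraic_set N (affine_space N - (affine_space N - Z))"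
    by (simp_all only: closedin_def openin_zariski topspace_zariski)
  have "affine_space N - (affine_space N - Z) = Z"
    using Z(1) by blast
  then show "algebraic_set N Z"
    using Z(2) by (simp only:)
next
  assume Z: "algebraic_set N Z"
  have "affine_space N - (affine_space N - Z) = Z"
    using algebraic_set_subset[OF Z] by blast
  then show "closedin (zariski N) Z"
    unfolding closedin_def openin_zariski topspace_zariski
    using Z algebraic_set_subset[OF Z] by (simp only: Diff_subset simp_thms)
qed


section \<open>Varieties\<close>

definition irreducible_space :: "'a topology \<Rightarrow> bool" where
  "irreducible_space X \<longleftrightarrow> topspace X \<noteq> {} \<and>
     (\<forall>A B. closedin X A \<longrightarrow> closedin X B \<longrightarrow> topspace X = A \<union> B
        \<longrightarrow> A = topspace X \<or> B = topspace X)"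

definition quasi_affine_variety :: "nat \<Rightarrow> (nat \<Rightarrow> complex) set \<Rightarrow> bool" where
  "quasi_affine_variety N S \<longleftrightarrow>
     (\<exists>U Z. openin (zariski N) U \<and> closedin (zariski N) Z \<and> S = U \<inter> Z) \<and>
     irreducible_space (subtopology (zariski N) S)"

definition regular_function ::
    "nat \<Rightarrow> (nat \<Rightarrow> complex) set \<Rightarrow> ((nat \<Rightarrow> complex) \<Rightarrow> complex) \<Rightarrow> bool" where
  "regular_function N S \<phi> \<longleftrightarrow>
     (\<forall>x\<in>S. \<exists>U. openin (subtopology (zariski N) S) U \<and> x \<in> U \<and>
        (\<exists>p\<in>poly_funs N. \<exists>q\<in>poly_funs N. \<forall>y\<in>U. q y \<noteq> 0 \<and> \<phi> y = p y / q y))"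

definition regular_map ::
    "nat \<Rightarrow> (nat \<Rightarrow> complex) set \<Rightarrow> nat \<Rightarrow> (nat \<Rightarrow> complex) set
      \<Rightarrow> ((nat \<Rightarrow> complex) \<Rightarrow> nat \<Rightarrow> complex) \<Rightarrow> bool" where
  "regular_map N S M T F \<longleftrightarrow> F ` S \<subseteq> T \<and> (\<forall>j<M. regular_function N S (\<lambda>x. F x j))"

definition isomorphic_varieties ::
    "nat \<Rightarrow> (nat \<Rightarrow> complex) set \<Rightarrow> nat \<Rightarrow> (nat \<Rightarrow> complex) set \<Rightarrow> bool" where
  "isomorphic_varieties N S M T \<longleftrightarrow>
     (\<exists>F G. regular_map N S M T F \<and> regular_map M T N S G \<and>
        (\<forall>x\<in>S. G (F x) = x) \<and> (\<forall>y\<in>T. F (G y) = y))"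

text \<open>A locally closed subset of \<open>\<complex>\<^sup>N\<close> is affine if it is isomorphic to a closed
  subset of some \<open>\<complex>\<^sup>M\<close>; it need not be closed in \<open>\<complex>\<^sup>N\<close>.\<close>

definition affine_variety :: "nat \<Rightarrow> (nat \<Rightarrow> complex) set \<Rightarrow> bool" where
  "affine_variety N S \<longleftrightarrow> quasi_affine_variety N S \<and>
     (\<exists>M Z. closedin (zariski M) Z \<and> isomorphic_varieties N S M Z)"

text \<open>The dimension of a variety is the transcendence degree of its function field, that is,
  the largest number of algebraically independent elements of the coordinate ring of its
  closure (whose fraction field is the function field).\<close>

definition algebraically_independent_on ::
    "nat \<Rightarrow> (nat \<Rightarrow> complex) set \<Rightarrow> nat \<Rightarrow> (nat \<Rightarrow> (nat \<Rightarrow> complex) \<Rightarrow> complex) \<Rightarrow> bool" where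
  "algebraically_independent_on N S d p \<longleftrightarrow> (\<forall>i<d. p i \<in> poly_funs N) \<and>
     (\<forall>F\<in>poly_funs d. (\<forall>x\<in>S. F (\<lambda>i. if i < d then p i x else 0) = 0)
        \<longrightarrow> (\<forall>y\<in>affine_space d. F y = 0))"

definition variety_dim :: "nat \<Rightarrow> (nat \<Rightarrow> complex) set \<Rightarrow> nat" where
  "variety_dim N S = (GREATEST d. \<exists>p. algebraically_independent_on N S d p)"

text \<open>Scalar multiplication of the complex vector space of sequences, with addition from
  \<^theory>\<open>HOL-Library.Function_Algebras\<close>.\<close>

definition cscale :: "complex \<Rightarrow> (nat \<Rightarrow> complex) \<Rightarrow> nat \<Rightarrow> complex" where
  "cscale c v = (\<lambda>i. c * v i)"

lemma vector_space_cscale: "vector_space cscale"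
  by standard (rule ext, simp add: cscale_def distrib_left distrib_right mult.assoc)+

definition tangent_space ::
    "nat \<Rightarrow> (nat \<Rightarrow> complex) set \<Rightarrow> (nat \<Rightarrow> complex) \<Rightarrow> (nat \<Rightarrow> complex) set" where
  "tangent_space N S x = {v \<in> affine_space N. \<forall>p\<in>poly_funs N. (\<forall>y\<in>S. p y = 0)
     \<longrightarrow> deriv (\<lambda>t. p (\<lambda>i. x i + t * v i)) 0 = 0}"

definition smooth_variety :: "nat \<Rightarrow> (nat \<Rightarrow> complex) set \<Rightarrow> bool" where
  "smooth_variety N S \<longleftrightarrow> quasi_affine_variety N S \<and>
     (\<forall>x\<in>S. vector_space.dim cscale (tangent_space N S x) = variety_dim N S)"


section \<open>Topological Euler characteristic\<close>

definition int_independent :: "('a, 'b) monoid_scheme \<Rightarrow> 'a set \<Rightarrow> bool" where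
  "int_independent G B \<longleftrightarrow> finite B \<and> B \<subseteq> carrier G \<and>
     (\<forall>k :: 'a \<Rightarrow> int. finprod G (\<lambda>b. b [^]\<^bsub>G\<^esub> k b) B = \<one>\<^bsub>G\<^esub> \<longrightarrow> (\<forall>b\<in>B. k b = 0))"

definition betti_number :: "nat \<Rightarrow> 'a topology \<Rightarrow> enat" where
  "betti_number p X = (SUP B \<in> {B. int_independent (homology_group (int p) X) B}. enat (card B))"

text \<open>The Euler characteristic is defined only when the total rank of the integral singular
  homology is finite; this is part of the predicate.\<close>

definition has_euler_characteristic :: "'a topology \<Rightarrow> int \<Rightarrow> bool" where
  "has_euler_characteristic X e \<longleftrightarrow>
     (\<forall>p. betti_number p X \<noteq> \<infinity>) \<and> finite {p. betti_number p X \<noteq> 0} \<and>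
     e = (\<Sum>p | betti_number p X \<noteq> 0. (-1) ^ p * int (the_enat (betti_number p X)))"


section \<open>The identification of \<open>\<Omega>(2,2)\<close> with \<open>\<complex>\<^sup>1\<^sup>2\<close>\<close>

definition quad_map :: "(nat \<Rightarrow> complex) \<Rightarrow> complex^2 \<Rightarrow> complex^2" where
  "quad_map c z = vector
     [c 0 + c 1 * z$1 + c 2 * z$2 + c 3 * (z$1)^2 + c 4 * (z$1 * z$2) + c 5 * (z$2)^2,
      c 6 + c 7 * z$1 + c 8 * z$2 + c 9 * (z$1)^2 + c 10 * (z$1 * z$2) + c 11 * (z$2)^2]"

definition coeff_set :: "(complex^2 \<Rightarrow> complex^2) set \<Rightarrow> (nat \<Rightarrow> complex) set" where
  "coeff_set A = {c \<in> affine_space 12. quad_map c \<in> A}"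

lemma quadratic_coeffs_unique:
  fixes a b c d e k :: complex
  assumes "\<And>x y. a + b * x + c * y + d * x^2 + e * (x * y) + k * y^2
    = a' + b' * x + c' * y + d' * x^2 + e' * (x * y) + k' * y^2"
  shows "a = a' \<and> b = b' \<and> c = c' \<and> d = d' \<and> e = e' \<and> k = k'"
proof -
  have a: "a = a'" using assms[of 0 0] by simp
  have b1: "a + b + d = a' + b' + d'" and b2: "a - b + d = a' - b' + d'"
    using assms[of 1 0] assms[of "-1" 0] by simp_all
  have "(a + b + d) - (a - b + d) = (a' + b' + d') - (a' - b' + d')"
    by (simp only: b1 b2)
  then have "2 * b = 2 * b'"
    by simp
  moreover from this have "b = b'"
    by simp
  moreover from this have "2 * d = 2 * d'"
    using b1 a by simp
  ultimately have bd: "b = b'" "d = d'"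
    by simp_all
  have c1: "a + c + k = a' + c' + k'" and c2: "a - c + k = a' - c' + k'"
    using assms[of 0 1] assms[of 0 "-1"] by simp_all
  have "(a + c + k) - (a - c + k) = (a' + c' + k') - (a' - c' + k')"
    by (simp only: c1 c2)
  then have "2 * c = 2 * c'"
    by simp
  moreover from this have "c = c'"
    by simp
  moreover from this have "2 * k = 2 * k'"
    using c1 a by simp
  ultimately have ck: "c = c'" "k = k'"
    by simp_all
  show ?thesis
    using assms[of 1 1] a bd ck by simp
qed

lemma poly2_degree_le_2:
  "poly2_degree_le 2 g \<longleftrightarrow> (\<exists>a b c d e k. \<forall>z. g z =
     a + b * z$1 + c * z$2 + d * (z$1)^2 + e * (z$1 * z$2) + k * (z$2)^2)"
proof -
  have S: "{(i, j). i + j \<le> (2::nat)} = {(0,0), (1,0), (0,1), (2,0), (1,1), (0,2)}"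
    by auto
  have eq: "(\<Sum>(i, j) \<in> {(i, j). i + j \<le> 2}. a i j * (z$1) ^ i * (z$2) ^ j)
    = a 0 0 + a 1 0 * z$1 + a 0 1 * z$2 + a 2 0 * (z$1)^2 + a 1 1 * (z$1 * z$2) + a 0 2 * (z$2)^2"
    for a :: "nat \<Rightarrow> nat \<Rightarrow> complex" and z :: "complex^2"
    unfolding S by (simp add: algebra_simps)
  show ?thesis
  proof
    assume "poly2_degree_le 2 g"
    then show "\<exists>a b c d e k. \<forall>z. g z =
        a + b * z$1 + c * z$2 + d * (z$1)^2 + e * (z$1 * z$2) + k * (z$2)^2"
      unfolding poly2_degree_le_def eq by blast
  next
    assume "\<exists>a b c d e k. \<forall>z. g z =
        a + b * z$1 + c * z$2 + d * (z$1)^2 + e * (z$1 * z$2) + k * (z$2)^2"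
    then obtain a b c d e k where g: "\<And>z. g z =
        a + b * z$1 + c * z$2 + d * (z$1)^2 + e * (z$1 * z$2) + k * (z$2)^2"
      by blast
    define m :: "nat \<Rightarrow> nat \<Rightarrow> complex" where "m i j =
      (if (i, j) = (0,0) then a else if (i, j) = (1,0) then b else if (i, j) = (0,1) then c
       else if (i, j) = (2,0) then d else if (i, j) = (1,1) then e else k)" for i j
    show "poly2_degree_le 2 g"
      unfolding poly2_degree_le_def eq by (rule exI[of _ m]) (simp add: g m_def)
  qed
qed

lemma bij_betw_quad_map: "bij_betw quad_map (affine_space 12) (Omega 2 2)"
proof (rule bij_betw_imageI)
  show "inj_on quad_map (affine_space 12)"
  proof (rule inj_onI)
    fix c d
    assume c: "c \<in> affine_space 12" and d: "d \<in> affine_space 12" and eq: "quad_map c = quad_map d"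
    have 1: "quad_map c (vector [x, y]) $ i = quad_map d (vector [x, y]) $ i" for x y i
      by (simp add: eq)
    have lo: "c 0 = d 0 \<and> c 1 = d 1 \<and> c 2 = d 2 \<and> c 3 = d 3 \<and> c 4 = d 4 \<and> c 5 = d 5"
      using 1[of _ _ 1] unfolding quad_map_def vector_2 by (rule quadratic_coeffs_unique)
    have hi: "c 6 = d 6 \<and> c 7 = d 7 \<and> c 8 = d 8 \<and> c 9 = d 9 \<and> c 10 = d 10 \<and> c 11 = d 11"
      using 1[of _ _ 2] unfolding quad_map_def vector_2 by (rule quadratic_coeffs_unique)
    show "c = d"
    proof
      fix i :: nat
      have "i = 0 \<or> i = 1 \<or> i = 2 \<or> i = 3 \<or> i = 4 \<or> i = 5 \<or> i = 6 \<or> i = 7 \<or> i = 8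
          \<or> i = 9 \<or> i = 10 \<or> i = 11" if "\<not> 12 \<le> i"
        using that by presburger
      then consider "i \<ge> 12" | "i \<in> {0,1,2,3,4,5,6,7,8,9,10,11}"
        by blast
      then show "c i = d i"
      proof cases
        case 1
        then show ?thesis using c d by (simp add: affine_space_def)
      next
        case 2
        then show ?thesis using lo hi by auto
      qed
    qed
  qed
  show "quad_map ` affine_space 12 = Omega 2 2"
  proof (intro equalityI subsetI)
    fix f assume "f \<in> quad_map ` affine_space 12"
    then obtain c where f: "f = quad_map c"
      by blast
    show "f \<in> Omega 2 2"
      unfolding Omega_def poly2_degree_le_2 f quad_map_def mem_Collect_eq vector_2 by blast
  next
    fix f assume f: "f \<in> Omega 2 2"
    obtain a0 a1 a2 a3 a4 a5 where a: "\<And>z. f z $ 1 =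
        a0 + a1 * z$1 + a2 * z$2 + a3 * (z$1)^2 + a4 * (z$1 * z$2) + a5 * (z$2)^2"
      using f unfolding Omega_def poly2_degree_le_2 by blast
    obtain b0 b1 b2 b3 b4 b5 where b: "\<And>z. f z $ 2 =
        b0 + b1 * z$1 + b2 * z$2 + b3 * (z$1)^2 + b4 * (z$1 * z$2) + b5 * (z$2)^2"
      using f unfolding Omega_def poly2_degree_le_2 by blast
    define c where "c i = (if i < 12 then [a0,a1,a2,a3,a4,a5,b0,b1,b2,b3,b4,b5] ! i else 0)"
      for i :: nat
    have "c \<in> affine_space 12"
      by (simp add: c_def affine_space_def)
    moreover have "quad_map c = f"
      by (rule ext) (simp add: vec_eq_iff forall_2 quad_map_def a b c_def nth_Cons')
    ultimately show "f \<in> quad_map ` affine_space 12"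
      by blast
  qed
qed

definition zariski_open_dense :: "(complex^2 \<Rightarrow> complex^2) set \<Rightarrow> bool" where
  "zariski_open_dense A \<longleftrightarrow> openin (zariski 12) (coeff_set A) \<and>
     Abstract_Topology.closure_of (zariski 12) (coeff_set A) = affine_space 12"

definition euclidean_open_dense :: "(complex^2 \<Rightarrow> complex^2) set \<Rightarrow> bool" where
  "euclidean_open_dense A \<longleftrightarrow> openin (top_of_set (affine_space 12)) (coeff_set A) \<and>
     Abstract_Topology.closure_of (top_of_set (affine_space 12)) (coeff_set A) = affine_space 12"

end

theory Submission
  imports Defs
begin

text \<open>The Jacobian of a quadratic map is a polynomial of degree two, and its zero set is a hyperbola iff
  the discriminant of its quadratic part and the determinant of the whole conic do not vanish. An affine
  change of variables turns the Jacobian into \<open>k (x y - 1)\<close>, which forces the map into the normal form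
  \<open>f1\<close>. So the orbit of \<open>f1\<close> is the complement of a hypersurface in \<open>\<complex>\<^sup>1\<^sup>2\<close>; everything except the
  Euler characteristic follows from this.

  Multiplying the first component of a map by \<open>\<lambda>\<close> multiplies the discriminant by \<open>\<lambda>\<^sup>2\<close> and
  the determinant by \<open>\<lambda>\<^sup>3\<close>, hence their quotient \<open>\<phi>\<close> by \<open>\<lambda>\<close>. The two open sets where \<open>\<phi>\<close> avoids a
  closed half-line cover the orbit, each is homotopy equivalent to \<open>{\<phi> = 1}\<close>, and their
  intersection is homotopy equivalent to two copies of it, so additivity gives
  \<open>\<chi> + \<chi> - 2 \<chi> = 0\<close> provided that the homology has finite rank. For the finiteness, Gram-Schmidt
  applied to both factors of \<open>f = L \<circ> f1 \<circ> R\<close> deforms the orbit into a compact subset, and a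
  compact subset of an open set has a neighbourhood there that is a finite union of convex open sets.\<close>

section \<open>Ranks of abelian groups\<close>

text \<open>The obstacle to deforming the orbit is that \<open>L\<close> and \<open>R\<close> are
  not functions of \<open>f\<close>: the symmetries of \<open>f1\<close> form a group of order six,
  generated by the swap of the coordinates and by scaling one coordinate with a primitive cube root
  of unity and the other with its inverse. Gram-Schmidt, however, sees \<open>R\<close> only through
  the Gram matrix of its columns, and these symmetries have unitary linear parts, so the Gram matrix
  is a function of \<open>f\<close>. Explicit radicals express it through the coefficients of
  \<open>f\<close>, which gives its continuity. Once \<open>R\<close> is normalized, the derivative
  of \<open>f\<close> at the centre of the critical hyperbola gives access to \<open>L\<close>,
  because the derivative of \<open>f1\<close> at the origin is just the swap. Translations are
  removed by moving that centre and its image to the origin.\<close>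

definition lincomb :: "('a, 'b) monoid_scheme \<Rightarrow> ('i \<Rightarrow> 'a) \<Rightarrow> ('i \<Rightarrow> int) \<Rightarrow> 'i set \<Rightarrow> 'a" where
  "lincomb G b k I = finprod G (\<lambda>i. b i [^]\<^bsub>G\<^esub> k i) I"

text \<open>Indexed families allow the image of a set under a homomorphism to be tested for
  independence before injectivity on that set is known. Independence then yields injectivity, which
  leads back to the notion for sets.\<close>

definition independent_family :: "('a, 'b) monoid_scheme \<Rightarrow> ('i \<Rightarrow> 'a) \<Rightarrow> 'i set \<Rightarrow> bool" where
  "independent_family G b I \<longleftrightarrow> finite I \<and> b ` I \<subseteq> carrier G \<and>
     (\<forall>k. lincomb G b k I = \<one>\<^bsub>G\<^esub> \<longrightarrow> (\<forall>i\<in>I. k i = 0))"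

lemma int_independent_iff: "int_independent G B \<longleftrightarrow> independent_family G id B"
  by (auto simp: int_independent_def independent_family_def lincomb_def)

context comm_group
begin

lemma lincomb_closed: "b ` I \<subseteq> carrier G \<Longrightarrow> lincomb G b k I \<in> carrier G"
  unfolding lincomb_def by (rule finprod_closed) auto

lemma lincomb_insert:
  "\<lbrakk>finite I; i \<notin> I; b i \<in> carrier G; b ` I \<subseteq> carrier G\<rbrakk>
    \<Longrightarrow> lincomb G b k (insert i I) = b i [^] k i \<otimes> lincomb G b k I"
  unfolding lincomb_def by (rule finprod_insert) auto

lemma lincomb_zero: "(\<And>i. i \<in> I \<Longrightarrow> k i = 0) \<Longrightarrow> lincomb G b k I = \<one>"
  unfolding lincomb_def by (rule finprod_one_eqI) simp

lemma lincomb_add: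
  assumes "b ` I \<subseteq> carrier G"
  shows "lincomb G b (\<lambda>i. k i + l i) I = lincomb G b k I \<otimes> lincomb G b l I"
proof -
  have "lincomb G b (\<lambda>i. k i + l i) I = finprod G (\<lambda>i. b i [^] k i \<otimes> b i [^] l i) I"
    unfolding lincomb_def using assms by (intro finprod_cong') (auto simp: int_pow_mult)
  also have "\<dots> = lincomb G b k I \<otimes> lincomb G b l I"
    unfolding lincomb_def using assms by (intro finprod_multf) auto
  finally show ?thesis .
qed

lemma lincomb_scale:
  assumes "b ` I \<subseteq> carrier G" "finite I"
  shows "lincomb G b (\<lambda>i. k i * n) I = lincomb G b k I [^] (n::int)"
  using assms(2,1)
proof (induction I)
  case empty
  then show ?case by (simp add: lincomb_def)
next
  case (insert i I)
  then show ?case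
    by (simp add: lincomb_insert int_pow_distrib int_pow_pow lincomb_closed)
qed

lemma lincomb_lincomb:
  assumes "b ` I \<subseteq> carrier G" "finite I" "finite C"
  shows "lincomb G (\<lambda>c. lincomb G b (k c) I) n C = lincomb G b (\<lambda>i. \<Sum>c\<in>C. k c i * n c) I"
  using assms(3)
proof (induction C)
  case empty
  have "lincomb G b (\<lambda>i. 0) I = \<one>" by (rule lincomb_zero) simp
  then show ?case by (simp add: lincomb_def[of _ _ _ "{}"])
next
  case (insert c C)
  have im: "(\<lambda>c. lincomb G b (k c) I) ` C \<subseteq> carrier G"
    using assms(1) lincomb_closed by auto
  show ?case
    using insert im assms
    by (simp add: lincomb_insert lincomb_add lincomb_scale lincomb_closed)
qed

lemma lincomb_mono_neutral:
  assumes "finite I" "J \<subseteq> I" "b ` I \<subseteq> carrier G" "\<And>i. i \<in> I - J \<Longrightarrow> k i = 0"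
  shows "lincomb G b k I = lincomb G b k J"
  unfolding lincomb_def
  by (rule finprod_mono_neutral_cong_right) (use assms in auto)

lemma lincomb_Un_disjoint:
  assumes "finite I" "finite J" "I \<inter> J = {}" "b ` (I \<union> J) \<subseteq> carrier G"
  shows "lincomb G b k (I \<union> J) = lincomb G b k I \<otimes> lincomb G b k J"
  unfolding lincomb_def
  by (rule finprod_Un_disjoint) (use assms in auto)

lemma lincomb_cong:
  assumes "b ` I \<subseteq> carrier G" "\<And>i. i \<in> I \<Longrightarrow> b' i [^] k' i = b i [^] k i"
  shows "lincomb G b' k' I = lincomb G b k I"
  unfolding lincomb_def by (rule finprod_cong') (use assms in auto)

lemma lincomb_reindex:
  assumes "b ` h ` I \<subseteq> carrier G" "inj_on h I"
  shows "lincomb G b k (h ` I) = lincomb G (b \<circ> h) (k \<circ> h) I"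
  unfolding lincomb_def o_def by (rule finprod_reindex) (use assms in auto)

lemma independent_family_mono:
  assumes "independent_family G b I" "J \<subseteq> I"
  shows "independent_family G b J"
  unfolding independent_family_def
proof (intro conjI allI impI)
  show "finite J" "b ` J \<subseteq> carrier G"
    using assms finite_subset[of J I] by (auto simp: independent_family_def)
  fix k
  assume k: "lincomb G b k J = \<one>"
  let ?k = "\<lambda>i. if i \<in> J then k i else 0"
  have "lincomb G b ?k I = lincomb G b ?k J"
    using assms by (intro lincomb_mono_neutral) (auto simp: independent_family_def)
  also have "\<dots> = lincomb G b k J"
    using assms by (intro lincomb_cong) (auto simp: independent_family_def)
  finally have "lincomb G b ?k I = \<one>"
    using k by simp
  then have "\<forall>i\<in>I. ?k i = 0"
    using assms(1) unfolding independent_family_def by blast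
  then show "\<forall>i\<in>J. k i = 0"
    using assms(2) by (metis subsetD)
qed

lemma independent_family_inj_on:
  assumes "independent_family G b I"
  shows "inj_on b I"
proof (rule inj_onI, rule ccontr)
  fix i j
  assume ij: "i \<in> I" "j \<in> I" "b i = b j" "i \<noteq> j"
  have ind: "independent_family G b {i, j}"
    using assms ij by (intro independent_family_mono[OF assms]) auto
  have bj: "b j \<in> carrier G"
    using assms ij by (auto simp: independent_family_def)
  have "lincomb G b (\<lambda>x. if x = i then 1 else -1) {i, j} = b i [^] (1::int) \<otimes> (b j [^] (-1::int) \<otimes> \<one>)"
    using ij bj by (simp add: lincomb_def del: int_pow_1)
  also have "b j [^] (-1::int) = inv (b j)"
    using bj int_pow_neg[of "b j" 1] by simp
  finally have "lincomb G b (\<lambda>x. if x = i then 1 else -1) {i, j} = \<one>"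
    using ij bj by simp
  with ind have "(\<lambda>x. if x = i then 1 else -1 :: int) i = 0"
    unfolding independent_family_def by blast
  then show False by simp
qed

lemma independent_family_imp_int_independent:
  assumes "independent_family G b I"
  shows "int_independent G (b ` I)" "card (b ` I) = card I"
proof -
  have inj: "inj_on b I" by (rule independent_family_inj_on[OF assms])
  then show "card (b ` I) = card I" by (rule card_image)
  show "int_independent G (b ` I)"
    unfolding int_independent_iff independent_family_def
  proof (intro conjI allI impI)
    show "finite (b ` I)" "id ` b ` I \<subseteq> carrier G"
      using assms by (auto simp: independent_family_def)
    fix k
    assume "lincomb G id k (b ` I) = \<one>"
    then have "lincomb G b (k \<circ> b) I = \<one>"
      using assms inj by (simp add: lincomb_reindex independent_family_def)
    then have "\<forall>i\<in>I. (k \<circ> b) i = 0"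
      using assms unfolding independent_family_def by blast
    then show "\<forall>i\<in>b ` I. k i = 0"
      by simp
  qed
qed

end

text \<open>The rank is taken relative to a subset of the carrier, so that kernels and images never have
  to be turned into groups of their own.\<close>

definition subset_rank :: "('a, 'b) monoid_scheme \<Rightarrow> 'a set \<Rightarrow> enat" where
  "subset_rank G S = (SUP B \<in> {B. int_independent G B \<and> B \<subseteq> S}. enat (card B))"

lemma subset_rank_ge: "int_independent G B \<Longrightarrow> B \<subseteq> S \<Longrightarrow> enat (card B) \<le> subset_rank G S"
  unfolding subset_rank_def by (rule SUP_upper) simp

lemma int_independent_empty: "int_independent G {}"
  by (simp add: int_independent_def)

text \<open>Were all independent sets smaller than n, the supremum would be at most n - 1. The case
  n = 0 is split off because of truncated subtraction.\<close>

lemma subset_rank_attained: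
  assumes "enat n \<le> subset_rank G S"
  shows "\<exists>B. int_independent G B \<and> B \<subseteq> S \<and> n \<le> card B"
proof (cases "n = 0")
  case True
  then show ?thesis using int_independent_empty by blast
next
  case False
  show ?thesis
  proof (rule ccontr)
    assume none: "\<nexists>B. int_independent G B \<and> B \<subseteq> S \<and> n \<le> card B"
    have "subset_rank G S \<le> enat (n - 1)"
      unfolding subset_rank_def
    proof (rule SUP_least)
      fix B assume "B \<in> {B. int_independent G B \<and> B \<subseteq> S}"
      then have "card B < n" using none by (auto simp: not_le[symmetric])
      then show "enat (card B) \<le> enat (n - 1)" by simp
    qed
    with assms have "enat n \<le> enat (n - 1)" by (rule order_trans)
    then show False using False by simp
  qed
qed

lemma (in comm_group) subset_rank_trivial:
  assumes "S \<subseteq> {\<one>}"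
  shows "subset_rank G S = 0"
proof -
  have "B = {}" if "int_independent G B" "B \<subseteq> S" for B
  proof (rule ccontr)
    assume "B \<noteq> {}"
    then have B: "B = {\<one>}" using assms that by auto
    have "finprod G (\<lambda>b. b [^] (1::int)) B = \<one>"
      unfolding B by (rule finprod_one_eqI) simp
    then have "\<forall>b\<in>B. (1::int) = 0"
      using that(1) unfolding int_independent_def by (elim conjE allE[of _ "\<lambda>_. 1"]) simp
    then show False using B by simp
  qed
  then have "{B. int_independent G B \<and> B \<subseteq> S} = {{}}"
    using int_independent_empty by auto
  then show ?thesis by (simp add: subset_rank_def enat_0)
qed

lemma (in group_hom) hom_lincomb:
  assumes "comm_group G" "comm_group H" "finite I" "b ` I \<subseteq> carrier G"
  shows "h (lincomb G b k I) = lincomb H (h \<circ> b) k I"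
proof -
  interpret cG: comm_group G by fact
  interpret cH: comm_group H by fact
  show ?thesis
    using assms(3,4)
  proof (induction I)
    case empty
    then show ?case by (simp add: lincomb_def)
  next
    case (insert i I)
    then have "(h \<circ> b) ` I \<subseteq> carrier H" by auto
    with insert show ?case
      by (simp add: cG.lincomb_insert cH.lincomb_insert cG.lincomb_closed hom_int_pow)
  qed
qed

text \<open>Rank-nullity without an exchange lemma: choose a maximal subset \<open>S\<close> of an independent set
  \<open>B\<close> whose image is independent; each element of \<open>B - S\<close> then yields an element
  of the kernel, and these are independent because each involves its own element of \<open>B - S\<close>.\<close>

lemma (in group_hom) independent_card_le_kernel_image:
  assumes "comm_group G" "comm_group H" and B: "int_independent G B"
  shows "enat (card B) \<le> subset_rank G (kernel G H h) + subset_rank H (h ` carrier G)"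
proof -
  interpret cG: comm_group G by fact
  interpret cH: comm_group H by fact
  have finB: "finite B" and BG: "B \<subseteq> carrier G"
    using B by (auto simp: int_independent_def)
  then have idB: "id ` B \<subseteq> carrier G" and hB: "h ` B \<subseteq> carrier H" by auto
  define \<S> where "\<S> = {S. S \<subseteq> B \<and> independent_family H h S}"
  have "finite \<S>" unfolding \<S>_def using finB by simp
  moreover have "{} \<in> \<S>" by (simp add: \<S>_def independent_family_def)
  ultimately obtain S where S: "S \<in> \<S>" and max: "\<And>T. T \<in> \<S> \<Longrightarrow> S \<subseteq> T \<Longrightarrow> S = T"
    using finite_has_maximal[of \<S>] by blast
  have SB: "S \<subseteq> B" and indS: "independent_family H h S"
    using S by (auto simp: \<S>_def)
  have ex: "\<exists>k. lincomb G id k B \<in> kernel G H h \<and> k b \<noteq> 0 \<and> (\<forall>x\<in>B - S. x \<noteq> b \<longrightarrow> k x = 0)"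
    if b: "b \<in> B - S" for b
  proof -
    have fin: "finite (insert b S)" and hS: "h ` insert b S \<subseteq> carrier H"
      using finB SB finite_subset[OF SB] b BG by auto
    have "\<not> independent_family H h (insert b S)"
    proof
      assume "independent_family H h (insert b S)"
      then have "insert b S \<in> \<S>" using b SB by (auto simp: \<S>_def)
      then have "S = insert b S" by (rule max) auto
      then show False using b by auto
    qed
    then obtain k i where k: "lincomb H h k (insert b S) = \<one>\<^bsub>H\<^esub>" and i: "i \<in> insert b S" "k i \<noteq> 0"
      unfolding independent_family_def using fin hS by blast
    have kb: "k b \<noteq> 0"
    proof
      assume kb: "k b = 0"
      have "lincomb H h k (insert b S) = lincomb H h k S"
        using fin hS kb by (intro cH.lincomb_mono_neutral) auto
      then have "\<forall>x\<in>S. k x = 0"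
        using indS k unfolding independent_family_def by simp
      then show False using i kb by auto
    qed
    let ?k = "\<lambda>x. if x \<in> insert b S then k x else 0"
    have "h (lincomb G id ?k B) = lincomb H h ?k B"
      using hom_lincomb[OF assms(1,2) finB idB] by simp
    also have "\<dots> = lincomb H h ?k (insert b S)"
      using finB SB b hB by (intro cH.lincomb_mono_neutral) auto
    also have "\<dots> = lincomb H h k (insert b S)"
      using hS by (intro cH.lincomb_cong) auto
    finally have "lincomb G id ?k B \<in> kernel G H h"
      using k cG.lincomb_closed[OF idB] by (simp add: kernel_def)
    then show ?thesis using kb by (intro exI[of _ ?k]) auto
  qed
  have "\<forall>b\<in>B - S. \<exists>k. lincomb G id k B \<in> kernel G H h \<and> k b \<noteq> 0 \<and> (\<forall>x\<in>B - S. x \<noteq> b \<longrightarrow> k x = 0)"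
    using ex by (rule ballI)
  then obtain k where kB: "\<forall>b\<in>B - S. lincomb G id (k b) B \<in> kernel G H h \<and> k b b \<noteq> 0 \<and>
      (\<forall>x\<in>B - S. x \<noteq> b \<longrightarrow> k b x = 0)"
    unfolding bchoice_iff by (elim exE)
  have k: "lincomb G id (k b) B \<in> kernel G H h" "k b b \<noteq> 0"
      "\<And>x. x \<in> B - S \<Longrightarrow> x \<noteq> b \<Longrightarrow> k b x = 0" if "b \<in> B - S" for b
    using bspec[OF kB that] by blast+
  let ?y = "\<lambda>b. lincomb G id (k b) B"
  have indy: "independent_family G ?y (B - S)"
    unfolding independent_family_def
  proof (intro conjI allI impI)
    show "finite (B - S)" using finB by simp
    show "?y ` (B - S) \<subseteq> carrier G" using cG.lincomb_closed[OF idB] by auto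
    fix n
    assume "lincomb G ?y n (B - S) = \<one>"
    then have "lincomb G id (\<lambda>x. \<Sum>b\<in>B - S. k b x * n b) B = \<one>"
      using cG.lincomb_lincomb[OF idB finB, of "B - S" k n] finB by simp
    then have 0: "(\<Sum>b\<in>B - S. k b x * n b) = 0" if "x \<in> B" for x
      using B that unfolding int_independent_iff independent_family_def
      by (elim conjE allE[of _ "\<lambda>x. \<Sum>b\<in>B - S. k b x * n b"]) simp
    show "\<forall>x\<in>B - S. n x = 0"
    proof
      fix x assume x: "x \<in> B - S"
      have "(\<Sum>b\<in>B - S. k b x * n b) = (\<Sum>b\<in>{x}. k b x * n b)"
        using finB x k(3) by (intro sum.mono_neutral_right) auto
      then show "n x = 0" using 0[of x] x k(2) by simp
    qed
  qed
  have "?y ` (B - S) \<subseteq> kernel G H h" using k(1) by auto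
  from subset_rank_ge[OF cG.independent_family_imp_int_independent(1)[OF indy] this]
  have "enat (card (B - S)) \<le> subset_rank G (kernel G H h)"
    using cG.independent_family_imp_int_independent(2)[OF indy] by simp
  moreover have "h ` S \<subseteq> h ` carrier G" using SB BG by auto
  from subset_rank_ge[OF cH.independent_family_imp_int_independent(1)[OF indS] this]
  have "enat (card S) \<le> subset_rank H (h ` carrier G)"
    using cH.independent_family_imp_int_independent(2)[OF indS] by simp
  moreover have "card B = card (B - S) + card S"
    using finB SB by (simp add: card_Diff_subset finite_subset card_mono)
  ultimately show ?thesis
    by (metis add_mono plus_enat_simps(1))
qed

text \<open>Preimages \<open>g y\<close> of the elements of L are adjoined to K. Applying
  \<open>h\<close> to a relation kills its part in the kernel, so independence of L removes the
  coefficients of the preimages; independence of K then removes the rest.\<close>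

lemma (in group_hom) independent_kernel_image_lift:
  assumes "comm_group G" "comm_group H"
    and K: "int_independent G K" "K \<subseteq> kernel G H h"
    and L: "int_independent H L" "L \<subseteq> h ` carrier G"
  shows "\<exists>B. int_independent G B \<and> card B = card K + card L"
proof -
  interpret cG: comm_group G by fact
  interpret cH: comm_group H by fact
  define g where "g = inv_into (carrier G) h"
  have g: "g y \<in> carrier G" "h (g y) = y" if "y \<in> L" for y
    using L(2) that by (auto simp: g_def inv_into_into f_inv_into_f)
  have fin: "finite K" "finite L" and KG: "K \<subseteq> carrier G" and LH: "L \<subseteq> carrier H"
    using K L by (auto simp: int_independent_def)
  have inj: "inj_on g L" using g(2) by (rule inj_on_inverseI)
  have gG: "g ` L \<subseteq> carrier G" using g(1) by auto
  have zero: "(\<forall>y\<in>L. k (g y) = 0)" if k: "h (lincomb G id k (g ` L)) = \<one>\<^bsub>H\<^esub>" for k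
  proof -
    have "h (lincomb G id k (g ` L)) = h (lincomb G g (k \<circ> g) L)"
      using gG inj by (subst cG.lincomb_reindex) auto
    also have "\<dots> = lincomb H (h \<circ> g) (k \<circ> g) L"
      using gG fin assms by (intro hom_lincomb) auto
    also have "\<dots> = lincomb H id (k \<circ> g) L"
      using g LH by (intro cH.lincomb_cong) auto
    finally show ?thesis
      using L(1) k unfolding int_independent_iff independent_family_def by auto
  qed
  have disj: "K \<inter> g ` L = {}"
  proof (rule ccontr)
    assume "K \<inter> g ` L \<noteq> {}"
    then obtain y where y: "y \<in> L" "g y \<in> K" by auto
    then have hg: "h (g y) = \<one>\<^bsub>H\<^esub>" using K(2) by (auto simp: kernel_def)
    let ?k = "\<lambda>x. if x = g y then 1 else (0::int)"
    have "lincomb G id ?k (g ` L) = lincomb G id ?k {g y}"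
      using gG fin y by (intro cG.lincomb_mono_neutral) auto
    also have "\<dots> = g y" using g(1)[OF y(1)] by (simp add: lincomb_def)
    finally have "\<forall>y\<in>L. ?k (g y) = 0" using hg by (intro zero) simp
    then show False using y by auto
  qed
  have "independent_family G id (K \<union> g ` L)"
    unfolding independent_family_def
  proof (intro conjI allI impI)
    show "finite (K \<union> g ` L)" "id ` (K \<union> g ` L) \<subseteq> carrier G" using fin KG gG by auto
    fix k
    assume k: "lincomb G id k (K \<union> g ` L) = \<one>"
    have split: "lincomb G id k (K \<union> g ` L) = lincomb G id k K \<otimes> lincomb G id k (g ` L)"
      using fin disj KG gG by (intro cG.lincomb_Un_disjoint) auto
    have cl: "lincomb G id k K \<in> carrier G" "lincomb G id k (g ` L) \<in> carrier G"
      using KG gG by (auto intro!: cG.lincomb_closed)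
    have "h (lincomb G id k K) = lincomb H h k K"
      using hom_lincomb[OF assms(1,2) fin(1), of id] KG by simp
    also have "\<dots> = lincomb H (\<lambda>_. \<one>\<^bsub>H\<^esub>) k K"
      using K(2) by (intro cH.lincomb_cong) (auto simp: kernel_def)
    also have "\<dots> = \<one>\<^bsub>H\<^esub>" by (simp add: lincomb_def)
    finally have hK: "h (lincomb G id k K) = \<one>\<^bsub>H\<^esub>" .
    have "h (lincomb G id k K \<otimes> lincomb G id k (g ` L)) = \<one>\<^bsub>H\<^esub>"
      using k split by simp
    then have "h (lincomb G id k (g ` L)) = \<one>\<^bsub>H\<^esub>" using hK cl by simp
    then have kL: "\<forall>y\<in>L. k (g y) = 0" by (rule zero)
    then have "lincomb G id k (g ` L) = \<one>" by (intro cG.lincomb_zero) auto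
    then have "lincomb G id k K = \<one>" using k split cl by simp
    then have "\<forall>x\<in>K. k x = 0"
      using K(1) unfolding int_independent_iff independent_family_def by blast
    with kL show "\<forall>x\<in>K \<union> g ` L. k x = 0" by auto
  qed
  moreover have "card (K \<union> g ` L) = card K + card L"
    using fin disj inj by (simp add: card_Un_disjoint card_image)
  ultimately show ?thesis by (auto simp: int_independent_iff)
qed

proposition (in group_hom) rank_nullity:
  assumes "comm_group G" "comm_group H"
  shows "subset_rank G (carrier G) = subset_rank G (kernel G H h) + subset_rank H (h ` carrier G)"
    (is "?g = ?k + ?i")
proof (rule antisym)
  show "?g \<le> ?k + ?i"
    unfolding subset_rank_def[of G "carrier G"]
    using independent_card_le_kernel_image[OF assms] by (intro SUP_least) simp
  \<comment> \<open>Both ranks may be infinite, so only finite lower bounds are added. An infinite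
    summand would then push a finite rank \<open>N\<close> of the group up to
    \<open>Suc N\<close>.\<close>
  have *: "enat (m + n) \<le> ?g" if m: "enat m \<le> ?k" and n: "enat n \<le> ?i" for m n
  proof -
    obtain K where K: "int_independent G K" "K \<subseteq> kernel G H h" "m \<le> card K"
      using subset_rank_attained[OF m] by blast
    obtain L where L: "int_independent H L" "L \<subseteq> h ` carrier G" "n \<le> card L"
      using subset_rank_attained[OF n] by blast
    obtain B where B: "int_independent G B" "card B = card K + card L"
      using independent_kernel_image_lift[OF assms K(1,2) L(1,2)] by blast
    then have "enat (card B) \<le> ?g"
      by (intro subset_rank_ge) (auto simp: int_independent_def)
    moreover have "enat (m + n) \<le> enat (card B)" using B K L by simp
    ultimately show ?thesis by (rule order_trans[rotated])
  qed
  show "?k + ?i \<le> ?g"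
  proof (cases ?g)
    case (enat N)
    have "?k \<noteq> \<infinity>"
    proof
      assume "?k = \<infinity>"
      then have "enat (Suc N + 0) \<le> ?g" by (intro *) (auto simp: enat_0)
      then show False using enat by simp
    qed
    moreover have "?i \<noteq> \<infinity>"
    proof
      assume "?i = \<infinity>"
      then have "enat (0 + Suc N) \<le> ?g" by (intro *) (auto simp: enat_0)
      then show False using enat by simp
    qed
    ultimately obtain m n where "?k = enat m" "?i = enat n" by auto
    then show ?thesis using *[of m n] by simp
  qed simp
qed

section \<open>Additivity of the Euler characteristic\<close>

text \<open>Detached from topology, so that the bookkeeping of an exact sequence becomes arithmetic
  of sequences in \<open>enat\<close>.\<close>

definition has_alternating_sum :: "(nat \<Rightarrow> enat) \<Rightarrow> int \<Rightarrow> bool" where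
  "has_alternating_sum b e \<longleftrightarrow> (\<forall>p. b p \<noteq> \<infinity>) \<and> finite {p. b p \<noteq> 0} \<and>
     e = (\<Sum>p | b p \<noteq> 0. (-1) ^ p * int (the_enat (b p)))"

lemma has_alternating_sum_iff:
  "has_alternating_sum b e \<longleftrightarrow>
     (\<exists>n N. b = (\<lambda>p. enat (n p)) \<and> (\<forall>p\<ge>N. n p = 0) \<and> e = (\<Sum>p<N. (-1) ^ p * int (n p)))"
proof
  assume "has_alternating_sum b e"
  then have fin: "\<And>p. b p \<noteq> \<infinity>" "finite {p. b p \<noteq> 0}"
    and e: "e = (\<Sum>p | b p \<noteq> 0. (-1) ^ p * int (the_enat (b p)))"
    by (auto simp: has_alternating_sum_def)
  obtain N where N: "\<And>p. b p \<noteq> 0 \<Longrightarrow> p < N"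
    using finite_nat_set_iff_bounded[of "{p. b p \<noteq> 0}"] fin(2) by auto
  have bn: "b = (\<lambda>p. enat (the_enat (b p)))"
  proof
    fix p
    show "b p = enat (the_enat (b p))" using fin(1)[of p] by (cases "b p") auto
  qed
  have "the_enat (b p) = 0" if "p \<ge> N" for p
    using N[of p] that by (cases "b p = 0") (auto simp: zero_enat_def)
  moreover have "e = (\<Sum>p<N. (-1) ^ p * int (the_enat (b p)))"
    unfolding e using N by (intro sum.mono_neutral_left) (auto simp: zero_enat_def)
  ultimately show "\<exists>n N. b = (\<lambda>p. enat (n p)) \<and> (\<forall>p\<ge>N. n p = 0) \<and> e = (\<Sum>p<N. (-1) ^ p * int (n p))"
    using bn by (intro exI[of _ "\<lambda>p. the_enat (b p)"] exI[of _ N]) simp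
next
  assume "\<exists>n N. b = (\<lambda>p. enat (n p)) \<and> (\<forall>p\<ge>N. n p = 0) \<and> e = (\<Sum>p<N. (-1) ^ p * int (n p))"
  then obtain n where "\<exists>N. b = (\<lambda>p. enat (n p)) \<and> (\<forall>p\<ge>N. n p = 0) \<and> e = (\<Sum>p<N. (-1) ^ p * int (n p))" ..
  then obtain N where n': "b = (\<lambda>p. enat (n p)) \<and> (\<forall>p\<ge>N. n p = 0) \<and> e = (\<Sum>p<N. (-1) ^ p * int (n p))" ..
  have n: "b = (\<lambda>p. enat (n p))" "\<And>p. p \<ge> N \<Longrightarrow> n p = 0" "e = (\<Sum>p<N. (-1) ^ p * int (n p))"
    using n' by blast+
  have sub: "{p. b p \<noteq> 0} \<subseteq> {..<N}"
  proof
    fix p assume "p \<in> {p. b p \<noteq> 0}"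
    then have "n p \<noteq> 0" using n(1) by (simp add: zero_enat_def)
    then show "p \<in> {..<N}" using n(2)[of p] by (cases "p < N") auto
  qed
  then have "finite {p. b p \<noteq> 0}" by (rule finite_subset) simp
  moreover have "(\<Sum>p | b p \<noteq> 0. (-1) ^ p * int (the_enat (b p))) = e"
    unfolding n(3) using sub by (intro sum.mono_neutral_cong_left) (auto simp: n(1) zero_enat_def)
  ultimately show "has_alternating_sum b e"
    using n(1) by (simp add: has_alternating_sum_def)
qed

lemma has_alternating_sumI:
  assumes "\<And>p. p \<ge> N \<Longrightarrow> n p = 0"
  shows "has_alternating_sum (\<lambda>p. enat (n p)) (\<Sum>p<N. (-1) ^ p * int (n p))"
  using assms unfolding has_alternating_sum_iff by blast

lemma alternating_telescope:
  fixes c :: "nat \<Rightarrow> nat"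
  shows "(\<Sum>p<N. (-1) ^ p * (int (c p) + int (c (Suc p)))) = int (c 0) - (-1) ^ N * int (c N)"
  by (induction N) (simp_all add: algebra_simps)

text \<open>The ranks in a long exact sequence: \<open>\<alpha>\<close>, \<open>\<beta>\<close>, \<open>\<gamma>\<close> are the ranks of the three kinds of
  maps.\<close>

lemma alternating_sum_exact:
  assumes b: "\<And>p. b p = \<alpha> p + \<beta> p" and c: "\<And>p. c p = \<beta> p + \<gamma> p"
    and a: "\<And>p. a p = \<gamma> (Suc p) + \<alpha> p" and \<gamma>0: "\<gamma> 0 = 0"
    and ex: "\<exists>n N. \<alpha> = (\<lambda>p. enat (n p)) \<and> (\<forall>p\<ge>N. n p = 0)"
      "\<exists>n N. \<beta> = (\<lambda>p. enat (n p)) \<and> (\<forall>p\<ge>N. n p = 0)"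
      "\<exists>n N. \<gamma> = (\<lambda>p. enat (n p)) \<and> (\<forall>p\<ge>N. n p = 0)"
  shows "\<exists>x y. has_alternating_sum a x \<and> has_alternating_sum c y \<and> has_alternating_sum b (x + y)"
proof -
  obtain A N1 where A: "\<alpha> = (\<lambda>p. enat (A p))" "\<forall>p\<ge>N1. A p = 0" using ex(1) by blast
  obtain B N2 where B: "\<beta> = (\<lambda>p. enat (B p))" "\<forall>p\<ge>N2. B p = 0" using ex(2) by blast
  obtain C N3 where C: "\<gamma> = (\<lambda>p. enat (C p))" "\<forall>p\<ge>N3. C p = 0" using ex(3) by blast
  define N where "N = N1 + N2 + N3"
  have z: "A p = 0" "B p = 0" "C p = 0" if "p \<ge> N" for p
    using A(2) B(2) C(2) that by (auto simp: N_def)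
  have C0: "C 0 = 0" using \<gamma>0 C(1) by (simp add: zero_enat_def)
  let ?x = "\<Sum>p<N. (-1) ^ p * int (C (Suc p) + A p)"
  let ?y = "\<Sum>p<N. (-1) ^ p * int (B p + C p)"
  let ?s = "\<Sum>p<N. (-1) ^ p * int (A p + B p)"
  have "a = (\<lambda>p. enat (C (Suc p) + A p))" "c = (\<lambda>p. enat (B p + C p))" "b = (\<lambda>p. enat (A p + B p))"
    using a b c A(1) B(1) C(1) by auto
  moreover have "has_alternating_sum (\<lambda>p. enat (C (Suc p) + A p)) ?x"
    by (rule has_alternating_sumI) (simp add: z)
  moreover have "has_alternating_sum (\<lambda>p. enat (B p + C p)) ?y"
    by (rule has_alternating_sumI) (simp add: z)
  moreover have "has_alternating_sum (\<lambda>p. enat (A p + B p)) ?s"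
    by (rule has_alternating_sumI) (simp add: z)
  \<comment> \<open>The ranks \<open>A\<close> and \<open>B\<close> cancel in each degree. What
    remains telescopes to the terms of \<open>C\<close> at 0 and at \<open>N\<close>, both
    zero.\<close>
  moreover have "?x + ?y - ?s = (\<Sum>p<N. (-1) ^ p * (int (C p) + int (C (Suc p))))"
    unfolding sum.distrib[symmetric] sum_subtractf[symmetric]
    by (rule sum.cong) (simp_all add: algebra_simps)
  then have "?s = ?x + ?y"
    unfolding alternating_telescope using C0 z(3)[of N] by simp
  ultimately have "has_alternating_sum a ?x" "has_alternating_sum c ?y" "has_alternating_sum b (?x + ?y)"
    by (simp_all only:)
  then show ?thesis by (intro exI conjI)
qed

lemma has_alternating_sum_unique:
  "has_alternating_sum b x \<Longrightarrow> has_alternating_sum b y \<Longrightarrow> x = y"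
  by (simp add: has_alternating_sum_def)

lemma finite_support_summand:
  fixes b :: "nat \<Rightarrow> enat"
  assumes "has_alternating_sum b x" "\<And>p. a p \<le> b p"
  shows "\<exists>n N. a = (\<lambda>p. enat (n p)) \<and> (\<forall>p\<ge>N. n p = 0)"
proof -
  obtain n N where n: "b = (\<lambda>p. enat (n p))" "\<forall>p\<ge>N. n p = 0"
    using assms(1) unfolding has_alternating_sum_iff by blast
  have "\<exists>m. a p = enat m \<and> m \<le> n p" for p
    using assms(2)[of p] n(1) by (cases "a p") auto
  then obtain m where "\<And>p. a p = enat (m p)" "\<And>p. m p \<le> n p" by metis
  then have "a = (\<lambda>p. enat (m p))" "\<forall>p\<ge>N. m p = 0"
    using n(2) by (auto, metis le_zero_eq)
  then show ?thesis by blast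
qed

lemma alternating_sum_mono:
  fixes b :: "nat \<Rightarrow> enat"
  assumes "has_alternating_sum b x" "\<And>p. a p \<le> b p"
  shows "\<exists>y. has_alternating_sum a y"
  using finite_support_summand[OF assms] unfolding has_alternating_sum_iff by blast

text \<open>Finiteness passes from the outer terms to the middle one because \<open>\<alpha>\<close>
  is bounded by \<open>a\<close>, while \<open>\<beta>\<close> and \<open>\<gamma>\<close> are
  bounded by \<open>c\<close>.\<close>

lemma alternating_sum_exact_middle:
  assumes b: "\<And>p. b p = \<alpha> p + \<beta> p" and c: "\<And>p. c p = \<beta> p + \<gamma> p"
    and a: "\<And>p. a p = \<gamma> (Suc p) + \<alpha> p" and \<gamma>0: "\<gamma> 0 = 0"
    and "has_alternating_sum a x" "has_alternating_sum c y"
  shows "has_alternating_sum b (x + y)"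
proof -
  have "\<exists>x y. has_alternating_sum a x \<and> has_alternating_sum c y \<and> has_alternating_sum b (x + y)"
  proof (rule alternating_sum_exact[OF b c a \<gamma>0])
    show "\<exists>n N. \<alpha> = (\<lambda>p. enat (n p)) \<and> (\<forall>p\<ge>N. n p = 0)"
      by (rule finite_support_summand[OF assms(5)]) (simp add: a)
    show "\<exists>n N. \<beta> = (\<lambda>p. enat (n p)) \<and> (\<forall>p\<ge>N. n p = 0)"
      by (rule finite_support_summand[OF assms(6)]) (simp add: c)
    show "\<exists>n N. \<gamma> = (\<lambda>p. enat (n p)) \<and> (\<forall>p\<ge>N. n p = 0)"
      by (rule finite_support_summand[OF assms(6)]) (simp add: c)
  qed
  then show ?thesis using assms(5,6) has_alternating_sum_unique by metis
qed

lemma alternating_sum_exact_right: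
  assumes b: "\<And>p. b p = \<alpha> p + \<beta> p" and c: "\<And>p. c p = \<beta> p + \<gamma> p"
    and a: "\<And>p. a p = \<gamma> (Suc p) + \<alpha> p" and \<gamma>0: "\<gamma> 0 = 0"
    and "has_alternating_sum a x" "has_alternating_sum b y"
  shows "has_alternating_sum c (y - x)"
proof -
  have "\<exists>x y. has_alternating_sum a x \<and> has_alternating_sum c y \<and> has_alternating_sum b (x + y)"
  proof (rule alternating_sum_exact[OF b c a \<gamma>0])
    show "\<exists>n N. \<alpha> = (\<lambda>p. enat (n p)) \<and> (\<forall>p\<ge>N. n p = 0)"
      by (rule finite_support_summand[OF assms(6)]) (simp add: b)
    show "\<exists>n N. \<beta> = (\<lambda>p. enat (n p)) \<and> (\<forall>p\<ge>N. n p = 0)"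
      by (rule finite_support_summand[OF assms(6)]) (simp add: b)
    \<comment> \<open>The sequence \<open>a\<close> bounds \<open>\<gamma>\<close> only from degree
      one on. The entry in degree zero comes from \<open>\<gamma> 0 = 0\<close>, whence the bound
      \<open>Suc N\<close> below.\<close>
    have "\<exists>n N. (\<lambda>p. \<gamma> (Suc p)) = (\<lambda>p. enat (n p)) \<and> (\<forall>p\<ge>N. n p = 0)"
      by (rule finite_support_summand[OF assms(5)]) (simp add: a)
    then obtain n N where n: "\<And>p. \<gamma> (Suc p) = enat (n p)" "\<And>p. p \<ge> N \<Longrightarrow> n p = 0" by metis
    have "\<gamma> p = enat (case p of 0 \<Rightarrow> 0 | Suc q \<Rightarrow> n q)" for p
      using n(1) \<gamma>0 by (cases p) (auto simp: zero_enat_def)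
    moreover have "\<forall>p\<ge>Suc N. (case p of 0 \<Rightarrow> 0 | Suc q \<Rightarrow> n q) = 0"
      using n(2) by (auto split: nat.split)
    ultimately show "\<exists>n N. \<gamma> = (\<lambda>p. enat (n p)) \<and> (\<forall>p\<ge>N. n p = 0)" by blast
  qed
  then obtain x' y' where *: "has_alternating_sum a x'" "has_alternating_sum c y'"
      "has_alternating_sum b (x' + y')" by blast
  have "x' = x" "x' + y' = y"
    using * assms(5,6) has_alternating_sum_unique by blast+
  then show ?thesis using *(2) by auto
qed

section \<open>Ranks of singular homology groups\<close>

definition homology_rank :: "int \<Rightarrow> 'a topology \<Rightarrow> 'a set \<Rightarrow> enat" where
  "homology_rank p X S = subset_rank (relative_homology_group p X S) (carrier (relative_homology_group p X S))"

lemma betti_number_eq: "betti_number p X = homology_rank (int p) X {}"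
proof -
  have "{B. int_independent (homology_group (int p) X) B} = {B. int_independent (homology_group (int p) X) B
      \<and> B \<subseteq> carrier (homology_group (int p) X)}"
    by (auto simp: int_independent_def)
  then show ?thesis
    by (simp only: betti_number_def homology_rank_def subset_rank_def)
qed

lemma has_euler_characteristic_iff:
  "has_euler_characteristic X e \<longleftrightarrow> has_alternating_sum (\<lambda>p. homology_rank (int p) X {}) e"
  by (simp add: has_euler_characteristic_def has_alternating_sum_def betti_number_eq)

definition finite_type :: "'a topology \<Rightarrow> bool" where
  "finite_type X \<longleftrightarrow> (\<exists>e. has_euler_characteristic X e)"

lemma homology_subset_rank_trivial:
  "A \<subseteq> {\<one>\<^bsub>relative_homology_group p X S\<^esub>} \<Longrightarrow> subset_rank (relative_homology_group p X S) A = 0"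
  by (rule comm_group.subset_rank_trivial[OF abelian_relative_homology_group])

lemma homology_rank_trivial:
  assumes "trivial_group (relative_homology_group p X S)"
  shows "homology_rank p X S = 0"
  unfolding homology_rank_def
  by (rule homology_subset_rank_trivial) (use assms in \<open>simp add: trivial_group_def\<close>)

lemma group_hom_homology:
  assumes "f \<in> hom (relative_homology_group p X S) (relative_homology_group q Y T)"
  shows "group_hom (relative_homology_group p X S) (relative_homology_group q Y T) f"
  using assms by (simp add: group_hom_def group_hom_axioms_def)

lemma homology_rank_nullity:
  assumes "f \<in> hom (relative_homology_group p X S) (relative_homology_group q Y T)"
  shows "homology_rank p X S = subset_rank (relative_homology_group p X S)
           (kernel (relative_homology_group p X S) (relative_homology_group q Y T) f)
         + subset_rank (relative_homology_group q Y T) (f ` carrier (relative_homology_group p X S))"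
  unfolding homology_rank_def
  using group_hom.rank_nullity[OF group_hom_homology[OF assms]] by simp

lemma subset_rank_mono: "S \<subseteq> T \<Longrightarrow> subset_rank G S \<le> subset_rank G T"
  unfolding subset_rank_def by (rule SUP_subset_mono) auto

lemma homology_rank_inj_le:
  assumes f: "f \<in> hom (relative_homology_group p X S) (relative_homology_group q Y T)"
    and "inj_on f (carrier (relative_homology_group p X S))"
  shows "homology_rank p X S \<le> homology_rank q Y T"
proof -
  interpret group_hom "relative_homology_group p X S" "relative_homology_group q Y T" f
    by (rule group_hom_homology[OF f])
  have "kernel (relative_homology_group p X S) (relative_homology_group q Y T) f \<subseteq> {\<one>\<^bsub>relative_homology_group p X S\<^esub>}"
    using assms(2) inj_on_one_iff unfolding kernel_def by blast
  from homology_subset_rank_trivial[OF this]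
  have "homology_rank p X S = subset_rank (relative_homology_group q Y T) (f ` carrier (relative_homology_group p X S))"
    unfolding homology_rank_nullity[OF f] by simp
  also have "\<dots> \<le> homology_rank q Y T"
    unfolding homology_rank_def by (rule subset_rank_mono) auto
  finally show ?thesis .
qed

lemma homology_rank_iso:
  assumes "f \<in> iso (relative_homology_group p X S) (relative_homology_group q Y T)"
  shows "homology_rank p X S = homology_rank q Y T"
proof (rule antisym)
  show "homology_rank p X S \<le> homology_rank q Y T"
    using assms by (intro homology_rank_inj_le) (auto simp: iso_def bij_betw_def)
  have "inv_into (carrier (relative_homology_group p X S)) f
    \<in> iso (relative_homology_group q Y T) (relative_homology_group p X S)"
    using assms by (simp add: group.iso_set_sym)
  then show "homology_rank q Y T \<le> homology_rank p X S"
    by (intro homology_rank_inj_le) (auto simp: iso_def bij_betw_def)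
qed

lemma homology_rank_homotopy_equivalent:
  assumes "X homotopy_equivalent_space Y"
  shows "homology_rank p X {} = homology_rank p Y {}"
  using homotopy_equivalent_space_imp_isomorphic_homology_groups[OF assms, of p]
  by (auto simp: is_iso_def intro: homology_rank_iso)

lemma has_euler_characteristic_homotopy_equivalent:
  "X homotopy_equivalent_space Y \<Longrightarrow> has_euler_characteristic X e \<longleftrightarrow> has_euler_characteristic Y e"
  by (simp add: has_euler_characteristic_iff homology_rank_homotopy_equivalent)

text \<open>The identity on the homology of Y factors through the homology of P. So the map induced
  by \<open>f\<close> is injective, and the ranks for Y are bounded by those for P.\<close>

lemma finite_type_dominated:
  assumes f: "continuous_map Y P f" and g: "continuous_map P Y g"
    and gf: "homotopic_with (\<lambda>_. True) Y Y (g \<circ> f) id" and P: "finite_type P"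
  shows "finite_type Y"
proof -
  have "homology_rank p Y {} \<le> homology_rank p P {}" for p
  proof (rule homology_rank_inj_le)
    show "hom_induced p Y {} P {} f \<in> hom (homology_group p Y) (homology_group p P)"
      by (rule hom_induced_hom)
    show "inj_on (hom_induced p Y {} P {} f) (carrier (homology_group p Y))"
    proof (rule inj_on_inverseI)
      fix x assume "x \<in> carrier (homology_group p Y)"
      then show "hom_induced p P {} Y {} g (hom_induced p Y {} P {} f x) = x"
        using homology_homotopy_empty[OF gf, of p] f g
        by (simp add: hom_induced_compose' hom_induced_id)
    qed
  qed
  then show ?thesis
    using P alternating_sum_mono[of "\<lambda>p. homology_rank (int p) P {}" _ "\<lambda>p. homology_rank (int p) Y {}"]
    unfolding finite_type_def has_euler_characteristic_iff by blast
qed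

text \<open>Rank-nullity at the three terms of the long exact sequence of the pair:
  \<open>\<alpha>\<close>, \<open>\<beta>\<close>, \<open>\<gamma>\<close> are the ranks of the
  images of the inclusion, of the map to relative homology and of the boundary. Since
  \<open>\<gamma> p\<close> lives in degree p - 1, \<open>\<gamma> 0\<close> is the rank of a subset
  of the trivial group in degree -1.\<close>

lemma long_exact_ranks:
  obtains \<alpha> \<beta> \<gamma> :: "nat \<Rightarrow> enat" where
    "\<And>p. homology_rank (int p) X {} = \<alpha> p + \<beta> p"
    "\<And>p. homology_rank (int p) X S = \<beta> p + \<gamma> p"
    "\<And>p. homology_rank (int p) (subtopology X S) {} = \<gamma> (Suc p) + \<alpha> p"
    "\<gamma> 0 = 0"
proof -
  let ?i = "\<lambda>p. hom_induced p (subtopology X S) {} X {} id"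
  let ?j = "\<lambda>p. hom_induced p X {} X S id"
  let ?d = "\<lambda>p. hom_boundary p X S"
  let ?A = "\<lambda>p. homology_group p (subtopology X S)"
  let ?B = "\<lambda>p. homology_group p X"
  let ?C = "\<lambda>p. relative_homology_group p X S"
  have kj: "kernel (?B p) (?C p) (?j p) = ?i p ` carrier (?A p)" for p
    using homology_exactness_axiom_3[of p X S] by simp
  have kd: "kernel (?C p) (?A (p - 1)) (?d p) = ?j p ` carrier (?B p)" for p
    using homology_exactness_axiom_1[of p X S] by simp
  have ki: "kernel (?A p) (?B p) (?i p) = ?d (p + 1) ` carrier (?C (p + 1))" for p
    using homology_exactness_axiom_2[of "p + 1" X S] by simp
  define \<alpha> where "\<alpha> p = subset_rank (?B (int p)) (?i (int p) ` carrier (?A (int p)))" for p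
  define \<beta> where "\<beta> p = subset_rank (?C (int p)) (?j (int p) ` carrier (?B (int p)))" for p
  define \<gamma> where "\<gamma> p = subset_rank (?A (int p - 1)) (?d (int p) ` carrier (?C (int p)))" for p
  show thesis
  proof (rule that[of \<alpha> \<beta> \<gamma>])
    show "homology_rank (int p) X {} = \<alpha> p + \<beta> p" for p
      using homology_rank_nullity[OF hom_induced_hom[of "int p" X "{}" X S id]]
      by (simp add: kj \<alpha>_def \<beta>_def)
    show "homology_rank (int p) X S = \<beta> p + \<gamma> p" for p
      using homology_rank_nullity[OF hom_boundary_hom[of "int p" X S]]
      by (simp add: kd \<beta>_def \<gamma>_def)
    show "homology_rank (int p) (subtopology X S) {} = \<gamma> (Suc p) + \<alpha> p" for p
      using homology_rank_nullity[OF hom_induced_hom[of "int p" "subtopology X S" "{}" X "{}" id]]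
      by (simp add: ki \<alpha>_def \<gamma>_def add.commute)
    have "?d 0 ` carrier (?C 0) \<subseteq> carrier (?A (- 1))"
      by (intro image_subsetI) (use hom_boundary_carrier[of 0 X S] in simp)
    also have "\<dots> = {\<one>\<^bsub>?A (- 1)\<^esub>}"
      using trivial_relative_homology_group[of "-1" "subtopology X S" "{}"] by (simp add: trivial_group_def)
    finally show "\<gamma> 0 = 0"
      unfolding \<gamma>_def by (simp add: homology_subset_rank_trivial)
  qed
qed

text \<open>Excision identifies the homology of the pair (T, S \<inter> T) with that of (S \<union>
  T, S). The long exact sequence of the first pair gives t - u for the relative homology, and that
  of the second pair adds s.\<close>

theorem euler_characteristic_Un:
  assumes "openin X S" "openin X T"
    and S: "has_euler_characteristic (subtopology X S) s"
    and T: "has_euler_characteristic (subtopology X T) t"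
    and ST: "has_euler_characteristic (subtopology X (S \<inter> T)) u"
  shows "has_euler_characteristic (subtopology X (S \<union> T)) (s + t - u)"
proof -
  let ?Y = "subtopology X (S \<union> T)"
  have sub: "S \<subseteq> topspace X" "T \<subseteq> topspace X" using assms(1,2) openin_subset by auto
  have top: "topspace ?Y = S \<union> T" using sub by auto
  have YS: "subtopology ?Y S = subtopology X S" and YT: "subtopology ?Y T = subtopology X T"
    by (simp_all add: subtopology_subtopology Int_absorb1)
  have openS: "openin ?Y S" and openT: "openin ?Y T"
    using assms(1,2) by (auto simp: openin_subtopology_alt)
  have excision: "homology_rank p (subtopology X T) (S \<inter> T) = homology_rank p ?Y S" for p
  proof -
    \<comment> \<open>The excised set is the complement of T: it is closed and lies in the open set
      S.\<close>
    let ?U = "topspace ?Y - T"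
    have "closedin ?Y ?U" using openT by (rule openin_closedin_eq[THEN iffD1, THEN conjunct2])
    then have "?Y closure_of ?U \<subseteq> ?Y interior_of S"
      using openS by (auto simp: closure_of_closedin interior_of_openin top)
    from homology_excision_axiom[OF this, of "topspace ?Y" p]
    have "hom_induced p (subtopology ?Y (topspace ?Y - ?U)) (S - ?U) (subtopology ?Y (topspace ?Y)) S id
      \<in> iso (relative_homology_group p (subtopology ?Y (topspace ?Y - ?U)) (S - ?U))
          (relative_homology_group p (subtopology ?Y (topspace ?Y)) S)"
      using top by auto
    moreover have "topspace ?Y - ?U = T" "S - ?U = S \<inter> T" using top by auto
    ultimately show ?thesis
      using homology_rank_iso by (metis YT subtopology_topspace)
  qed
  have TST: "subtopology (subtopology X T) (S \<inter> T) = subtopology X (S \<inter> T)"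
    by (simp add: subtopology_subtopology Int_absorb1)
  have "has_alternating_sum (\<lambda>p. homology_rank (int p) (subtopology X T) (S \<inter> T)) (t - u)"
  proof (rule long_exact_ranks[of "subtopology X T" "S \<inter> T"])
    fix \<alpha> \<beta> \<gamma> :: "nat \<Rightarrow> enat"
    assume "\<And>p. homology_rank (int p) (subtopology X T) {} = \<alpha> p + \<beta> p"
      "\<And>p. homology_rank (int p) (subtopology X T) (S \<inter> T) = \<beta> p + \<gamma> p"
      "\<And>p. homology_rank (int p) (subtopology (subtopology X T) (S \<inter> T)) {} = \<gamma> (Suc p) + \<alpha> p"
      "\<gamma> 0 = 0"
    from alternating_sum_exact_right[OF this] show ?thesis
      using T ST by (simp only: has_euler_characteristic_iff TST)
  qed
  then have rel: "has_alternating_sum (\<lambda>p. homology_rank (int p) ?Y S) (t - u)"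
    by (simp add: excision)
  have "has_alternating_sum (\<lambda>p. homology_rank (int p) ?Y {}) (s + (t - u))"
  proof (rule long_exact_ranks[of ?Y S])
    fix \<alpha> \<beta> \<gamma> :: "nat \<Rightarrow> enat"
    assume "\<And>p. homology_rank (int p) ?Y {} = \<alpha> p + \<beta> p"
      "\<And>p. homology_rank (int p) ?Y S = \<beta> p + \<gamma> p"
      "\<And>p. homology_rank (int p) (subtopology ?Y S) {} = \<gamma> (Suc p) + \<alpha> p"
      "\<gamma> 0 = 0"
    from alternating_sum_exact_middle[OF this] show ?thesis
      using S rel by (simp only: has_euler_characteristic_iff YS)
  qed
  then show ?thesis by (simp add: has_euler_characteristic_iff algebra_simps)
qed

section \<open>Spaces with homology of finite rank\<close>

lemma has_euler_characteristic_empty: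
  assumes "topspace X = {}"
  shows "has_euler_characteristic X 0"
proof -
  have "homology_rank p X {} = 0" for p
    using assms by (intro homology_rank_trivial trivial_homology_group_empty)
  then show ?thesis by (simp add: has_euler_characteristic_iff has_alternating_sum_def)
qed

lemma subset_rank_integer_group: "subset_rank integer_group (carrier integer_group) \<le> 1"
proof -
  have "card B \<le> 1" if B: "int_independent integer_group B" for B
  proof (rule ccontr)
    assume "\<not> card B \<le> 1"
    then obtain x y where xy: "x \<in> B" "y \<in> B" "x \<noteq> y"
      using card_le_Suc0_iff_eq[of B] B by (auto simp: int_independent_def)
    interpret comm_group integer_group by (rule abelian_integer_group)
    have "independent_family integer_group id {x, y}"
      by (rule independent_family_mono[of id B]) (use B xy in \<open>auto simp: int_independent_iff\<close>)
    \<comment> \<open>Any two integers satisfy x y - y x = 0, a relation whose coefficients do not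
      both vanish when x and y differ.\<close>
    moreover have "lincomb integer_group id (\<lambda>z. if z = x then y else - x) {x, y} = \<one>\<^bsub>integer_group\<^esub>"
      using xy by (simp add: lincomb_def)
    ultimately have "\<forall>z\<in>{x, y}. (if z = x then y else - x) = 0"
      unfolding independent_family_def by blast
    then show False using xy by auto
  qed
  then show ?thesis
    unfolding subset_rank_def by (intro SUP_least) (auto simp: one_enat_def)
qed

text \<open>Comparison with a point bounds the rank by one in degree zero and by zero above; upper
  bounds are enough for finite type.\<close>

lemma finite_type_contractible:
  assumes "contractible_space X"
  shows "finite_type X"
proof (cases "topspace X = {}")
  case True
  then show ?thesis using has_euler_characteristic_empty finite_type_def by blast
next
  case False
  have "homology_rank (int p) X {} \<le> (if p = 0 then 1 else 0)" for p
  proof (cases p)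
    case 0
    have "homology_group 0 X \<cong> integer_group"
      using assms False contractible_imp_path_connected_space
      by (intro isomorphic_integer_zeroth_homology_group) auto
    then obtain h where h: "h \<in> iso (homology_group 0 X) integer_group" by (auto simp: is_iso_def)
    interpret group_hom "homology_group 0 X" integer_group h
      using h by (simp add: group_hom_def group_hom_axioms_def iso_def)
    have "kernel (homology_group 0 X) integer_group h \<subseteq> {\<one>\<^bsub>homology_group 0 X\<^esub>}"
      using h inj_on_one_iff unfolding kernel_def iso_def bij_betw_def by blast
    then have "subset_rank (homology_group 0 X) (kernel (homology_group 0 X) integer_group h) = 0"
      by (rule homology_subset_rank_trivial)
    moreover have "h ` carrier (homology_group 0 X) = carrier integer_group"
      using h by (simp add: iso_def bij_betw_def)
    ultimately have "homology_rank 0 X {} = subset_rank integer_group (carrier integer_group)"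
      unfolding homology_rank_def using rank_nullity abelian_integer_group by simp
    then show ?thesis using 0 subset_rank_integer_group by simp
  next
    case (Suc n)
    obtain a where a: "a \<in> topspace X" "X homotopy_equivalent_space (subtopology X {a})"
      using assms False contractible_eq_homotopy_equivalent_singleton_subtopology[of X] by auto
    have "homology_rank (int p) X {} = homology_rank (int p) (subtopology X {a}) {}"
      by (rule homology_rank_homotopy_equivalent[OF a(2)])
    also have "\<dots> = 0"
      using Suc a(1) by (intro homology_rank_trivial homology_dimension_axiom[of _ a]) auto
    finally show ?thesis using Suc by simp
  qed
  moreover have "\<exists>e. has_alternating_sum (\<lambda>p. if p = 0 then 1 else 0) e"
    using has_alternating_sumI[of 1 "\<lambda>p. if p = 0 then 1 else 0"]
    by (auto simp: one_enat_def zero_enat_def if_distrib[of enat] cong: if_cong)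
  then obtain e where "has_alternating_sum (\<lambda>p. if p = 0 then 1 else 0) e" ..
  ultimately show ?thesis
    unfolding finite_type_def has_euler_characteristic_iff by (rule alternating_sum_mono[rotated])
qed

text \<open>Inclusion-exclusion, splitting off one set A: the intersection of A with the union of
  the others is a union of fewer members of the intersection-closed \<open>\<C>\<close>. The
  induction is on the cardinality because the intersected family is in general no subfamily of
  F.\<close>

lemma finite_type_Union:
  assumes \<C>: "\<And>A. A \<in> \<C> \<Longrightarrow> openin X A" "\<And>A. A \<in> \<C> \<Longrightarrow> contractible_space (subtopology X A)"
      "\<And>A B. A \<in> \<C> \<Longrightarrow> B \<in> \<C> \<Longrightarrow> A \<inter> B \<in> \<C>"
    and "finite F" "F \<subseteq> \<C>"
  shows "finite_type (subtopology X (\<Union>F))"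
  using assms(4,5)
proof (induction "card F" arbitrary: F rule: less_induct)
  case less
  show ?case
  proof (cases "F = {}")
    case True
    then show ?thesis
      using has_euler_characteristic_empty[of "subtopology X (\<Union>F)"] by (auto simp: finite_type_def)
  next
    case False
    then obtain A where A: "A \<in> F" by blast
    define F' where "F' = F - {A}"
    have F': "finite F'" "F' \<subseteq> \<C>" "card F' < card F" "\<Union>F = A \<union> \<Union>F'"
      using less.prems A card_Diff1_less[of F A] by (auto simp: F'_def)
    have AC: "A \<in> \<C>" using A less.prems by blast
    have "finite_type (subtopology X (\<Union>F'))"
      using less.hyps[OF F'(3,1,2)] .
    moreover have "finite_type (subtopology X (\<Union>((\<inter>) A ` F')))"
    proof (rule less.hyps)
      show "card ((\<inter>) A ` F') < card F"
        using card_image_le[OF F'(1), of "(\<inter>) A"] F'(3) by simp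
      show "finite ((\<inter>) A ` F')" using F'(1) by simp
      show "(\<inter>) A ` F' \<subseteq> \<C>" using F'(2) AC \<C>(3) by blast
    qed
    moreover have "\<Union>((\<inter>) A ` F') = A \<inter> \<Union>F'" by auto
    moreover have "finite_type (subtopology X A)"
      using \<C>(2)[OF AC] by (rule finite_type_contractible)
    moreover have "openin X A" "openin X (\<Union>F')"
      using \<C>(1) AC F'(2) by auto
    ultimately show ?thesis
      unfolding finite_type_def F'(4) using euler_characteristic_Un by metis
  qed
qed

section \<open>Spaces deformable to compact subsets\<close>

lemma homotopic_with_top_of_setI:
  fixes h :: "real \<times> 'a::topological_space \<Rightarrow> 'b::topological_space"
  assumes "continuous_on ({0..1} \<times> X) h" "\<And>t x. t \<in> {0..1} \<Longrightarrow> x \<in> X \<Longrightarrow> h (t, x) \<in> Y"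
    and "\<And>x. x \<in> X \<Longrightarrow> h (0, x) = p x" "\<And>x. x \<in> X \<Longrightarrow> h (1, x) = q x"
  shows "homotopic_with (\<lambda>_. True) (top_of_set X) (top_of_set Y) p q"
proof -
  have "\<exists>h. continuous_map (prod_topology (top_of_set {0..1::real}) (top_of_set X)) (top_of_set Y) h \<and>
      (\<forall>x\<in>topspace (top_of_set X). h (0, x) = p x) \<and> (\<forall>x\<in>topspace (top_of_set X). h (1, x) = q x)"
    using assms by (intro exI[of _ h]) auto
  then show ?thesis
    using homotopic_with[of "top_of_set X" "\<lambda>_. True" "top_of_set Y" p q] by simp
qed

text \<open>Constraining only the first N coordinates keeps these sets open in the product topology.
  Unlike balls, boxes are closed under intersection, as \<open>finite_type_Union\<close>
  requires.\<close>

definition box_fun :: "nat \<Rightarrow> (nat \<Rightarrow> complex set) \<Rightarrow> (nat \<Rightarrow> complex) set" where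
  "box_fun N B = {x. \<forall>i<N. x i \<in> B i}"

lemma open_box_fun:
  assumes "\<And>i. i < N \<Longrightarrow> open (B i)"
  shows "open (box_fun N B)"
proof -
  have "box_fun N B = (\<Inter>i<N. (\<lambda>x. x i) -` B i)"
    by (auto simp: box_fun_def)
  moreover have "open ((\<lambda>x. x i) -` B i)" if "i < N" for i
    using assms[OF that] by (intro open_vimage) auto
  ultimately show ?thesis by (auto intro: open_INT)
qed

lemma contractible_box:
  assumes "\<And>i. i < N \<Longrightarrow> convex (B i)"
  shows "contractible_space (top_of_set (affine_space N \<inter> box_fun N B))" (is "contractible_space (top_of_set ?X)")
proof (cases "?X = {}")
  case True
  then show ?thesis by (simp only: contractible_space_top_of_set contractible_empty)
next
  case False
  then obtain a where a: "a \<in> ?X" by blast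
  have "homotopic_with (\<lambda>_. True) (top_of_set ?X) (top_of_set ?X) id (\<lambda>x. a)"
  proof (rule homotopic_with_top_of_setI)
    let ?h = "\<lambda>(t, x) i. (1 - t) *\<^sub>R x i + t *\<^sub>R a i"
    have c: "continuous_on ({0..1} \<times> ?X) (\<lambda>z. (snd z :: nat \<Rightarrow> complex) i)" for i
      by (rule continuous_on_product_then_coordinatewise) (intro continuous_intros)
    show "continuous_on ({0..1} \<times> ?X) ?h"
      unfolding case_prod_beta by (intro continuous_on_coordinatewise_then_product continuous_intros c)
    show "?h (t, x) \<in> ?X" if "t \<in> {0..1}" "x \<in> ?X" for t x
      using that a assms by (auto simp: affine_space_def box_fun_def convex_alt)
  qed auto
  then show ?thesis by (auto simp: contractible_space_def)
qed

lemma box_in_open: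
  assumes "open U" "x \<in> U" "x \<in> affine_space N"
  shows "\<exists>B. (\<forall>i<N. open (B i) \<and> convex (B i)) \<and> x \<in> box_fun N B \<and> affine_space N \<inter> box_fun N B \<subseteq> U"
proof -
  have "openin (product_topology (\<lambda>i::nat. euclidean :: complex topology) UNIV) U"
    using assms(1) by (simp add: open_fun_def)
  from product_topology_open_contains_basis[OF this assms(2)]
  obtain X where X: "x \<in> Pi\<^sub>E UNIV X" "\<And>i. open (X i)" "Pi\<^sub>E UNIV X \<subseteq> U"
    by auto
  have "\<exists>e>0. ball (x i) e \<subseteq> X i" for i
    using X(1,2) open_contains_ball by (metis PiE_mem UNIV_I)
  then obtain e where e: "\<And>i. e i > 0" "\<And>i. ball (x i) (e i) \<subseteq> X i" by metis
  have "affine_space N \<inter> box_fun N (\<lambda>i. ball (x i) (e i)) \<subseteq> U"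
  proof
    fix y assume y: "y \<in> affine_space N \<inter> box_fun N (\<lambda>i. ball (x i) (e i))"
    have "y i \<in> X i" for i
    proof (cases "i < N")
      case True
      then show ?thesis using y e(2)[of i] by (auto simp: box_fun_def)
    next
      case False
      \<comment> \<open>From N on both points have coordinate 0, so the remaining conditions of the
        basic open set transfer from x to y.\<close>
      then have "y i = x i" using y assms(3) by (simp add: affine_space_def)
      then show ?thesis using X(1) by auto
    qed
    then show "y \<in> U" using X(3) by auto
  qed
  then show ?thesis
    using e(1) by (intro exI[of _ "\<lambda>i. ball (x i) (e i)"]) (auto simp: box_fun_def)
qed

text \<open>No triangulation or smooth structure is needed for the finiteness of the homology: the compact
  set \<open>K\<close> has a neighbourhood in \<open>X\<close> that is a finite union of convex open sets.\<close>

theorem finite_type_deformable_to_compact: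
  fixes h :: "real \<times> (nat \<Rightarrow> complex) \<Rightarrow> nat \<Rightarrow> complex"
  assumes X: "openin (top_of_set (affine_space N)) X"
    and h: "continuous_on ({0..1} \<times> X) h" "\<And>t x. t \<in> {0..1} \<Longrightarrow> x \<in> X \<Longrightarrow> h (t, x) \<in> X"
      "\<And>x. x \<in> X \<Longrightarrow> h (0, x) = x"
    and K: "compact K" "K \<subseteq> X" "\<And>x. x \<in> X \<Longrightarrow> h (1, x) \<in> K"
  shows "finite_type (top_of_set X)"
proof -
  obtain U where U: "open U" "X = affine_space N \<inter> U"
    using X by (auto simp: openin_open)
  define \<C> where "\<C> = {affine_space N \<inter> box_fun N B | B. \<forall>i<N. open (B i) \<and> convex (B i)}"
  have "\<exists>B. (\<forall>i<N. open (B i) \<and> convex (B i)) \<and> x \<in> box_fun N B \<and> affine_space N \<inter> box_fun N B \<subseteq> U" if "x \<in> K" for x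
    using that K(2) U by (intro box_in_open) auto
  then obtain B where B: "\<And>x i. x \<in> K \<Longrightarrow> i < N \<Longrightarrow> open (B x i)" "\<And>x i. x \<in> K \<Longrightarrow> i < N \<Longrightarrow> convex (B x i)"
      "\<And>x. x \<in> K \<Longrightarrow> x \<in> box_fun N (B x)" "\<And>x. x \<in> K \<Longrightarrow> affine_space N \<inter> box_fun N (B x) \<subseteq> U"
    by metis
  have "\<And>x. x \<in> K \<Longrightarrow> open (box_fun N (B x))" using B(1) by (intro open_box_fun)
  then obtain D where D: "D \<subseteq> K" "finite D" "K \<subseteq> (\<Union>x\<in>D. box_fun N (B x))"
    using compactE_image[OF K(1), of K "\<lambda>x. box_fun N (B x)"] B(3) by blast
  define F where "F = (\<lambda>x. affine_space N \<inter> box_fun N (B x)) ` D"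
  have "\<exists>B'. affine_space N \<inter> box_fun N (B x) = affine_space N \<inter> box_fun N B' \<and> (\<forall>i<N. open (B' i) \<and> convex (B' i))"
    if "x \<in> D" for x
    using that B(1,2) D(1) by (intro exI[of _ "B x"]) auto
  then have F: "finite F" "F \<subseteq> \<C>"
    using D by (auto simp: F_def \<C>_def)
  have UF: "\<Union>F \<subseteq> X" "K \<subseteq> \<Union>F"
  proof -
    show "\<Union>F \<subseteq> X"
      unfolding F_def U(2) using B(4) D(1) by (intro Union_least) auto
    show "K \<subseteq> \<Union>F"
    proof
      fix x assume x: "x \<in> K"
      then obtain y where "y \<in> D" "x \<in> box_fun N (B y)" using D(3) by blast
      moreover have "x \<in> affine_space N" using x K(2) U(2) by blast
      ultimately show "x \<in> \<Union>F" by (auto simp: F_def)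
    qed
  qed
  have "finite_type (subtopology (top_of_set (affine_space N)) (\<Union>F))"
  proof (rule finite_type_Union[OF _ _ _ F])
    fix A assume "A \<in> \<C>"
    then obtain B where B: "A = affine_space N \<inter> box_fun N B" "\<forall>i<N. open (B i) \<and> convex (B i)"
      by (auto simp: \<C>_def)
    show "openin (top_of_set (affine_space N)) A"
      unfolding B(1) using B(2) by (intro openin_open_Int open_box_fun) auto
    have "subtopology (top_of_set (affine_space N)) A = top_of_set A"
      unfolding B(1) subtopology_subtopology by (simp add: Int_absorb1 inf.assoc[symmetric])
    then show "contractible_space (subtopology (top_of_set (affine_space N)) A)"
      using contractible_box[of N B] B by simp
  next
    fix A A' assume "A \<in> \<C>" "A' \<in> \<C>"
    then obtain B B' where B: "A = affine_space N \<inter> box_fun N B" "\<forall>i<N. open (B i) \<and> convex (B i)"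
        "A' = affine_space N \<inter> box_fun N B'" "\<forall>i<N. open (B' i) \<and> convex (B' i)"
      by (auto simp: \<C>_def)
    have "A \<inter> A' = affine_space N \<inter> box_fun N (\<lambda>i. B i \<inter> B' i)"
      using B by (auto simp: box_fun_def)
    moreover have "\<forall>i<N. open (B i \<inter> B' i) \<and> convex (B i \<inter> B' i)"
      using B by (auto intro: convex_Int)
    ultimately show "A \<inter> A' \<in> \<C>" unfolding \<C>_def by blast
  qed
  moreover have "subtopology (top_of_set (affine_space N)) (\<Union>F) = top_of_set (\<Union>F)"
    using UF(1) U(2) unfolding subtopology_subtopology by (simp add: Int_absorb1 le_infE)
  ultimately have ft: "finite_type (top_of_set (\<Union>F))" by simp
  have h1: "continuous_on X (\<lambda>x. h (1, x))"
    by (rule continuous_on_compose2[OF h(1)]) (auto intro!: continuous_intros)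
  \<comment> \<open>The neighbourhood dominates X: the end of the deformation maps X into K and
    hence into \<open>\<Union>F\<close>, and followed by the inclusion it is homotopic to the
    identity of X.\<close>
  show ?thesis
  proof (rule finite_type_dominated[OF _ _ _ ft])
    show "continuous_map (top_of_set X) (top_of_set (\<Union>F)) (\<lambda>x. h (1, x))"
      using h1 K(3) UF(2) by auto
    show "continuous_map (top_of_set (\<Union>F)) (top_of_set X) id"
      using UF(1) by auto
    have "homotopic_with (\<lambda>_. True) (top_of_set X) (top_of_set X) id (id \<circ> (\<lambda>x. h (1, x)))"
      by (rule homotopic_with_top_of_setI[OF h(1)]) (use h in auto)
    then show "homotopic_with (\<lambda>_. True) (top_of_set X) (top_of_set X) (id \<circ> (\<lambda>x. h (1, x))) id"
      by (rule homotopic_with_symD)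
  qed
qed

text \<open>An action of the punctured plane together with an equivariant function splits off a factor
  homotopy equivalent to a circle.\<close>

locale punctured_plane_action =
  fixes X :: "'a::topological_space set" and act :: "complex \<Rightarrow> 'a \<Rightarrow> 'a" and \<phi> :: "'a \<Rightarrow> complex"
  assumes act_closed: "x \<in> X \<Longrightarrow> l \<noteq> 0 \<Longrightarrow> act l x \<in> X"
    and act_one: "x \<in> X \<Longrightarrow> act 1 x = x"
    and act_act: "x \<in> X \<Longrightarrow> l \<noteq> 0 \<Longrightarrow> m \<noteq> 0 \<Longrightarrow> act l (act m x) = act (l * m) x"
    and continuous_act: "continuous_on ((- {0}) \<times> X) (\<lambda>(l, x). act l x)"
    and continuous_\<phi>: "continuous_on X \<phi>"
    and \<phi>_nonzero: "x \<in> X \<Longrightarrow> \<phi> x \<noteq> 0"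
    and \<phi>_act: "x \<in> X \<Longrightarrow> l \<noteq> 0 \<Longrightarrow> \<phi> (act l x) = l * \<phi> x"
begin

lemma continuous_act':
  assumes "continuous_on S f" "continuous_on S g" "\<And>s. s \<in> S \<Longrightarrow> f s \<noteq> 0" "\<And>s. s \<in> S \<Longrightarrow> g s \<in> X"
  shows "continuous_on S (\<lambda>s. act (f s) (g s))"
  using continuous_on_compose2[OF continuous_act, of S "\<lambda>s. (f s, g s)"] assms
  by (auto intro!: continuous_intros)

definition slice :: "'a set" where "slice = {x \<in> X. \<phi> x = 1}"

lemma retract_to_slice: "x \<in> X \<Longrightarrow> act (inverse (\<phi> x)) x \<in> slice"
  using \<phi>_nonzero by (simp add: slice_def act_closed \<phi>_act)

text \<open>Acting by ((1 - t) \<phi> x + t w) / \<phi> x moves \<phi> x along the segment to w,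
  which stays inside W and so avoids 0. At t = 1 this is the retraction to the slice followed by the
  action of w.\<close>

lemma homotopy_equivalent_slice:
  assumes w: "w \<in> W" "0 \<notin> W" and star: "\<And>z t. z \<in> W \<Longrightarrow> t \<in> {0..1} \<Longrightarrow> (1 - t) *\<^sub>R z + t *\<^sub>R w \<in> W"
  shows "top_of_set {x \<in> X. \<phi> x \<in> W} homotopy_equivalent_space top_of_set slice"
proof -
  let ?U = "{x \<in> X. \<phi> x \<in> W}"
  let ?f = "\<lambda>x. act (inverse (\<phi> x)) x"
  have w0: "w \<noteq> 0" using w by auto
  have c\<phi>: "continuous_on ?U \<phi>" by (rule continuous_on_subset[OF continuous_\<phi>]) auto
  have f: "continuous_map (top_of_set ?U) (top_of_set slice) ?f"
    using retract_to_slice by (auto intro!: continuous_act' continuous_intros c\<phi> simp: \<phi>_nonzero)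
  have g: "continuous_map (top_of_set slice) (top_of_set ?U) (act w)"
    using w w0 by (auto intro!: continuous_act' continuous_intros simp: slice_def act_closed \<phi>_act)
  have "homotopic_with (\<lambda>_. True) (top_of_set ?U) (top_of_set ?U) id (act w \<circ> ?f)"
  proof (rule homotopic_with_top_of_setI)
    let ?l = "\<lambda>(t, x). ((1 - t) *\<^sub>R \<phi> x + t *\<^sub>R w) / \<phi> x"
    let ?h = "\<lambda>z. act (?l z) (snd z)"
    have l0: "?l z \<noteq> 0" if "z \<in> {0..1} \<times> ?U" for z
      using that star w(2) \<phi>_nonzero by (cases z) (auto, metis)
    have c: "continuous_on ({0..1} \<times> ?U) (\<lambda>z. \<phi> (snd z))"
      by (rule continuous_on_compose2[OF c\<phi>]) (auto intro!: continuous_intros)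
    show "continuous_on ({0..1} \<times> ?U) ?h"
    proof (rule continuous_act'[OF _ _ l0])
      show "continuous_on ({0..1} \<times> ?U) ?l"
        unfolding case_prod_beta using \<phi>_nonzero by (intro continuous_intros c) auto
      show "continuous_on ({0..1} \<times> ?U) snd" by (intro continuous_intros)
    qed auto
    show "?h (t, x) \<in> ?U" if "t \<in> {0..1}" "x \<in> ?U" for t x
      using l0[of "(t, x)"] that star \<phi>_nonzero[of x] by (auto simp: act_closed \<phi>_act)
    show "?h (0, x) = id x" if "x \<in> ?U" for x using that \<phi>_nonzero by (simp add: act_one)
    show "?h (1, x) = (act w \<circ> ?f) x" if "x \<in> ?U" for x
      using that \<phi>_nonzero w0 by (simp add: act_act field_simps)
  qed
  then have gf: "homotopic_with (\<lambda>_. True) (top_of_set ?U) (top_of_set ?U) (act w \<circ> ?f) id"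
    by (rule homotopic_with_symD)
  have "continuous_map (top_of_set slice) (top_of_set slice) (?f \<circ> act w)"
    using f g by (rule continuous_map_compose[rotated])
  then have fg: "homotopic_with (\<lambda>_. True) (top_of_set slice) (top_of_set slice) (?f \<circ> act w) id"
    by (rule homotopic_with_equal[rotated 2]) (use w0 in \<open>auto simp: slice_def \<phi>_act act_act act_one\<close>)
  show ?thesis
    unfolding homotopy_equivalent_space_def using f g gf fg by blast
qed

theorem euler_characteristic_zero:
  assumes "finite_type (top_of_set X)"
  shows "has_euler_characteristic (top_of_set X) 0"
proof -
  \<comment> \<open>The slice is a retract of X, so its homology inherits finite rank.\<close>
  have "finite_type (top_of_set slice)"
  proof (rule finite_type_dominated[OF _ _ _ assms])
    show "continuous_map (top_of_set slice) (top_of_set X) id"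
      by (auto simp: slice_def)
    show c: "continuous_map (top_of_set X) (top_of_set slice) (\<lambda>x. act (inverse (\<phi> x)) x)"
      using retract_to_slice
      by (auto intro!: continuous_act' continuous_intros continuous_\<phi> simp: \<phi>_nonzero)
    show "homotopic_with (\<lambda>_. True) (top_of_set slice) (top_of_set slice) ((\<lambda>x. act (inverse (\<phi> x)) x) \<circ> id) id"
    proof (rule homotopic_with_equal)
      show "continuous_map (top_of_set slice) (top_of_set slice) ((\<lambda>x. act (inverse (\<phi> x)) x) \<circ> id)"
        using c by (auto simp: slice_def intro: continuous_on_subset)
    qed (auto simp: slice_def act_one)
  qed
  then obtain e where e: "has_euler_characteristic (top_of_set slice) e"
    by (auto simp: finite_type_def)
  let ?T = "top_of_set X"
  define P where "P W = {x \<in> X. \<phi> x \<in> W}" for W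
  have sub: "subtopology ?T (P W) = top_of_set (P W)" for W
    unfolding subtopology_subtopology P_def by (simp add: Int_absorb1)
  have op: "openin ?T (P W)" if "open W" for W
    unfolding P_def using continuous_openin_preimage_gen[OF continuous_\<phi> that]
    by (simp add: vimage_def Int_def)
  have eW: "has_euler_characteristic (subtopology ?T (P W)) e"
    if "w \<in> W" "0 \<notin> W" "\<And>z t. z \<in> W \<Longrightarrow> t \<in> {0..1} \<Longrightarrow> (1 - t) *\<^sub>R z + t *\<^sub>R w \<in> W" for w W
    using has_euler_characteristic_homotopy_equivalent[OF homotopy_equivalent_slice[OF that]] e
    unfolding sub by (simp add: P_def)
  \<comment> \<open>\<open>?R\<close> and \<open>?L\<close> are the planes slit along a closed real
    half-line, star-shaped around 1 and -1. They cover everything except 0 and intersect in the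
    disjoint half-planes \<open>?H\<close> and \<open>?H'\<close>.\<close>
  let ?R = "{z. Im z \<noteq> 0 \<or> Re z > 0}" and ?L = "{z. Im z \<noteq> 0 \<or> Re z < 0}"
  let ?H = "{z. Im z > 0}" and ?H' = "{z. Im z < 0}"
  have open_half: "open ?H" "open ?H'"
    by (auto intro: open_halfspace_Im_gt open_halfspace_Im_lt)
  have "?R = ?H \<union> ?H' \<union> {z. Re z > 0}" "?L = ?H \<union> ?H' \<union> {z. Re z < 0}" by auto
  then have open_slit: "open ?R" "open ?L"
    using open_half by (auto intro: open_halfspace_Re_gt open_halfspace_Re_lt)
  have star: "(1 - t) * a + t * b > 0" if "a > 0" "b > 0" "t \<in> {0..1}" for a b t :: real
    using that by (cases "t = 0") (auto intro: add_nonneg_pos)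
  have eH: "has_euler_characteristic (subtopology ?T (P ?H)) e"
    by (rule eW[of \<i>]) (use star[of _ 1] in auto)
  have eH': "has_euler_characteristic (subtopology ?T (P ?H')) e"
  proof (rule eW[of "-\<i>"])
    show "(1 - t) *\<^sub>R z + t *\<^sub>R - \<i> \<in> ?H'" if "z \<in> ?H'" "t \<in> {0..1}" for z t
      using star[of "- Im z" 1 t] that by auto
  qed auto
  have eR: "has_euler_characteristic (subtopology ?T (P ?R)) e"
  proof (rule eW[of 1])
    show "(1 - t) *\<^sub>R z + t *\<^sub>R 1 \<in> ?R" if "z \<in> ?R" "t \<in> {0..1}" for z t
    \<comment> \<open>A nonzero imaginary part stays nonzero while t < 1, so the real part matters
      only on the real axis; at t = 1 the point is 1.\<close>
    proof (cases "Im z = 0 \<or> t = 1")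
      case True
      then show ?thesis using star[of "Re z" 1 t] that by auto
    qed (use that in auto)
  qed auto
  have eL: "has_euler_characteristic (subtopology ?T (P ?L)) e"
  proof (rule eW[of "-1"])
    show "(1 - t) *\<^sub>R z + t *\<^sub>R - 1 \<in> ?L" if "z \<in> ?L" "t \<in> {0..1}" for z t
    proof (cases "Im z = 0 \<or> t = 1")
      case True
      then show ?thesis using star[of "- Re z" 1 t] that by auto
    qed (use that in auto)
  qed auto
  have "P ?H \<inter> P ?H' = {}" by (auto simp: P_def)
  then have "has_euler_characteristic (subtopology ?T (P ?H \<inter> P ?H')) 0"
    by (intro has_euler_characteristic_empty) simp
  from euler_characteristic_Un[OF op[OF open_half(1)] op[OF open_half(2)] eH eH' this]
  have "has_euler_characteristic (subtopology ?T (P ?H \<union> P ?H')) (e + e)" by simp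
  moreover have "P ?H \<union> P ?H' = P ?R \<inter> P ?L" by (auto simp: P_def)
  ultimately have "has_euler_characteristic (subtopology ?T (P ?R \<inter> P ?L)) (e + e)" by simp
  from euler_characteristic_Un[OF op[OF open_slit(1)] op[OF open_slit(2)] eR eL this]
  have "has_euler_characteristic (subtopology ?T (P ?R \<union> P ?L)) 0" by simp
  moreover have "P ?R \<union> P ?L = topspace ?T"
  proof -
    have "(Im (\<phi> x) \<noteq> 0 \<or> Re (\<phi> x) > 0) \<or> (Im (\<phi> x) \<noteq> 0 \<or> Re (\<phi> x) < 0)" if "x \<in> X" for x
      using \<phi>_nonzero[OF that] by (auto simp: complex_eq_iff)
    then show ?thesis by (auto simp only: P_def topspace_euclidean_subtopology)
  qed
  ultimately show ?thesis by (simp only: subtopology_topspace)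
qed

end

section \<open>Normal form of maps whose critical set is a hyperbola\<close>

definition aff :: "complex \<Rightarrow> complex \<Rightarrow> complex \<Rightarrow> complex \<Rightarrow> complex \<Rightarrow> complex \<Rightarrow> complex^2 \<Rightarrow> complex^2" where
  "aff p q r s u v z = vector [p * z$1 + q * z$2 + u, r * z$1 + s * z$2 + v]"

lemma aff_nth [simp]:
  "aff p q r s u v z $ 1 = p * z$1 + q * z$2 + u" "aff p q r s u v z $ 2 = r * z$1 + s * z$2 + v"
  by (simp_all add: aff_def)

lemma vec2_eq_iff: "x = y \<longleftrightarrow> x$1 = y$1 \<and> x$2 = y$2" for x y :: "'a^2"
  by (simp add: vec_eq_iff forall_2)

text \<open>With six scalars in place of a matrix and a vector, composition, inversion and
  substitution all become polynomial identities in named variables.\<close>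

lemma GA2_iff: "L \<in> GA2 \<longleftrightarrow> (\<exists>p q r s u v. p * s - q * r \<noteq> 0 \<and> L = aff p q r s u v)"
proof
  assume "L \<in> GA2"
  then obtain A b where A: "invertible (A :: complex^2^2)" "L = (\<lambda>z. A *v z + b)"
    by (auto simp: GA2_def)
  have "L = aff (A$1$1) (A$1$2) (A$2$1) (A$2$2) (b$1) (b$2)"
    by (rule ext) (simp add: A(2) vec2_eq_iff matrix_vector_mult_def sum_2)
  moreover have "A$1$1 * A$2$2 - A$1$2 * A$2$1 \<noteq> 0"
    using A(1) by (simp add: invertible_det_nz det_2)
  ultimately show "\<exists>p q r s u v. p * s - q * r \<noteq> 0 \<and> L = aff p q r s u v" by blast
next
  assume "\<exists>p q r s u v. p * s - q * r \<noteq> 0 \<and> L = aff p q r s u v"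
  then obtain p q r s u v where L: "p * s - q * r \<noteq> 0" "L = aff p q r s u v" by blast
  let ?A = "vector [vector [p, q], vector [r, s]] :: complex^2^2"
  have "invertible ?A" using L(1) by (simp add: invertible_det_nz det_2)
  moreover have "L = (\<lambda>z. ?A *v z + vector [u, v])"
    by (rule ext) (simp add: L(2) vec2_eq_iff matrix_vector_mult_def sum_2)
  ultimately show "L \<in> GA2" unfolding GA2_def by blast
qed

lemma aff_in_GA2: "p * s - q * r \<noteq> 0 \<Longrightarrow> aff p q r s u v \<in> GA2"
  unfolding GA2_iff by blast

lemma aff_id: "aff 1 0 0 1 0 0 = id"
  by (rule ext) (simp add: vec2_eq_iff)

lemma id_in_GA2: "id \<in> GA2"
  using aff_in_GA2[of 1 1 0 0 0 0] by (simp add: aff_id)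

lemma aff_comp:
  "aff p q r s u v \<circ> aff p' q' r' s' u' v' =
   aff (p * p' + q * r') (p * q' + q * s') (r * p' + s * r') (r * q' + s * s')
       (p * u' + q * v' + u) (r * u' + s * v' + v)"
  by (rule ext) (simp add: vec2_eq_iff algebra_simps)

lemma comp_in_GA2:
  assumes "L \<in> GA2" "M \<in> GA2"
  shows "L \<circ> M \<in> GA2"
proof -
  obtain p q r s u v p' q' r' s' u' v' where L: "p * s - q * r \<noteq> 0" "L = aff p q r s u v"
      and M: "p' * s' - q' * r' \<noteq> 0" "M = aff p' q' r' s' u' v'"
    using assms unfolding GA2_iff by blast
  have "(p * p' + q * r') * (r * q' + s * s') - (p * q' + q * s') * (r * p' + s * r')
      = (p * s - q * r) * (p' * s' - q' * r')"
    by (simp add: algebra_simps power2_eq_square)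
  then show ?thesis
    unfolding L(2) M(2) aff_comp using L(1) M(1) by (intro aff_in_GA2) simp
qed

lemma inverse_in_GA2:
  assumes "L \<in> GA2"
  shows "\<exists>M\<in>GA2. L \<circ> M = id \<and> M \<circ> L = id"
proof -
  obtain p q r s u v where L: "p * s - q * r \<noteq> 0" "L = aff p q r s u v"
    using assms unfolding GA2_iff by blast
  define i where "i = inverse (p * s - q * r)"
  have i: "(p * s - q * r) * i = 1" using L(1) by (simp add: i_def)
  \<comment> \<open>The adjugate matrix divided by the determinant, with the matching
    translation.\<close>
  let ?M = "aff (s * i) (- (q * i)) (- (r * i)) (p * i) ((q * v - s * u) * i) ((r * u - p * v) * i)"
  have "s * i * (p * i) - (- (q * i)) * (- (r * i)) = (p * s - q * r) * i * i"
    by (simp add: algebra_simps)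
  then have "s * i * (p * i) - (- (q * i)) * (- (r * i)) = i" using i by simp
  moreover have "i \<noteq> 0" using i by auto
  ultimately have "?M \<in> GA2" by (intro aff_in_GA2) simp
  moreover have "L (?M z) = z" for z
  proof -
    have "p * (s * i * z$1 + - (q * i) * z$2 + (q * v - s * u) * i) + q * (- (r * i) * z$1 + p * i * z$2 + (r * u - p * v) * i)
        = (p * s - q * r) * i * (z$1 - u)"
      "r * (s * i * z$1 + - (q * i) * z$2 + (q * v - s * u) * i) + s * (- (r * i) * z$1 + p * i * z$2 + (r * u - p * v) * i)
        = (p * s - q * r) * i * (z$2 - v)"
      by (simp_all add: algebra_simps)
    then show ?thesis unfolding i by (simp add: L(2) vec2_eq_iff)
  qed
  moreover have "?M (L z) = z" for z
  proof -
    have "s * i * (p * z$1 + q * z$2 + u) + - (q * i) * (r * z$1 + s * z$2 + v) + (q * v - s * u) * i = (p * s - q * r) * i * z$1"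
      "- (r * i) * (p * z$1 + q * z$2 + u) + p * i * (r * z$1 + s * z$2 + v) + (r * u - p * v) * i = (p * s - q * r) * i * z$2"
      by (simp_all add: algebra_simps)
    then show ?thesis unfolding i by (simp add: L(2) vec2_eq_iff)
  qed
  ultimately show ?thesis by (auto simp: fun_eq_iff)
qed

lemma orbit_refl: "f \<in> orbit f"
  unfolding orbit_def using id_in_GA2 by (auto intro!: exI[of _ id])

lemma orbit_trans:
  assumes "f \<in> orbit g" "g \<in> orbit h"
  shows "f \<in> orbit h"
proof -
  obtain L R L' R' where "f = L \<circ> g \<circ> R" "L \<in> GA2" "R \<in> GA2" "g = L' \<circ> h \<circ> R'" "L' \<in> GA2" "R' \<in> GA2"
    using assms unfolding orbit_def by blast
  then have "f = (L \<circ> L') \<circ> h \<circ> (R' \<circ> R)" "L \<circ> L' \<in> GA2" "R' \<circ> R \<in> GA2"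
    by (auto simp: o_assoc comp_in_GA2)
  then show ?thesis unfolding orbit_def by blast
qed

lemma orbit_sym:
  assumes "f \<in> orbit g"
  shows "g \<in> orbit f"
proof -
  obtain L R where f: "f = L \<circ> g \<circ> R" "L \<in> GA2" "R \<in> GA2"
    using assms unfolding orbit_def by blast
  obtain L' R' where L': "L' \<in> GA2" "L' \<circ> L = id" and R': "R' \<in> GA2" "R \<circ> R' = id"
    using inverse_in_GA2 f(2,3) by metis
  have "L' \<circ> f \<circ> R' = (L' \<circ> L) \<circ> g \<circ> (R \<circ> R')" by (simp add: f(1) o_assoc)
  then have "g = L' \<circ> f \<circ> R'" using L' R' by simp
  then show ?thesis unfolding orbit_def using L'(1) R'(1) by blast
qed

lemma orbit_eq_iff: "orbit f = orbit g \<longleftrightarrow> f \<in> orbit g"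
  using orbit_refl orbit_trans orbit_sym by blast

lemma linearly_equivalent_iff:
  assumes "f \<in> Omega 2 2"
  shows "linearly_equivalent f g \<longleftrightarrow> f \<in> orbit g"
  unfolding linearly_equivalent_def using assms orbit_refl orbit_trans orbit_sym by blast

section \<open>Conics under affine substitutions\<close>

definition qpoly :: "complex \<Rightarrow> complex \<Rightarrow> complex \<Rightarrow> complex \<Rightarrow> complex \<Rightarrow> complex \<Rightarrow> complex \<Rightarrow> complex \<Rightarrow> complex" where
  "qpoly a b c d e k x y = a + b * x + c * y + d * x^2 + e * (x * y) + k * y^2"

text \<open>The new coefficients are written exactly as in \<open>conic_disc_aff\<close> and
  \<open>conic_det_aff\<close>, so that the transformation laws of the invariants apply to them
  literally.\<close>

lemma qpoly_aff:
  "qpoly a b c d e k (p * x + q * y + u) (r * x + s * y + v) =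
   qpoly (qpoly a b c d e k u v)
     (b * p + c * r + 2 * d * p * u + e * (p * v + r * u) + 2 * k * r * v)
     (b * q + c * s + 2 * d * q * u + e * (q * v + s * u) + 2 * k * s * v)
     (d * p^2 + e * p * r + k * r^2)
     (2 * d * p * q + e * (p * s + q * r) + 2 * k * r * s)
     (d * q^2 + e * q * s + k * s^2) x y"
  unfolding qpoly_def by (simp add: algebra_simps power2_eq_square)

lemma Omega_iff: "f \<in> Omega 2 2 \<longleftrightarrow> (\<exists>a b c d e k a' b' c' d' e' k'. \<forall>z. f z =
    vector [qpoly a b c d e k (z$1) (z$2), qpoly a' b' c' d' e' k' (z$1) (z$2)])"
  unfolding Omega_def poly2_degree_le_2 qpoly_def by (simp add: vec2_eq_iff) blast

lemma Omega_orbit: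
  assumes "f \<in> Omega 2 2" "g \<in> orbit f"
  shows "g \<in> Omega 2 2"
proof -
  obtain L R where "L \<in> GA2" "R \<in> GA2" and g: "g = L \<circ> f \<circ> R"
    using assms(2) unfolding orbit_def by blast
  then obtain p q r s u v p' q' r' s' u' v' where L: "L = aff p q r s u v"
      and R: "R = aff p' q' r' s' u' v'"
    unfolding GA2_iff by blast
  obtain a b c d e k a' b' c' d' e' k' where f: "\<And>z. f z =
    vector [qpoly a b c d e k (z$1) (z$2), qpoly a' b' c' d' e' k' (z$1) (z$2)]"
    using assms(1) unfolding Omega_iff by blast
  have lin: "m * qpoly a b c d e k x y + n * qpoly a' b' c' d' e' k' x y + w =
      qpoly (m * a + n * a' + w) (m * b + n * b') (m * c + n * c') (m * d + n * d') (m * e + n * e') (m * k + n * k') x y"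
    for m n w a b c d e k a' b' c' d' e' k' x y
    unfolding qpoly_def by (simp add: algebra_simps power2_eq_square)
  have "\<exists>a b c d e k. \<forall>z. g z $ i = qpoly a b c d e k (z$1) (z$2)" if "i = 1 \<or> i = 2" for i
    using that unfolding g L R o_def f
    by (elim disjE) (simp_all only: aff_nth f vector_2 qpoly_aff lin, blast+)
  then obtain a b c d e k a' b' c' d' e' k' where
      "\<And>z. g z $ 1 = qpoly a b c d e k (z$1) (z$2)" "\<And>z. g z $ 2 = qpoly a' b' c' d' e' k' (z$1) (z$2)"
    by metis
  then have "\<forall>z. g z = vector [qpoly a b c d e k (z$1) (z$2), qpoly a' b' c' d' e' k' (z$1) (z$2)]"
    by (simp add: vec2_eq_iff)
  then show ?thesis unfolding Omega_iff by blast
qed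

lemma hyperbola_preimage:
  assumes "M \<in> GA2"
  shows "is_hyperbola {z. M z $ 1 * M z $ 2 = 1}"
proof -
  obtain N where N: "N \<in> GA2" "M \<circ> N = id" "N \<circ> M = id"
    using inverse_in_GA2[OF assms] by blast
  have "M (N z) = z" "N (M z) = z" for z using N by (metis comp_apply id_apply)+
  then have "{z. M z $ 1 * M z $ 2 = 1} = N ` {z. z$1 * z$2 = 1}"
    by (auto simp: image_iff) metis
  then show ?thesis unfolding is_hyperbola_def using N(1) by blast
qed

text \<open>Substituting y = 1 / x and multiplying by x^2 gives a polynomial of degree at most four
  in x that vanishes at every nonzero x, so all its coefficients are zero. The constant term
  \<open>a\<close> is nonzero because the origin is not on the hyperbola.\<close>

lemma qpoly_unit_hyperbola:
  assumes "\<And>x y. qpoly a b c d e k x y = 0 \<longleftrightarrow> x * y = 1"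
  shows "b = 0 \<and> c = 0 \<and> d = 0 \<and> k = 0 \<and> e = - a \<and> a \<noteq> 0"
proof -
  have "poly [:k, c, a + e, b, d:] x = 0" if "x \<noteq> 0" for x
  proof -
    define y where "y = 1 / x"
    have xy: "x * y = 1" using that by (simp add: y_def)
    have "x^2 * qpoly a b c d e k x y = a * x^2 + b * x^3 + c * x * (x * y) + d * x^4 + e * x^2 * (x * y) + k * (x * y)^2"
      by (simp add: qpoly_def algebra_simps power2_eq_square eval_nat_numeral)
    then have "a * x^2 + b * x^3 + c * x + d * x^4 + e * x^2 + k = 0"
      using assms[of x y] xy by simp
    then show ?thesis
      by (simp add: algebra_simps power2_eq_square eval_nat_numeral)
  qed
  then have "UNIV - {0} \<subseteq> {x. poly [:k, c, a + e, b, d:] x = 0}" by auto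
  then have "infinite {x. poly [:k, c, a + e, b, d:] x = 0}"
    using infinite_UNIV_char_0[where 'a = complex] finite_subset[of "UNIV - {0 :: complex}"] by auto
  then have "[:k, c, a + e, b, d:] = 0"
    using poly_roots_finite by blast
  moreover have "a \<noteq> 0" using assms[of 0 0] by (simp add: qpoly_def)
  ultimately show ?thesis by (auto simp: add_eq_0_iff)
qed

definition conic_disc :: "complex \<Rightarrow> complex \<Rightarrow> complex \<Rightarrow> complex" where
  "conic_disc d e k = e^2 - 4 * d * k"

text \<open>Four times the determinant of the symmetric 3 by 3 matrix of the homogenized conic. In
  the same normalization \<open>conic_disc\<close> is -4 times the determinant of its quadratic
  block.\<close>

definition conic_det :: "complex \<Rightarrow> complex \<Rightarrow> complex \<Rightarrow> complex \<Rightarrow> complex \<Rightarrow> complex \<Rightarrow> complex" where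
  "conic_det a b c d e k = 4 * a * d * k + b * c * e - a * e^2 - d * c^2 - k * b^2"

lemma conic_disc_aff:
  "conic_disc (d * p^2 + e * p * r + k * r^2) (2 * d * p * q + e * (p * s + q * r) + 2 * k * r * s)
     (d * q^2 + e * q * s + k * s^2) = (p * s - q * r)^2 * conic_disc d e k"
  unfolding conic_disc_def by (simp add: algebra_simps power2_eq_square)

text \<open>A translation leaves the determinant unchanged and a linear substitution multiplies it
  by the square of its own determinant. Treating the two separately keeps the expansions small;
  \<open>det_disc\<close> isolates the constant term, which reduces the linear case to
  \<open>conic_disc_aff\<close>.\<close>

lemma conic_det_aff:
  "conic_det (qpoly a b c d e k u v)
     (b * p + c * r + 2 * d * p * u + e * (p * v + r * u) + 2 * k * r * v)
     (b * q + c * s + 2 * d * q * u + e * (q * v + s * u) + 2 * k * s * v)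
     (d * p^2 + e * p * r + k * r^2) (2 * d * p * q + e * (p * s + q * r) + 2 * k * r * s)
     (d * q^2 + e * q * s + k * s^2) = (p * s - q * r)^2 * conic_det a b c d e k"
proof -
  have translate: "conic_det (qpoly a b c d e k u v) (b + 2 * d * u + e * v) (c + e * u + 2 * k * v) d e k
      = conic_det a b c d e k"
    unfolding conic_det_def qpoly_def by (simp add: algebra_simps power2_eq_square)
  have det_disc: "conic_det a b c d e k = (b * c * e - d * c^2 - k * b^2) - a * conic_disc d e k" for a b c d e k
    unfolding conic_det_def conic_disc_def by (simp add: algebra_simps)
  have linear: "conic_det a (b * p + c * r) (b * q + c * s)
     (d * p^2 + e * p * r + k * r^2) (2 * d * p * q + e * (p * s + q * r) + 2 * k * r * s)
     (d * q^2 + e * q * s + k * s^2) = (p * s - q * r)^2 * conic_det a b c d e k" for a b c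
  proof -
    have "(b * p + c * r) * (b * q + c * s) * (2 * d * p * q + e * (p * s + q * r) + 2 * k * r * s)
      - (d * p^2 + e * p * r + k * r^2) * (b * q + c * s)^2 - (d * q^2 + e * q * s + k * s^2) * (b * p + c * r)^2
      = (p * s - q * r)^2 * (b * c * e - d * c^2 - k * b^2)"
      by (simp add: algebra_simps power2_eq_square)
    then show ?thesis unfolding det_disc conic_disc_aff by (simp add: algebra_simps)
  qed
  have "b * p + c * r + 2 * d * p * u + e * (p * v + r * u) + 2 * k * r * v
      = (b + 2 * d * u + e * v) * p + (c + e * u + 2 * k * v) * r"
    "b * q + c * s + 2 * d * q * u + e * (q * v + s * u) + 2 * k * s * v
      = (b + 2 * d * u + e * v) * q + (c + e * u + 2 * k * v) * s"
    by (simp_all add: algebra_simps)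
  then show ?thesis by (simp only: linear translate)
qed

text \<open>This is the quadratic formula over the complex numbers. The determinant of the two
  linear factors is a square root of the discriminant, hence nonzero.\<close>

lemma binary_quadratic_factor:
  assumes "conic_disc d e k \<noteq> 0"
  shows "\<exists>p q r s. p * s - q * r \<noteq> 0 \<and> (\<forall>x y. d * x^2 + e * (x * y) + k * y^2 = (p * x + q * y) * (r * x + s * y))"
proof (cases "d = 0")
  case True
  then have "e \<noteq> 0" using assms by (simp add: conic_disc_def)
  moreover have "\<forall>x y. d * x^2 + e * (x * y) + k * y^2 = (e * x + k * y) * (0 * x + 1 * y)"
    using True by (auto simp: algebra_simps power2_eq_square)
  ultimately show ?thesis by (intro exI[of _ e] exI[of _ k] exI[of _ 0] exI[of _ 1]) auto
next
  case False
  define w where "w = csqrt (conic_disc d e k)"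
  have w: "w^2 = e^2 - 4 * d * k" by (simp add: w_def conic_disc_def)
  have w0: "w \<noteq> 0" using assms by (simp add: w_def)
  have "\<forall>x y. d * x^2 + e * (x * y) + k * y^2 = (d * x + (e + w) / 2 * y) * (1 * x + (e - w) / (2 * d) * y)"
  proof (intro allI)
    fix x y
    have "(d * x + (e + w) / 2 * y) * (1 * x + (e - w) / (2 * d) * y)
      = d * x^2 + e * (x * y) + (e^2 - w^2) / (4 * d) * y^2"
      using False by (simp add: field_simps power2_eq_square)
    also have "(e^2 - w^2) / (4 * d) = k" using False by (simp add: w)
    finally show "d * x^2 + e * (x * y) + k * y^2 = (d * x + (e + w) / 2 * y) * (1 * x + (e - w) / (2 * d) * y)"
      by simp
  qed
  moreover have "d * ((e - w) / (2 * d)) - (e + w) / 2 * 1 = - w"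
    using False by (simp add: field_simps)
  then have "d * ((e - w) / (2 * d)) - (e + w) / 2 * 1 \<noteq> 0" using w0 by simp
  ultimately show ?thesis by blast
qed

text \<open>Both invariants change by the square of the determinant under an affine substitution,
  and for a (1 - x y) they are a^2 and -a^3. Conversely, translating to the centre removes the
  linear terms, and the quadratic part splits into two independent linear forms.\<close>

lemma is_hyperbola_conic_iff:
  "is_hyperbola {z. qpoly a b c d e k (z$1) (z$2) = 0} \<longleftrightarrow> conic_disc d e k \<noteq> 0 \<and> conic_det a b c d e k \<noteq> 0"
    (is "is_hyperbola ?C \<longleftrightarrow> _")
proof
  assume "is_hyperbola ?C"
  then obtain L where L: "L \<in> GA2" "?C = L ` {z. z$1 * z$2 = 1}"
    unfolding is_hyperbola_def by blast
  obtain p q r s u v where P: "p * s - q * r \<noteq> 0" "L = aff p q r s u v"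
    using L(1) unfolding GA2_iff by blast
  obtain M where M: "M \<circ> L = id" using inverse_in_GA2[OF L(1)] by blast
  have inj: "inj L" using M by (metis inj_on_id inj_on_imageI2)
  have "qpoly a b c d e k (p * x + q * y + u) (r * x + s * y + v) = 0 \<longleftrightarrow> x * y = 1" for x y
  proof -
    have "L (vector [x, y]) \<in> ?C \<longleftrightarrow> x * y = 1"
      unfolding L(2) using inj by (auto simp: inj_image_mem_iff)
    then show ?thesis by (simp add: P(2))
  qed
  note * = qpoly_unit_hyperbola[OF this[unfolded qpoly_aff]]
  show "conic_disc d e k \<noteq> 0 \<and> conic_det a b c d e k \<noteq> 0"
    using conic_disc_aff[of d p e r k q s] conic_det_aff[of a b c d e k u v p r q s] P(1) *
    by (auto simp: conic_disc_def[of 0] conic_det_def[of _ 0 0])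
next
  assume nz: "conic_disc d e k \<noteq> 0 \<and> conic_det a b c d e k \<noteq> 0"
  define D where "D = conic_disc d e k"
  have D: "D \<noteq> 0" "D = e^2 - 4 * d * k" using nz by (auto simp: D_def conic_disc_def)
  \<comment> \<open>Cramer's rule for the point where both partial derivatives of the conic vanish,
    that is, its centre; \<open>w\<close> will be the value there.\<close>
  define x0 where "x0 = (2 * b * k - c * e) / D"
  define y0 where "y0 = (2 * c * d - b * e) / D"
  define w where "w = - conic_det a b c d e k / D"
  have w: "w \<noteq> 0" using nz D by (simp add: w_def)
  obtain p q r s where f: "p * s - q * r \<noteq> 0"
      "\<And>x y. d * x^2 + e * (x * y) + k * y^2 = (p * x + q * y) * (r * x + s * y)"
    using binary_quadratic_factor nz by blast
  have e1: "b + 2 * d * x0 + e * y0 = 0"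
  proof -
    have "D * (b + 2 * d * x0 + e * y0) = D * b + 2 * d * (2 * b * k - c * e) + e * (2 * c * d - b * e)"
      using D(1) by (simp add: x0_def y0_def field_simps)
    also have "\<dots> = 0" unfolding D(2) by (simp add: algebra_simps power2_eq_square)
    finally show ?thesis using D(1) by simp
  qed
  have e2: "c + e * x0 + 2 * k * y0 = 0"
  proof -
    have "D * (c + e * x0 + 2 * k * y0) = D * c + e * (2 * b * k - c * e) + 2 * k * (2 * c * d - b * e)"
      using D(1) by (simp add: x0_def y0_def field_simps)
    also have "\<dots> = 0" unfolding D(2) by (simp add: algebra_simps power2_eq_square)
    finally show ?thesis using D(1) by simp
  qed
  \<comment> \<open>At the centre the quadratic part equals minus half the linear part, so the left
    side is twice the value there.\<close>
  have e3: "2 * a + b * x0 + c * y0 = 2 * w"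
  proof -
    have "D * (2 * a + b * x0 + c * y0) = D * 2 * a + b * (2 * b * k - c * e) + c * (2 * c * d - b * e)"
      using D(1) by (simp add: x0_def y0_def field_simps)
    also have "\<dots> = 2 * (- conic_det a b c d e k)" unfolding D(2) conic_det_def by (simp add: algebra_simps power2_eq_square)
    also have "\<dots> = D * (2 * w)" using D(1) by (simp add: w_def)
    finally show ?thesis using D(1) by simp
  qed
  have q: "qpoly a b c d e k x y = w + (p * (x - x0) + q * (y - y0)) * (r * (x - x0) + s * (y - y0))" for x y
  proof -
    have "2 * qpoly a b c d e k x y = 2 * w + 2 * (d * (x - x0)^2 + e * ((x - x0) * (y - y0)) + k * (y - y0)^2)"
    proof -
      have "2 * qpoly a b c d e k x y = (2 * a + b * x0 + c * y0) + (2 * (x - x0) + x0) * (b + 2 * d * x0 + e * y0)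
        + (2 * (y - y0) + y0) * (c + e * x0 + 2 * k * y0)
        + 2 * (d * (x - x0)^2 + e * ((x - x0) * (y - y0)) + k * (y - y0)^2)"
        unfolding qpoly_def by (simp add: algebra_simps power2_eq_square)
      then show ?thesis unfolding e1 e2 e3 by simp
    qed
    then have "2 * qpoly a b c d e k x y = 2 * (w + (p * (x - x0) + q * (y - y0)) * (r * (x - x0) + s * (y - y0)))"
      unfolding f(2) by (simp only: distrib_left)
    then show ?thesis by (simp only: mult_cancel_left) simp
  qed
  \<comment> \<open>The first linear form is divided by -w, which turns w + A B = 0 into A B = 1 for
    the new factors.\<close>
  let ?M = "aff (- p / w) (- q / w) r s ((p * x0 + q * y0) / w) (- (r * x0 + s * y0))"
  have "- p / w * s - - q / w * r = - (p * s - q * r) / w" by (simp add: diff_divide_distrib)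
  then have "?M \<in> GA2" using f(1) w by (intro aff_in_GA2) simp
  moreover have "qpoly a b c d e k (z$1) (z$2) = 0 \<longleftrightarrow> ?M z $ 1 * ?M z $ 2 = 1" for z
  proof -
    have "?M z $ 1 = (p * (z$1 - x0) + q * (z$2 - y0)) / - w" "?M z $ 2 = r * (z$1 - x0) + s * (z$2 - y0)"
      using w by (simp_all add: field_simps)
    moreover have "(A / - w * B = 1) = (w + A * B = 0)" for A B
    proof -
      have "A / - w * B = - (A * B / w)" by simp
      moreover have "(- (A * B / w) = 1) = (A * B = - w)" using w by (simp add: minus_equation_iff[of _ 1] divide_eq_eq eq_commute[of "- 1"])
      ultimately show ?thesis by (simp add: add_eq_0_iff)
    qed
    ultimately show ?thesis unfolding q by (simp only:)
  qed
  ultimately show "is_hyperbola ?C" using hyperbola_preimage[of ?M] by (simp only:)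
qed

section \<open>The Jacobian of a quadratic map and the normal form\<close>

definition jac :: "(nat \<Rightarrow> complex) \<Rightarrow> complex \<Rightarrow> complex \<Rightarrow> complex" where
  "jac c x y = (c 1 + 2 * c 3 * x + c 4 * y) * (c 8 + c 10 * x + 2 * c 11 * y)
     - (c 2 + c 4 * x + 2 * c 5 * y) * (c 7 + 2 * c 9 * x + c 10 * y)"

definition jac0 :: "(nat \<Rightarrow> complex) \<Rightarrow> complex" where "jac0 c = c 1 * c 8 - c 2 * c 7"
definition jacx :: "(nat \<Rightarrow> complex) \<Rightarrow> complex" where "jacx c = c 1 * c 10 + 2 * c 3 * c 8 - 2 * c 2 * c 9 - c 4 * c 7"
definition jacy :: "(nat \<Rightarrow> complex) \<Rightarrow> complex" where "jacy c = 2 * c 1 * c 11 + c 4 * c 8 - c 2 * c 10 - 2 * c 5 * c 7"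
definition jacxx :: "(nat \<Rightarrow> complex) \<Rightarrow> complex" where "jacxx c = 2 * c 3 * c 10 - 2 * c 4 * c 9"
definition jacxy :: "(nat \<Rightarrow> complex) \<Rightarrow> complex" where "jacxy c = 4 * c 3 * c 11 - 4 * c 5 * c 9"
definition jacyy :: "(nat \<Rightarrow> complex) \<Rightarrow> complex" where "jacyy c = 2 * c 4 * c 11 - 2 * c 5 * c 10"

lemma jac_qpoly: "jac c x y = qpoly (jac0 c) (jacx c) (jacy c) (jacxx c) (jacxy c) (jacyy c) x y"
  unfolding jac_def qpoly_def jac0_def jacx_def jacy_def jacxx_def jacxy_def jacyy_def by (simp add: algebra_simps power2_eq_square)

text \<open>\<open>jacobian\<close> is built from one-variable derivatives, so the chain rule comes
  from differentiating the explicit composite; \<open>prod\<close> and \<open>prod'\<close> express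
  multiplicativity of 2 by 2 determinants.\<close>

lemma jacobian_orbit:
  "jacobian (aff p q r s u v \<circ> quad_map c \<circ> aff p' q' r' s' u' v') z =
   (p * s - q * r) * (p' * s' - q' * r') * jac c (p' * z$1 + q' * z$2 + u') (r' * z$1 + s' * z$2 + v')"
proof -
  have 21: "(2::2) \<noteq> 1" by simp
  let ?X = "p' * z$1 + q' * z$2 + u'" and ?Y = "r' * z$1 + s' * z$2 + v'"
  let ?gx = "c 1 + 2 * c 3 * ?X + c 4 * ?Y" and ?gy = "c 2 + c 4 * ?X + 2 * c 5 * ?Y"
  let ?hx = "c 7 + 2 * c 9 * ?X + c 10 * ?Y" and ?hy = "c 8 + c 10 * ?X + 2 * c 11 * ?Y"
  let ?f = "aff p q r s u v \<circ> quad_map c \<circ> aff p' q' r' s' u' v'"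
  have d11: "deriv (\<lambda>t. ?f (\<chi> k. if k = 1 then t else z$k) $ 1) (z$1) = p * (?gx * p' + ?gy * r') + q * (?hx * p' + ?hy * r')"
    by (rule DERIV_imp_deriv)
       (auto simp: quad_map_def algebra_simps power2_eq_square intro!: derivative_eq_intros)
  have d21: "deriv (\<lambda>t. ?f (\<chi> k. if k = 1 then t else z$k) $ 2) (z$1) = r * (?gx * p' + ?gy * r') + s * (?hx * p' + ?hy * r')"
    by (rule DERIV_imp_deriv)
       (auto simp: quad_map_def algebra_simps power2_eq_square intro!: derivative_eq_intros)
  have d12: "deriv (\<lambda>t. ?f (\<chi> k. if k = 2 then t else z$k) $ 1) (z$2) = p * (?gx * q' + ?gy * s') + q * (?hx * q' + ?hy * s')"
    by (rule DERIV_imp_deriv)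
       (auto simp: quad_map_def algebra_simps power2_eq_square intro!: derivative_eq_intros)
  have d22: "deriv (\<lambda>t. ?f (\<chi> k. if k = 2 then t else z$k) $ 2) (z$2) = r * (?gx * q' + ?gy * s') + s * (?hx * q' + ?hy * s')"
    by (rule DERIV_imp_deriv)
       (auto simp: quad_map_def algebra_simps power2_eq_square intro!: derivative_eq_intros)
  have prod: "(p * A + q * B) * (r * C + s * D) - (p * C + q * D) * (r * A + s * B) = (p * s - q * r) * (A * D - B * C)"
    for A B C D
    by (simp add: algebra_simps)
  have prod': "(gx * p' + gy * r') * (hx * q' + hy * s') - (hx * p' + hy * r') * (gx * q' + gy * s')
      = (p' * s' - q' * r') * (gx * hy - gy * hx)" for gx gy hx hy
    by (simp add: algebra_simps)
  show ?thesis
    unfolding jacobian_def det_2 by (simp only: vec_lambda_beta d11 d12 d21 d22 prod prod' jac_def mult.assoc)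
qed

lemma jacobian_quad_map: "jacobian (quad_map c) z = jac c (z$1) (z$2)"
  using jacobian_orbit[of 1 0 0 1 0 0 c 1 0 0 1 0 0 z] by (simp add: aff_id)

definition jac_disc :: "(nat \<Rightarrow> complex) \<Rightarrow> complex" where
  "jac_disc c = conic_disc (jacxx c) (jacxy c) (jacyy c)"

definition jac_det :: "(nat \<Rightarrow> complex) \<Rightarrow> complex" where
  "jac_det c = conic_det (jac0 c) (jacx c) (jacy c) (jacxx c) (jacxy c) (jacyy c)"

lemma hyperbola_quad_map_iff:
  "is_hyperbola (critical_set (quad_map c)) \<longleftrightarrow> jac_disc c \<noteq> 0 \<and> jac_det c \<noteq> 0"
  unfolding critical_set_def jacobian_quad_map jac_qpoly is_hyperbola_conic_iff jac_disc_def jac_det_def ..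

definition f1_coeffs :: "nat \<Rightarrow> complex" where
  "f1_coeffs i = (if i \<in> {2, 3, 7, 11} then 1 else 0)"

lemma quad_map_f1_coeffs: "quad_map f1_coeffs = f1"
  by (rule ext) (simp add: quad_map_def f1_def f1_coeffs_def vec2_eq_iff)

lemma f1_coeffs_in: "f1_coeffs \<in> affine_space 12"
  by (auto simp: affine_space_def f1_coeffs_def)

lemma jac_f1_coeffs: "jac f1_coeffs x y = 4 * x * y - 1"
  by (simp add: jac_def f1_coeffs_def)

lemma orbit_f1_imp_hyperbola:
  assumes "f \<in> orbit f1"
  shows "is_hyperbola (critical_set f)"
proof -
  obtain p q r s u v p' q' r' s' u' v' where n: "p * s - q * r \<noteq> 0" "p' * s' - q' * r' \<noteq> 0"
      and f: "f = aff p q r s u v \<circ> f1 \<circ> aff p' q' r' s' u' v'"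
    using assms unfolding orbit_def GA2_iff by blast
  let ?M = "aff (4 * p') (4 * q') r' s' (4 * u') v'"
  have "4 * p' * s' - 4 * q' * r' = 4 * (p' * s' - q' * r')" by simp
  then have "?M \<in> GA2" using n(2) by (intro aff_in_GA2) simp
  moreover have "critical_set f = {z. ?M z $ 1 * ?M z $ 2 = 1}"
  proof -
    have "4 * p' * z$1 + 4 * q' * z$2 + 4 * u' = 4 * (p' * z$1 + q' * z$2 + u')" for z :: "complex^2"
      by (simp add: algebra_simps)
    then show ?thesis
      unfolding critical_set_def f quad_map_f1_coeffs[symmetric] jacobian_orbit jac_f1_coeffs aff_nth
      using n by (simp only: mult_eq_0_iff) simp
  qed
  ultimately show ?thesis using hyperbola_preimage[of ?M] by (simp only:)
qed

text \<open>The vanishing coefficients of the Jacobian force the shape (c 3, c 9) (x^2 + la y) + (c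
  5, c 11) (y^2 + mu x) plus a constant vector, with independent vectors and la mu = 4. A diagonal
  scaling of x and y then brings both brackets to the components of \<open>f1\<close> up to factors,
  which \<open>?L\<close> absorbs.\<close>

lemma unit_hyperbola_imp_orbit_f1:
  assumes "\<And>x y. jac c x y = 0 \<longleftrightarrow> x * y = 1"
  shows "quad_map c \<in> orbit f1"
proof -
  have j: "jacx c = 0" "jacy c = 0" "jacxx c = 0" "jacyy c = 0" "jacxy c = - jac0 c" "jac0 c \<noteq> 0"
    using qpoly_unit_hyperbola[OF assms[unfolded jac_qpoly]] by auto
  define D where "D = c 3 * c 11 - c 5 * c 9"
  have xy: "jacxy c = 4 * D" by (simp add: jacxy_def D_def algebra_simps)
  have D: "D \<noteq> 0" using j xy by auto
  have j3: "c 3 * c 10 - c 4 * c 9 = 0" and j4: "c 4 * c 11 - c 5 * c 10 = 0"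
    using j(3,4) by (simp_all add: jacxx_def jacyy_def)
  \<comment> \<open>The vector (c 4, c 10) is parallel to both (c 3, c 9) and (c 5, c 11). These are
    independent since D is nonzero, so it must vanish.\<close>
  have "D * c 4 = c 3 * (c 4 * c 11 - c 5 * c 10) + c 5 * (c 3 * c 10 - c 4 * c 9)"
    "D * c 10 = c 11 * (c 3 * c 10 - c 4 * c 9) + c 9 * (c 4 * c 11 - c 5 * c 10)"
    unfolding D_def by (simp_all add: algebra_simps)
  then have "D * c 4 = 0" "D * c 10 = 0"
    unfolding j3 j4 by simp_all
  then have c4: "c 4 = 0" "c 10 = 0" using D by auto
  \<comment> \<open>By Cramer's rule these are the coefficients of (c 2, c 8) along (c 3, c 9) and
    of (c 1, c 7) along (c 5, c 11); \<open>j1\<close> and \<open>j2\<close> make the other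
    coefficients vanish.\<close>
  define la where "la = (c 2 * c 11 - c 8 * c 5) / D"
  define mu where "mu = (c 7 * c 3 - c 1 * c 9) / D"
  have Dla: "D * la = c 2 * c 11 - c 8 * c 5" and Dmu: "D * mu = c 7 * c 3 - c 1 * c 9"
    using D by (simp_all add: la_def mu_def)
  have j1: "c 3 * c 8 - c 2 * c 9 = 0" and j2: "c 1 * c 11 - c 5 * c 7 = 0"
    using j(1,2) c4 by (simp_all add: jacx_def jacy_def)
  have "D * c 2 = D * la * c 3 + c 5 * (c 3 * c 8 - c 2 * c 9)" "D * c 8 = D * la * c 9 + c 11 * (c 3 * c 8 - c 2 * c 9)"
      "D * c 1 = D * mu * c 5 + c 3 * (c 1 * c 11 - c 5 * c 7)" "D * c 7 = D * mu * c 11 + c 9 * (c 1 * c 11 - c 5 * c 7)"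
    unfolding Dla Dmu by (simp_all add: D_def algebra_simps)
  then have "D * c 2 = D * (la * c 3)" "D * c 8 = D * (la * c 9)" "D * c 1 = D * (mu * c 5)" "D * c 7 = D * (mu * c 11)"
    unfolding j1 j2 by (simp_all add: mult.assoc)
  then have l: "c 2 = la * c 3" "c 8 = la * c 9" "c 1 = mu * c 5" "c 7 = mu * c 11"
    using D by simp_all
  have "jac0 c = - (la * mu * D)" unfolding jac0_def l D_def by (simp add: algebra_simps)
  then have "D * (la * mu) = D * 4" using j(5) xy by (simp add: algebra_simps)
  then have lamu: "la * mu = 4" using D by simp
  then have la0: "la \<noteq> 0" by auto
  \<comment> \<open>The scaling factors must satisfy \<beta> / \<alpha>^2 = la and \<alpha> /
    \<beta>^2 = mu. Eliminating \<beta> with la mu = 4 leaves \<alpha>^3 = 1 / (4 la).\<close>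
  define \<alpha> where "\<alpha> = exp (ln (1 / (4 * la)) / 3)"
  have \<alpha>0: "\<alpha> \<noteq> 0" by (simp add: \<alpha>_def)
  have "\<alpha> ^ 3 = exp (3 * (ln (1 / (4 * la)) / 3))"
    by (simp only: \<alpha>_def exp_of_nat_mult[symmetric] of_nat_numeral)
  also have "\<dots> = 1 / (4 * la)" using la0 by (simp add: exp_Ln)
  finally have \<alpha>: "\<alpha>^3 * (4 * la) = 1" using la0 by simp
  define \<beta> where "\<beta> = la * \<alpha>^2"
  have \<beta>0: "\<beta> \<noteq> 0" using la0 \<alpha>0 by (simp add: \<beta>_def)
  have mube: "mu * \<beta>^2 = \<alpha>"
  proof -
    have "mu * \<beta>^2 = \<alpha> * (\<alpha>^3 * ((la * mu) * la))"
      by (simp add: \<beta>_def power2_eq_square eval_nat_numeral)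
    then show ?thesis using \<alpha> by (simp add: lamu)
  qed
  let ?L = "aff (c 3 / \<alpha>^2) (c 5 / \<beta>^2) (c 9 / \<alpha>^2) (c 11 / \<beta>^2) (c 0) (c 6)"
  let ?R = "aff \<alpha> 0 0 \<beta> 0 0"
  have "c 3 / \<alpha>^2 * (c 11 / \<beta>^2) - c 5 / \<beta>^2 * (c 9 / \<alpha>^2) = D / (\<alpha>^2 * \<beta>^2)"
    using \<alpha>0 \<beta>0 by (simp add: D_def field_simps)
  then have LR: "?L \<in> GA2" "?R \<in> GA2" using D \<alpha>0 \<beta>0 by (auto intro!: aff_in_GA2)
  have \<beta>\<alpha>: "\<beta> / \<alpha>^2 = la" "\<alpha> / \<beta>^2 = mu"
    using \<alpha>0 \<beta>0 mube by (simp_all add: \<beta>_def field_simps)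
  have lin: "a / \<alpha>^2 * ((\<alpha> * x)^2 + \<beta> * y) + b / \<beta>^2 * ((\<beta> * y)^2 + \<alpha> * x) =
      a * x^2 + (la * a) * y + b * y^2 + (mu * b) * x" for a b x y
  proof -
    have "a / \<alpha>^2 * ((\<alpha> * x)^2 + \<beta> * y) + b / \<beta>^2 * ((\<beta> * y)^2 + \<alpha> * x) =
      a * x^2 + a * (\<beta> / \<alpha>^2) * y + b * y^2 + b * (\<alpha> / \<beta>^2) * x"
      using \<alpha>0 \<beta>0 by (simp add: field_simps)
    then show ?thesis by (simp add: \<beta>\<alpha> mult.commute)
  qed
  have "quad_map c = ?L \<circ> f1 \<circ> ?R"
  proof
    fix z
    show "quad_map c z = (?L \<circ> f1 \<circ> ?R) z"
      using lin[of "c 3" "z$1" "z$2" "c 5"] lin[of "c 9" "z$1" "z$2" "c 11"]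
      by (simp add: vec2_eq_iff quad_map_def f1_def c4 l del: One_nat_def)
  qed
  then show ?thesis unfolding orbit_def using LR by blast
qed

theorem hyperbola_iff_orbit_f1:
  assumes "f \<in> Omega 2 2"
  shows "is_hyperbola (critical_set f) \<longleftrightarrow> f \<in> orbit f1"
proof
  assume "is_hyperbola (critical_set f)"
  then obtain L where L: "L \<in> GA2" "critical_set f = L ` {z. z$1 * z$2 = 1}"
    unfolding is_hyperbola_def by blast
  obtain p q r s u v where P: "p * s - q * r \<noteq> 0" "L = aff p q r s u v"
    using L(1) unfolding GA2_iff by blast
  obtain M where M: "M \<circ> L = id" using inverse_in_GA2[OF L(1)] by blast
  have inj: "inj L" using M by (metis inj_on_id inj_on_imageI2)
  \<comment> \<open>Precomposition with L carries the critical set to x y = 1 itself without leaving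
    the orbit.\<close>
  have "f \<circ> L \<in> orbit f" unfolding orbit_def mem_Collect_eq
    using L(1) id_in_GA2 by (intro exI[of _ id] exI[of _ L]) simp
  then have "f \<circ> L \<in> Omega 2 2" using Omega_orbit assms by blast
  then obtain c' where c': "f \<circ> L = quad_map c'"
    using bij_betw_quad_map by (metis bij_betw_imp_surj_on imageE)
  obtain c where c: "f = quad_map c"
    using bij_betw_quad_map assms by (metis bij_betw_imp_surj_on imageE)
  have "jac c' x y = 0 \<longleftrightarrow> x * y = 1" for x y
  proof -
    let ?z = "vector [x, y] :: complex^2"
    have "jac c' x y = jacobian (aff 1 0 0 1 0 0 \<circ> quad_map c \<circ> L) ?z"
      by (simp add: aff_id c[symmetric] c' jacobian_quad_map)
    also have "\<dots> = (p * s - q * r) * jacobian (quad_map c) (L ?z)"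
      unfolding P(2) jacobian_orbit by (simp add: jacobian_quad_map)
    finally have "jac c' x y = 0 \<longleftrightarrow> L ?z \<in> critical_set f"
      using P(1) by (simp add: critical_set_def c)
    also have "\<dots> \<longleftrightarrow> x * y = 1"
      unfolding L(2) using inj by (auto simp: inj_image_mem_iff)
    finally show ?thesis .
  qed
  then have "f \<circ> L \<in> orbit f1" unfolding c' by (rule unit_hyperbola_imp_orbit_f1)
  then show "f \<in> orbit f1"
    using \<open>f \<circ> L \<in> orbit f\<close> orbit_sym orbit_trans by blast
qed (rule orbit_f1_imp_hyperbola)

text \<open>This presents the orbit as the non-vanishing locus of a single polynomial in the
  coefficients, the situation of \<open>principal_open\<close>.\<close>

lemma coeff_set_orbit_f1:
  "coeff_set (orbit f1) = {c \<in> affine_space 12. jac_disc c * jac_det c \<noteq> 0}"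
proof -
  have "quad_map c \<in> orbit f1 \<longleftrightarrow> jac_disc c \<noteq> 0 \<and> jac_det c \<noteq> 0" if "c \<in> affine_space 12" for c
    using hyperbola_iff_orbit_f1 hyperbola_quad_map_iff bij_betw_quad_map that by (metis bij_betwE)
  then show ?thesis by (auto simp: coeff_set_def)
qed

section \<open>Algebraic dependence\<close>

lemma poly_funs_sum: "(\<And>i. i \<in> A \<Longrightarrow> f i \<in> poly_funs N) \<Longrightarrow> (\<lambda>x. \<Sum>i\<in>A. f i x) \<in> poly_funs N"
  by (induction A rule: infinite_finite_induct) (auto intro: poly_funs.intros)

lemma poly_funs_prod: "(\<And>i. i \<in> A \<Longrightarrow> f i \<in> poly_funs N) \<Longrightarrow> (\<lambda>x. \<Prod>i\<in>A. f i x) \<in> poly_funs N"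
  by (induction A rule: infinite_finite_induct) (auto intro: poly_funs.intros)

lemma poly_funs_power: "p \<in> poly_funs N \<Longrightarrow> (\<lambda>x. p x ^ n) \<in> poly_funs N"
  by (induction n) (auto intro: poly_funs.intros)

lemma poly_funs_uminus: "p \<in> poly_funs N \<Longrightarrow> (\<lambda>x. - p x) \<in> poly_funs N"
  using poly_funs.mult[OF poly_funs.const[of "-1" N]] by simp

lemma poly_funs_diff: "p \<in> poly_funs N \<Longrightarrow> q \<in> poly_funs N \<Longrightarrow> (\<lambda>x. p x - q x) \<in> poly_funs N"
  using poly_funs.add[OF _ poly_funs_uminus, of p N q] by simp

lemma sum_fun_apply: "(\<Sum>a\<in>A. f a) x = (\<Sum>a\<in>A. f a x)" for f :: "'a \<Rightarrow> 'b \<Rightarrow> 'c::comm_monoid_add"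
  by (induction A rule: infinite_finite_induct) auto

definition fscale :: "complex \<Rightarrow> ('a \<Rightarrow> complex) \<Rightarrow> 'a \<Rightarrow> complex" where
  "fscale c f = (\<lambda>x. c * f x)"

interpretation fun_space: vector_space fscale
  by standard (rule ext, simp add: fscale_def distrib_left distrib_right mult.assoc)+

definition monomial :: "nat \<Rightarrow> (nat \<Rightarrow> nat) \<Rightarrow> (nat \<Rightarrow> complex) \<Rightarrow> complex" where
  "monomial N e x = (\<Prod>i<N. x i ^ e i)"

text \<open>Bounding each exponent separately, rather than the total degree, makes the count (m +
  1)^N immediate and the bounds additive under products.\<close>

definition monomials :: "nat \<Rightarrow> nat \<Rightarrow> ((nat \<Rightarrow> complex) \<Rightarrow> complex) set" where
  "monomials N m = monomial N ` ({..<N} \<rightarrow>\<^sub>E {..m})"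

lemma finite_monomials: "finite (monomials N m)"
  and card_monomials: "card (monomials N m) \<le> (m + 1) ^ N"
proof -
  have "finite ({..<N} \<rightarrow>\<^sub>E {..m})" by (intro finite_PiE) auto
  then show "finite (monomials N m)" "card (monomials N m) \<le> (m + 1) ^ N"
    unfolding monomials_def using card_image_le[of "{..<N} \<rightarrow>\<^sub>E {..m}" "monomial N"]
    by (auto simp: card_PiE)
qed

lemma monomial_in_monomials:
  assumes "\<And>i. i < N \<Longrightarrow> e i \<le> m"
  shows "monomial N e \<in> monomials N m"
proof -
  have "monomial N e = monomial N (restrict e {..<N})"
    by (rule ext) (simp add: monomial_def)
  moreover have "restrict e {..<N} \<in> {..<N} \<rightarrow>\<^sub>E {..m}"
    using assms by auto
  ultimately show ?thesis unfolding monomials_def by blast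
qed

lemma monomials_mono: "m \<le> m' \<Longrightarrow> monomials N m \<subseteq> monomials N m'"
proof
  fix f assume "m \<le> m'" "f \<in> monomials N m"
  then obtain e where e: "f = monomial N e" "e \<in> {..<N} \<rightarrow>\<^sub>E {..m}" by (auto simp: monomials_def)
  show "f \<in> monomials N m'"
    unfolding e(1) using e(2) \<open>m \<le> m'\<close> by (intro monomial_in_monomials) (force dest: PiE_mem)
qed

lemma monomial_mult: "monomial N e x * monomial N e' x = monomial N (\<lambda>i. e i + e' i) x"
  by (simp add: monomial_def prod.distrib[symmetric] power_add)

lemma monomials_mult:
  assumes "f \<in> monomials N m" "g \<in> monomials N m'"
  shows "(\<lambda>x. f x * g x) \<in> monomials N (m + m')"
proof -
  obtain e where e: "f = monomial N e" "e \<in> {..<N} \<rightarrow>\<^sub>E {..m}" using assms(1) by (auto simp: monomials_def)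
  obtain e' where e': "g = monomial N e'" "e' \<in> {..<N} \<rightarrow>\<^sub>E {..m'}" using assms(2) by (auto simp: monomials_def)
  have "(\<lambda>x. f x * g x) = monomial N (\<lambda>i. e i + e' i)"
    by (rule ext) (simp add: e e' monomial_mult)
  moreover have "e i + e' i \<le> m + m'" if "i < N" for i
    using PiE_mem[OF e(2), of i] PiE_mem[OF e'(2), of i] that by auto
  ultimately show ?thesis by (simp add: monomial_in_monomials)
qed

text \<open>For a fixed factor, the functions whose product with it lies in the target span form a
  subspace. Span minimality is used once for each factor.\<close>

lemma span_monomials_mult:
  assumes f: "f \<in> fun_space.span (monomials N m)" and g: "g \<in> fun_space.span (monomials N m')"
  shows "(\<lambda>x. f x * g x) \<in> fun_space.span (monomials N (m + m'))"
proof -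
  let ?W = "fun_space.span (monomials N (m + m'))"
  have sub: "fun_space.subspace {f. (\<lambda>x. f x * g x) \<in> ?W}" for g
  proof (rule fun_space.subspaceI)
    have "(\<lambda>x. (0 :: 'a \<Rightarrow> complex) x * g x) = 0" for g :: "'a \<Rightarrow> complex" by auto
    then show "0 \<in> {f. (\<lambda>x. f x * g x) \<in> ?W}"
      using fun_space.span_zero[of "monomials N (m + m')"] by (simp add: zero_fun_def)
    show "f + f' \<in> {f. (\<lambda>x. f x * g x) \<in> ?W}"
      if "f \<in> {f. (\<lambda>x. f x * g x) \<in> ?W}" "f' \<in> {f. (\<lambda>x. f x * g x) \<in> ?W}" for f f'
      using fun_space.span_add[of "\<lambda>x. f x * g x" "monomials N (m + m')" "\<lambda>x. f' x * g x"] that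
      by (simp add: plus_fun_def distrib_right)
    show "fscale c f \<in> {f. (\<lambda>x. f x * g x) \<in> ?W}" if "f \<in> {f. (\<lambda>x. f x * g x) \<in> ?W}" for c f
      using fun_space.span_scale[of "\<lambda>x. f x * g x" "monomials N (m + m')" c] that
      by (simp add: fscale_def mult.assoc)
  qed
  have base: "(\<lambda>x. f x * g x) \<in> ?W" if "f \<in> fun_space.span (monomials N m)" "g \<in> monomials N m'" for f g
  proof -
    have "monomials N m \<subseteq> {f. (\<lambda>x. f x * g x) \<in> ?W}"
      using that(2) monomials_mult fun_space.span_base by blast
    from fun_space.span_minimal[OF this sub] show ?thesis using that(1) by blast
  qed
  have "monomials N m' \<subseteq> {g. (\<lambda>x. g x * f x) \<in> ?W}"
    using base[OF f] by (auto simp: mult.commute)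
  from fun_space.span_minimal[OF this sub] show ?thesis using g by (auto simp: mult.commute)
qed

lemma span_monomials_mono: "f \<in> fun_space.span (monomials N m) \<Longrightarrow> m \<le> m' \<Longrightarrow> f \<in> fun_space.span (monomials N m')"
  using fun_space.span_mono[OF monomials_mono] by blast

lemma const_in_span_monomials: "(\<lambda>x. c) \<in> fun_space.span (monomials N m)"
proof -
  have "fscale c (monomial N (\<lambda>_. 0)) \<in> fun_space.span (monomials N m)"
    by (intro fun_space.span_scale fun_space.span_base monomial_in_monomials) simp
  then show ?thesis by (simp add: fscale_def monomial_def)
qed

lemma poly_fun_in_span:
  "p \<in> poly_funs N \<Longrightarrow> \<exists>m. p \<in> fun_space.span (monomials N m)"
proof (induction rule: poly_funs.induct)
  case (const c)
  then show ?case using const_in_span_monomials by blast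
next
  case (coord i)
  have "(\<lambda>x. x i) = monomial N (\<lambda>j. if j = i then 1 else 0)"
    using coord by (intro ext) (simp add: monomial_def if_distrib[of "(^) _"] prod.delta cong: if_cong)
  also have "\<dots> \<in> monomials N 1" by (rule monomial_in_monomials) simp
  finally show ?case using fun_space.span_base by blast
next
  case (add p q)
  then obtain m m' where "p \<in> fun_space.span (monomials N m)" "q \<in> fun_space.span (monomials N m')" by blast
  then have "p + q \<in> fun_space.span (monomials N (m + m'))"
    by (intro fun_space.span_add) (auto elim: span_monomials_mono)
  then show ?case by (auto simp: plus_fun_def)
next
  case (mult p q)
  then show ?case using span_monomials_mult by blast
qed

lemma span_monomials_power:
  assumes "f \<in> fun_space.span (monomials N m)"
  shows "(\<lambda>x. f x ^ a) \<in> fun_space.span (monomials N (a * m))"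
proof (induction a)
  case 0
  then show ?case using const_in_span_monomials[of 1] by simp
next
  case (Suc a)
  then show ?case using span_monomials_mult[OF assms Suc] by simp
qed

lemma span_monomials_prod:
  assumes "\<And>i. i < d \<Longrightarrow> f i \<in> fun_space.span (monomials N m)"
  shows "(\<lambda>x. \<Prod>i<d. f i x) \<in> fun_space.span (monomials N (d * m))"
  using assms
proof (induction d)
  case 0
  then show ?case using const_in_span_monomials[of 1] by simp
next
  case (Suc d)
  then have "(\<lambda>x. (\<Prod>i<d. f i x) * f d x) \<in> fun_space.span (monomials N (d * m + m))"
    by (intro span_monomials_mult) auto
  then show ?case by (simp add: add.commute)
qed

lemma sum_digits: "(\<Sum>i<d. (n div k ^ i) mod k * k ^ i) = n mod k ^ d" for n k :: nat
proof (induction d)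
  case (Suc d)
  have "n mod (k ^ d * k) = k ^ d * (n div k ^ d mod k) + n mod k ^ d" by (rule mod_mult2_eq)
  then show ?case using Suc by (simp add: mult.commute)
qed simp

text \<open>Counting: of the \<open>k ^ d\<close> products of powers below \<open>k\<close> of \<open>d > N\<close> polynomials in \<open>N\<close>
  variables, more than \<open>O(k ^ N)\<close> cannot be linearly independent. The relation between them is not the
  zero polynomial, since \<open>y i = t ^ (k ^ i)\<close> turns its monomials into distinct powers of \<open>t\<close>.\<close>

theorem algebraically_dependent:
  assumes p: "\<And>i. i < d \<Longrightarrow> p i \<in> poly_funs N" and "N < d"
  shows "\<exists>F\<in>poly_funs d. (\<forall>x. F (\<lambda>i. if i < d then p i x else 0) = 0) \<and> (\<exists>y\<in>affine_space d. F y \<noteq> 0)"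
proof -
  have "\<forall>i. \<exists>m. i < d \<longrightarrow> p i \<in> fun_space.span (monomials N m)"
    using p poly_fun_in_span by blast
  then obtain m where m: "\<And>i. i < d \<Longrightarrow> p i \<in> fun_space.span (monomials N (m i))" by metis
  define D where "D = (\<Sum>i<d. m i)"
  have "m i \<le> D" if "i < d" for i
    unfolding D_def using that by (intro member_le_sum) auto
  then have pD: "p i \<in> fun_space.span (monomials N D)" if "i < d" for i
    using m span_monomials_mono that by blast
  \<comment> \<open>Chosen so that (d k D + 1)^N \<le> k^N (d D + 1)^N < k^(N + 1) \<le> k^d: there
    are fewer monomials than products.\<close>
  define k where "k = (d * D + 1) ^ N + 1"
  have k: "k > 0" by (simp add: k_def)
  define dig where "dig n i = (n div k ^ i) mod k" for n i
  define G where "G n = (\<lambda>x. \<Prod>i<d. p i x ^ dig n i)" for n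
  have G: "G n \<in> fun_space.span (monomials N (d * (k * D)))" for n
    unfolding G_def
  proof (rule span_monomials_prod)
    fix i assume "i < d"
    from span_monomials_power[OF pD[OF this], of "dig n i"]
    show "(\<lambda>x. p i x ^ dig n i) \<in> fun_space.span (monomials N (k * D))"
      by (rule span_monomials_mono) (simp add: dig_def k less_imp_le)
  qed
  have "card (monomials N (d * (k * D))) \<le> (d * (k * D) + 1) ^ N" by (rule card_monomials)
  also have "\<dots> \<le> (k * (d * D + 1)) ^ N" using k by (intro power_mono) (auto simp: algebra_simps)
  also have "\<dots> = k ^ N * (d * D + 1) ^ N" by (rule power_mult_distrib)
  also have "\<dots> < k ^ N * k" using k by (intro mult_strict_left_mono) (auto simp: k_def)
  also have "\<dots> \<le> k ^ d" using \<open>N < d\<close> k power_increasing[of "Suc N" d k] by (simp add: mult.commute)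
  finally have less: "card (monomials N (d * (k * D))) < k ^ d" .
  have "\<exists>c. (\<exists>n<k ^ d. c n \<noteq> 0) \<and> (\<forall>x. (\<Sum>n<k ^ d. c n * G n x) = 0)"
  proof (cases "inj_on G {..<k ^ d}")
    \<comment> \<open>Linear dependence speaks of sets of functions, so two products that coincide
      as functions are handled separately, by the coefficients 1 and -1.\<close>
    case False
    then obtain n n' where n: "n < k ^ d" "n' < k ^ d" "n \<noteq> n'" "G n = G n'" by (auto simp: inj_on_def)
    define c :: "nat \<Rightarrow> complex" where "c j = (if j = n then 1 else if j = n' then - 1 else 0)" for j
    have "(\<Sum>j<k ^ d. c j * G j x) = 0" for x
    proof -
      have "(\<Sum>j<k ^ d. c j * G j x) = (\<Sum>j\<in>{n, n'}. c j * G j x)"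
        using n by (intro sum.mono_neutral_right) (auto simp: c_def)
      then show ?thesis using n by (simp add: c_def)
    qed
    then show ?thesis using n(1) by (intro exI[of _ c]) (auto simp: c_def intro!: exI[of _ n])
  next
    case True
    let ?S = "G ` {..<k ^ d}"
    have "\<not> fun_space.independent ?S"
    proof
      assume "fun_space.independent ?S"
      from fun_space.independent_span_bound[OF finite_monomials this]
      have "card ?S \<le> card (monomials N (d * (k * D)))" using G by blast
      then show False using less True by (simp add: card_image)
    qed
    then obtain u where u: "\<exists>v\<in>?S. u v \<noteq> 0" "(\<Sum>v\<in>?S. fscale (u v) v) = 0"
      using fun_space.dependent_finite[of ?S] by auto
    have "(\<Sum>n<k ^ d. u (G n) * G n x) = 0" for x
    proof -
      have "(\<Sum>n<k ^ d. u (G n) * G n x) = (\<Sum>v\<in>?S. fscale (u v) v x)"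
        using True by (simp add: sum.reindex fscale_def)
      also have "\<dots> = (\<Sum>v\<in>?S. fscale (u v) v) x" by (rule sum_fun_apply[symmetric])
      finally show ?thesis unfolding u(2) by simp
    qed
    then show ?thesis using u(1) by (intro exI[of _ "\<lambda>n. u (G n)"]) auto
  qed
  then obtain c where c: "\<exists>n<k ^ d. c n \<noteq> 0" "\<And>x. (\<Sum>n<k ^ d. c n * G n x) = 0" by blast
  define F where "F = (\<lambda>y. \<Sum>n<k ^ d. c n * (\<Prod>i<d. y i ^ dig n i))"
  have "F \<in> poly_funs d"
    unfolding F_def by (intro poly_funs_sum poly_funs.mult poly_funs.const poly_funs_prod poly_funs_power poly_funs.coord) auto
  moreover have "F (\<lambda>i. if i < d then p i x else 0) = 0" for x
    using c(2)[of x] by (simp add: F_def G_def)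
  moreover have "\<exists>y\<in>affine_space d. F y \<noteq> 0"
  proof (rule ccontr)
    assume "\<not> ?thesis"
    then have zero: "F y = 0" if "y \<in> affine_space d" for y using that by blast
    have "(\<Sum>n<k ^ d. c n * t ^ n) = 0" for t
    proof -
      let ?y = "\<lambda>i. if i < d then t ^ (k ^ i) else 0"
      have "(\<Prod>i<d. ?y i ^ dig n i) = t ^ n" if "n < k ^ d" for n
      proof -
        have "(\<Prod>i<d. ?y i ^ dig n i) = (\<Prod>i<d. t ^ (dig n i * k ^ i))"
          by (intro prod.cong) (auto simp: power_mult[symmetric] mult.commute)
        also have "\<dots> = t ^ (\<Sum>i<d. dig n i * k ^ i)" by (simp add: power_sum)
        also have "(\<Sum>i<d. dig n i * k ^ i) = n" using that by (simp add: dig_def sum_digits)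
        finally show ?thesis .
      qed
      then have "F ?y = (\<Sum>n<k ^ d. c n * t ^ n)" by (simp add: F_def)
      then show ?thesis using zero[of ?y] by (simp add: affine_space_def)
    qed
    moreover have "{..<k ^ d} = {..k ^ d - 1}"
      using k lessThan_Suc_atMost[of "k ^ d - 1"] by simp
    ultimately have "\<forall>n\<le>k ^ d - 1. c n = 0"
      using polyfun_eq_0[of c "k ^ d - 1"] by simp
    then show False using c(1) by auto
  qed
  ultimately show ?thesis by blast
qed

section \<open>Complements of hypersurfaces\<close>

lemma poly_funs_on_line:
  "p \<in> poly_funs N \<Longrightarrow> \<exists>P. \<forall>t. p (\<lambda>i. x i + t * v i) = poly P t"
proof (induction rule: poly_funs.induct)
  case (const c)
  then show ?case by (intro exI[of _ "[:c:]"]) simp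
next
  case (coord i)
  then show ?case by (intro exI[of _ "[:x i, v i:]"]) simp
next
  case (add p q)
  then obtain P Q where "\<forall>t. p (\<lambda>i. x i + t * v i) = poly P t" "\<forall>t. q (\<lambda>i. x i + t * v i) = poly Q t" by blast
  then show ?case by (intro exI[of _ "P + Q"]) simp
next
  case (mult p q)
  then obtain P Q where "\<forall>t. p (\<lambda>i. x i + t * v i) = poly P t" "\<forall>t. q (\<lambda>i. x i + t * v i) = poly Q t" by blast
  then show ?case by (intro exI[of _ "P * Q"]) simp
qed

lemma affine_space_line: "x \<in> affine_space N \<Longrightarrow> v \<in> affine_space N \<Longrightarrow> (\<lambda>i. x i + t * v i) \<in> affine_space N"
  by (simp add: affine_space_def)

lemma poly_funs_finite_zeros_on_line:
  assumes "p \<in> poly_funs N" "p y \<noteq> 0"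
  shows "finite {t. p (\<lambda>i. x i + t * (y i - x i)) = 0}"
proof -
  obtain P where P: "\<And>t. p (\<lambda>i. x i + t * (y i - x i)) = poly P t"
    using poly_funs_on_line[OF assms(1), of x "\<lambda>i. y i - x i"] by blast
  have "poly P 1 \<noteq> 0" using assms(2) P[of 1] by simp
  then have "P \<noteq> 0" by auto
  then show ?thesis unfolding P by (rule poly_roots_finite)
qed

text \<open>On the line through x and y both functions restrict to nonzero polynomials in one
  variable, with finitely many roots; any other parameter gives the point z.\<close>

lemma poly_funs_no_zero_divisors:
  assumes "p \<in> poly_funs N" "q \<in> poly_funs N" "x \<in> affine_space N" "y \<in> affine_space N" "p x \<noteq> 0" "q y \<noteq> 0"
  shows "\<exists>z\<in>affine_space N. p z \<noteq> 0 \<and> q z \<noteq> 0"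
proof -
  let ?l = "\<lambda>t i. y i + t * (x i - y i)"
  have "finite {t. p (?l t) = 0}"
    using assms by (intro poly_funs_finite_zeros_on_line)
  moreover have "finite {t. q (?l t) = 0}"
  proof -
    obtain Q where Q: "\<And>t. q (?l t) = poly Q t"
      using poly_funs_on_line[OF assms(2), of y "\<lambda>i. x i - y i"] by blast
    have "poly Q 0 \<noteq> 0" using assms(6) Q[of 0] by simp
    then have "Q \<noteq> 0" by auto
    then show ?thesis unfolding Q by (rule poly_roots_finite)
  qed
  ultimately have "finite ({t. p (?l t) = 0} \<union> {t. q (?l t) = 0})" by simp
  then have "{t. p (?l t) = 0} \<union> {t. q (?l t) = 0} \<noteq> UNIV" using infinite_UNIV_char_0 by metis
  then obtain t where "p (?l t) \<noteq> 0" "q (?l t) \<noteq> 0" by blast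
  moreover have "?l t \<in> affine_space N"
    using assms(3,4) by (simp add: affine_space_def)
  ultimately show ?thesis by blast
qed

lemma continuous_on_poly_funs: "p \<in> poly_funs N \<Longrightarrow> continuous_on UNIV p"
  by (induction rule: poly_funs.induct) (auto intro!: continuous_intros)

lemma poly_funs_cong: "p \<in> poly_funs N \<Longrightarrow> (\<And>i. i < N \<Longrightarrow> x i = y i) \<Longrightarrow> p x = p y"
  by (induction rule: poly_funs.induct) auto

lemma poly_funs_Suc: "p \<in> poly_funs N \<Longrightarrow> p \<in> poly_funs (Suc N)"
  by (induction rule: poly_funs.induct) (auto intro: poly_funs.intros)

interpretation seq_space: vector_space cscale
  by (rule vector_space_cscale)

lemma dim_affine_space: "seq_space.dim (affine_space N) = N"
proof (rule seq_space.dim_unique)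
  let ?e = "\<lambda>i j. if j = i then 1 else 0 :: complex"
  let ?B = "?e ` {..<N}"
  have inj: "inj_on ?e {..<N}"
    by (rule inj_onI) (metis one_neq_zero)
  show "?B \<subseteq> affine_space N" by (auto simp: affine_space_def)
  show "affine_space N \<subseteq> seq_space.span ?B"
  proof
    fix x assume x: "x \<in> affine_space N"
    have "x = (\<Sum>i<N. cscale (x i) (?e i))"
    proof
      fix j
      have "(\<Sum>i<N. cscale (x i) (?e i)) j = (\<Sum>i<N. if j = i then x i else 0)"
        unfolding sum_fun_apply by (intro sum.cong) (auto simp: cscale_def)
      then show "x j = (\<Sum>i<N. cscale (x i) (?e i)) j"
        using x by (simp add: affine_space_def)
    qed
    also have "\<dots> \<in> seq_space.span ?B"
      by (intro seq_space.span_sum seq_space.span_scale seq_space.span_base) auto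
    finally show "x \<in> seq_space.span ?B" .
  qed
  show "seq_space.independent ?B"
  proof
    assume "seq_space.dependent ?B"
    then obtain u i where u: "i < N" "u (?e i) \<noteq> 0" "(\<Sum>v\<in>?B. cscale (u v) v) = 0"
      using seq_space.dependent_finite[of ?B] by auto
    have "(\<Sum>v\<in>?B. cscale (u v) v) i = (\<Sum>j<N. if j = i then u (?e i) else 0)"
      unfolding sum_fun_apply sum.reindex[OF inj] by (intro sum.cong) (auto simp: cscale_def)
    then show False using u by simp
  qed
  show "card ?B = N" using inj by (simp add: card_image)
qed

locale principal_open =
  fixes N :: nat and P :: "(nat \<Rightarrow> complex) \<Rightarrow> complex" and x0 :: "nat \<Rightarrow> complex"
  assumes P: "P \<in> poly_funs N" and x0: "x0 \<in> affine_space N" "P x0 \<noteq> 0"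
begin

definition S :: "(nat \<Rightarrow> complex) set" where "S = {x \<in> affine_space N. P x \<noteq> 0}"

text \<open>If q were nonzero at some point, \<open>P\<close> and q would be nonzero at a common
  point, which lies in S. Zariski density, irreducibility, dimension and tangent spaces all rest on
  this.\<close>

lemma vanish_on_S:
  assumes "q \<in> poly_funs N" "\<And>x. x \<in> S \<Longrightarrow> q x = 0" "x \<in> affine_space N"
  shows "q x = 0"
  using poly_funs_no_zero_divisors[OF P assms(1) x0(1) assms(3) x0(2)] assms(2)
  by (auto simp: S_def)

lemma openin_zariski_S: "openin (zariski N) S"
proof -
  have "affine_space N - S = {x \<in> affine_space N. \<forall>p\<in>{P}. p x = 0}"
    by (auto simp: S_def)
  then have "algebraic_set N (affine_space N - S)"
    unfolding algebraic_set_def using P by (intro exI[of _ "{P}"]) auto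
  then show ?thesis by (auto simp: openin_zariski S_def)
qed

lemma algebraic_set_superset:
  assumes "algebraic_set N Z" "S \<subseteq> Z"
  shows "Z = affine_space N"
proof -
  obtain Q where Q: "Q \<subseteq> poly_funs N" "Z = {x \<in> affine_space N. \<forall>p\<in>Q. p x = 0}"
    using assms(1) unfolding algebraic_set_def by blast
  then have "p x = 0" if "p \<in> Q" "x \<in> affine_space N" for p x
    using vanish_on_S[of p x] that assms(2) by blast
  then show ?thesis unfolding Q(2) by blast
qed

lemma zariski_dense: "zariski N closure_of S = affine_space N"
proof (rule algebraic_set_superset)
  show "algebraic_set N (zariski N closure_of S)"
    using closedin_closure_of closedin_zariski by blast
  show "S \<subseteq> zariski N closure_of S"
    by (intro closure_of_subset) (auto simp: topspace_zariski S_def)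
qed

lemma openin_euclidean: "openin (top_of_set (affine_space N)) S"
proof -
  have "S = affine_space N \<inter> P -` (- {0})" by (auto simp: S_def)
  then show ?thesis
    using continuous_on_poly_funs[OF P] by (auto intro!: openin_open_Int open_vimage)
qed

text \<open>On the line from x to \<open>x0\<close>, \<open>P\<close> vanishes at finitely many
  parameters only, while every neighbourhood of x contains infinitely many points of that
  line.\<close>

lemma euclidean_dense: "top_of_set (affine_space N) closure_of S = affine_space N"
proof
  show "affine_space N \<subseteq> top_of_set (affine_space N) closure_of S"
  proof
    fix x assume x: "x \<in> affine_space N"
    let ?l = "\<lambda>t i. x i + t * (x0 i - x i)"
    show "x \<in> top_of_set (affine_space N) closure_of S"
      unfolding in_closure_of
    proof (intro conjI allI impI)
      show "x \<in> topspace (top_of_set (affine_space N))" using x by simp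
      fix T assume "x \<in> T \<and> openin (top_of_set (affine_space N)) T"
      then obtain U where U: "x \<in> U" "open U" "T = affine_space N \<inter> U" by (auto simp: openin_open)
      have "continuous_on UNIV ?l"
        by (intro continuous_on_coordinatewise_then_product continuous_intros)
      then have "open (?l -` U)" using U(2) by (simp add: open_vimage)
      moreover have "0 \<in> ?l -` U" using U(1) by simp
      ultimately obtain e where "e > 0" "ball 0 e \<subseteq> ?l -` U" by (meson open_contains_ball)
      then have "infinite (?l -` U)"
        using uncountable_ball[of e 0] countable_finite[of "ball 0 e"] finite_subset[of "ball 0 e" "?l -` U"] by blast
      moreover have "finite {t. P (?l t) = 0}"
        by (rule poly_funs_finite_zeros_on_line[OF P x0(2)])
      ultimately obtain t where "t \<in> ?l -` U" "P (?l t) \<noteq> 0"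
        using finite_subset[of "?l -` U" "{t. P (?l t) = 0}"] by blast
      moreover have "?l t \<in> affine_space N" using x x0(1) by (simp add: affine_space_def)
      ultimately show "\<exists>y. y \<in> S \<and> y \<in> T" using U(3) by (auto simp: S_def)
    qed
  qed
qed (use closure_of_subset_topspace[of "top_of_set (affine_space N)" S] in simp)

lemma irreducible_space_S: "irreducible_space (subtopology (zariski N) S)"
proof -
  have top: "topspace (subtopology (zariski N) S) = S"
    by (auto simp: topspace_zariski S_def)
  have "A = S \<or> B = S"
    if A: "closedin (subtopology (zariski N) S) A" and B: "closedin (subtopology (zariski N) S) B"
      and AB: "S = A \<union> B" for A B
  proof (rule ccontr)
    assume "\<not> (A = S \<or> B = S)"
    then obtain a b where ab: "a \<in> S" "a \<notin> A" "b \<in> S" "b \<notin> B" using AB by blast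
    obtain T where T: "algebraic_set N T" "A = T \<inter> S"
      using A by (auto simp: closedin_subtopology closedin_zariski)
    obtain T' where T': "algebraic_set N T'" "B = T' \<inter> S"
      using B by (auto simp: closedin_subtopology closedin_zariski)
    obtain p where p: "p \<in> poly_funs N" "\<forall>y\<in>T. p y = 0" "p a \<noteq> 0"
      using algebraic_set_separate[OF T(1), of a] ab T(2) by (auto simp: S_def)
    obtain q where q: "q \<in> poly_funs N" "\<forall>y\<in>T'. q y = 0" "q b \<noteq> 0"
      using algebraic_set_separate[OF T'(1), of b] ab T'(2) by (auto simp: S_def)
    have "a \<in> affine_space N" "b \<in> affine_space N" using ab by (auto simp: S_def)
    from poly_funs_no_zero_divisors[OF p(1) q(1) this p(3) q(3)]
    obtain z where z: "z \<in> affine_space N" "p z * q z \<noteq> 0" by auto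
    have "p z * q z = 0"
    proof (rule vanish_on_S[OF poly_funs.mult[OF p(1) q(1)] _ z(1)])
      fix x assume "x \<in> S"
      then have "x \<in> A \<or> x \<in> B" unfolding AB by blast
      then have "x \<in> T \<or> x \<in> T'" unfolding T(2) T'(2) by blast
      then show "p x * q x = 0" using p(2) q(2) by auto
    qed
    then show False using z(2) by simp
  qed
  moreover have "S \<noteq> {}" using x0 by (auto simp: S_def)
  ultimately show ?thesis unfolding irreducible_space_def top by blast
qed

lemma quasi_affine_variety_S: "quasi_affine_variety N S"
proof -
  have "closedin (zariski N) (affine_space N)"
    using closedin_topspace[of "zariski N"] by (simp add: topspace_zariski)
  moreover have "S = S \<inter> affine_space N" by (auto simp: S_def)
  ultimately show ?thesis
    unfolding quasi_affine_variety_def using openin_zariski_S irreducible_space_S by blast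
qed

lemma regular_functionI:
  assumes "p \<in> poly_funs M" "q \<in> poly_funs M" "T \<subseteq> affine_space M" "\<And>x. x \<in> T \<Longrightarrow> q x \<noteq> 0 \<and> \<phi> x = p x / q x"
  shows "regular_function M T \<phi>"
proof -
  have "openin (subtopology (zariski M) T) T"
    using assms(3) openin_topspace[of "subtopology (zariski M) T"]
    by (simp add: topspace_zariski Int_absorb1)
  then show ?thesis unfolding regular_function_def using assms by blast
qed

text \<open>Rabinowitsch: \<open>S\<close> is isomorphic to the hypersurface \<open>P x * t = 1\<close>.\<close>

lemma affine_variety_S: "affine_variety N S"
proof -
  let ?r = "\<lambda>y. P y * y N - 1"
  define Z where "Z = {y \<in> affine_space (Suc N). \<forall>p\<in>{?r}. p y = 0}"
  have P': "P \<in> poly_funs (Suc N)" using P by (rule poly_funs_Suc)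
  have "?r \<in> poly_funs (Suc N)"
    by (intro poly_funs_diff poly_funs.mult P' poly_funs.coord poly_funs.const) simp
  then have Z: "closedin (zariski (Suc N)) Z"
    unfolding closedin_zariski algebraic_set_def Z_def by (intro exI[of _ "{?r}"]) simp
  define F where "F x = x(N := 1 / P x)" for x
  define G where "G y i = (if i < N then y i else 0)" for y :: "nat \<Rightarrow> complex" and i
  have PF: "P (F x) = P x" for x
    by (rule poly_funs_cong[OF P]) (simp add: F_def)
  have PG: "P (G x) = P x" for x
    by (rule poly_funs_cong[OF P]) (simp add: G_def)
  have F: "F x \<in> Z" if "x \<in> S" for x
    using that PF[of x] by (auto simp: Z_def S_def affine_space_def F_def)
  have G: "G y \<in> S" if "y \<in> Z" for y
    using that PG[of y] by (auto simp: Z_def S_def affine_space_def) (auto simp: G_def)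
  have "regular_map N S (Suc N) Z F"
    unfolding regular_map_def
  proof (intro conjI allI impI)
    show "F ` S \<subseteq> Z" using F by blast
    fix j assume j: "j < Suc N"
    show "regular_function N S (\<lambda>x. F x j)"
    proof (cases "j = N")
      case True
      then show ?thesis
        by (intro regular_functionI[OF poly_funs.const[of 1] P]) (auto simp: S_def F_def)
    next
      case False
      then have "j < N" using j by simp
      then show ?thesis
        using False by (intro regular_functionI[OF poly_funs.coord[of j] poly_funs.const[of 1]]) (auto simp: S_def F_def)
    qed
  qed
  moreover have "regular_map (Suc N) Z N S G"
    unfolding regular_map_def
  proof (intro conjI allI impI)
    show "G ` Z \<subseteq> S" using G by blast
    fix j assume j: "j < N"
    show "regular_function (Suc N) Z (\<lambda>x. G x j)"
      using j by (intro regular_functionI[OF poly_funs.coord[of j] poly_funs.const[of 1]]) (auto simp: Z_def G_def)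
  qed
  moreover have "\<forall>x\<in>S. G (F x) = x"
    by (auto simp: S_def G_def F_def affine_space_def fun_eq_iff)
  moreover have "F (G y) = y" if "y \<in> Z" for y
  proof
    fix i
    have "P y * y N = 1" using that by (simp add: Z_def)
    then have "1 / P y = y N" by (metis divide_eq_eq mult.commute mult_zero_right zero_neq_one)
    moreover have "y i = 0" if "i > N" using \<open>y \<in> Z\<close> that by (simp add: Z_def affine_space_def)
    ultimately show "F (G y) i = y i"
      unfolding F_def PG by (auto simp: G_def)
  qed
  ultimately show ?thesis
    unfolding affine_variety_def isomorphic_varieties_def using quasi_affine_variety_S Z by blast
qed

text \<open>The coordinate functions are independent because a polynomial vanishing on S vanishes
  everywhere; \<open>algebraically_dependent\<close> excludes any larger family.\<close>

lemma variety_dim_S: "variety_dim N S = N"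
  unfolding variety_dim_def
proof (rule Greatest_equality)
  show "\<exists>p. algebraically_independent_on N S N p"
  proof (rule exI[of _ "\<lambda>i x. x i"])
    show "algebraically_independent_on N S N (\<lambda>i x. x i)"
      unfolding algebraically_independent_on_def
    proof (intro conjI allI impI ballI)
      show "(\<lambda>x. x i) \<in> poly_funs N" if "i < N" for i using that by (rule poly_funs.coord)
      fix F y
      assume F: "F \<in> poly_funs N" "\<forall>x\<in>S. F (\<lambda>i. if i < N then x i else 0) = 0" and y: "y \<in> affine_space N"
      have "(\<lambda>i. if i < N then x i else 0) = x" if "x \<in> S" for x
        using that by (auto simp: S_def affine_space_def)
      then show "F y = 0" using vanish_on_S[OF F(1) _ y] F(2) by simp
    qed
  qed
  fix d assume "\<exists>p. algebraically_independent_on N S d p"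
  then obtain p where p: "algebraically_independent_on N S d p" by blast
  show "d \<le> N"
  proof (rule ccontr)
    assume "\<not> d \<le> N"
    then have "N < d" by simp
    have "\<exists>F\<in>poly_funs d. (\<forall>x. F (\<lambda>i. if i < d then p i x else 0) = 0) \<and> (\<exists>y\<in>affine_space d. F y \<noteq> 0)"
    proof (rule algebraically_dependent[OF _ \<open>N < d\<close>])
      show "p i \<in> poly_funs N" if "i < d" for i
        using p that unfolding algebraically_independent_on_def by blast
    qed
    then obtain F y where F: "F \<in> poly_funs d" "\<forall>x. F (\<lambda>i. if i < d then p i x else 0) = 0"
      and y: "y \<in> affine_space d" "F y \<noteq> 0"
      by (elim bexE conjE)
    have "(\<forall>x\<in>S. F (\<lambda>i. if i < d then p i x else 0) = 0) \<longrightarrow> (\<forall>y\<in>affine_space d. F y = 0)"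
      using p F(1) unfolding algebraically_independent_on_def by (elim conjE) (erule bspec)
    then have "\<forall>y\<in>affine_space d. F y = 0" by (rule mp) (intro ballI spec[OF F(2)])
    then have "F y = 0" using y(1) by (rule bspec)
    then show False using y(2) by contradiction
  qed
qed

text \<open>A polynomial vanishing on S vanishes on the whole affine space, hence along every line
  through x, and imposes no condition on directions.\<close>

lemma tangent_space_S:
  assumes "x \<in> S"
  shows "tangent_space N S x = affine_space N"
proof -
  have "deriv (\<lambda>t. p (\<lambda>i. x i + t * v i)) 0 = 0"
    if v: "v \<in> affine_space N" and p: "p \<in> poly_funs N" "\<forall>y\<in>S. p y = 0" for v p
  proof -
    have x: "x \<in> affine_space N" using assms by (simp add: S_def)
    have "p (\<lambda>i. x i + t * v i) = 0" for t
      by (rule vanish_on_S[OF p(1) _ affine_space_line[OF x v]]) (rule bspec[OF p(2)])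
    then show ?thesis by simp
  qed
  then show ?thesis unfolding tangent_space_def by blast
qed

lemma smooth_variety_S: "smooth_variety N S"
  unfolding smooth_variety_def
proof (intro conjI ballI)
  show "quasi_affine_variety N S" by (rule quasi_affine_variety_S)
  fix x assume "x \<in> S"
  then show "seq_space.dim (tangent_space N S x) = variety_dim N S"
    by (simp only: tangent_space_S dim_affine_space variety_dim_S)
qed

end

section \<open>A deformation of the orbit to a compact set\<close>

text \<open>Interpolation at (0, 0), (1, 0), (-1, 0), (0, 1), (0, -1) and (1, 1). As the
  coefficients of a composite are linear in its values, their continuity in parameters follows from
  continuity of the values.\<close>

definition quad_coeff :: "(complex \<Rightarrow> complex \<Rightarrow> complex) \<Rightarrow> nat \<Rightarrow> complex" where
  "quad_coeff g i =
    (if i = 0 then g 0 0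
     else if i = 1 then (g 1 0 - g (-1) 0) / 2
     else if i = 2 then (g 0 1 - g 0 (-1)) / 2
     else if i = 3 then (g 1 0 + g (-1) 0) / 2 - g 0 0
     else if i = 4 then g 1 1 - (g 1 0 - g (-1) 0) / 2 - (g 0 1 - g 0 (-1)) / 2
        - (g 1 0 + g (-1) 0) / 2 - (g 0 1 + g 0 (-1)) / 2 + g 0 0
     else (g 0 1 + g 0 (-1)) / 2 - g 0 0)"

definition coeffs_of :: "(complex^2 \<Rightarrow> complex^2) \<Rightarrow> nat \<Rightarrow> complex" where
  "coeffs_of f i = (if i < 6 then quad_coeff (\<lambda>x y. f (vector [x, y]) $ 1) i
     else if i < 12 then quad_coeff (\<lambda>x y. f (vector [x, y]) $ 2) (i - 6) else 0)"

lemma coeffs_of_in: "coeffs_of f \<in> affine_space 12"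
  by (simp add: affine_space_def coeffs_of_def)

lemma less_6_cases: "i < 6 \<Longrightarrow> i = 0 \<or> i = 1 \<or> i = 2 \<or> i = 3 \<or> i = 4 \<or> i = (5::nat)"
  by presburger

lemma coeffs_of_quad_map:
  assumes "c \<in> affine_space 12"
  shows "coeffs_of (quad_map c) = c"
proof
  fix i :: nat
  have q: "quad_coeff (\<lambda>x y. a 0 + a 1 * x + a 2 * y + a 3 * x^2 + a 4 * (x * y) + a 5 * y^2) j = a j"
    if "j < 6" for a :: "nat \<Rightarrow> complex" and j
    using less_6_cases[OF that] by (elim disjE) (simp_all add: quad_coeff_def field_simps)
  consider "i < 6" | "i \<ge> 6" "i < 12" | "i \<ge> 12" by linarith
  then show "coeffs_of (quad_map c) i = c i"
  proof cases
    case 1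
    then show ?thesis using q[of i c] by (simp add: coeffs_of_def quad_map_def)
  next
    case 2
    then have "i - 6 < 6" by linarith
    then show ?thesis using q[of "i - 6" "\<lambda>j. c (j + 6)"] 2 by (simp add: coeffs_of_def quad_map_def)
  next
    case 3
    then show ?thesis using assms by (simp add: coeffs_of_def affine_space_def)
  qed
qed

lemma quad_map_coeffs_of:
  assumes "f \<in> Omega 2 2"
  shows "quad_map (coeffs_of f) = f"
proof -
  obtain c where "c \<in> affine_space 12" "f = quad_map c"
    using bij_betw_quad_map assms by (metis bij_betw_imp_surj_on imageE)
  then show ?thesis by (simp add: coeffs_of_quad_map)
qed

lemma continuous_on_coeffs_of:
  assumes "\<And>z i. continuous_on S (\<lambda>s. f s z $ i)"
  shows "continuous_on S (\<lambda>s. coeffs_of (f s))"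
proof (rule continuous_on_coordinatewise_then_product)
  fix i
  have q: "continuous_on S (\<lambda>s. quad_coeff (\<lambda>x y. f s (vector [x, y]) $ k) j)" for k j
    unfolding quad_coeff_def
    by (cases "j = 0"; cases "j = 1"; cases "j = 2"; cases "j = 3"; cases "j = 4")
       (auto intro!: continuous_intros assms)
  show "continuous_on S (\<lambda>s. coeffs_of (f s) i)"
    unfolding coeffs_of_def using q by (cases "i < 6"; cases "i < 12") auto
qed

section \<open>Invariants of a map in the orbit of \<open>f1\<close>\<close>

lemma gradient_coeffs:
  assumes "quad_map c = aff p q r s u v \<circ> f1 \<circ> aff p' q' r' s' u' v'"
  shows "c 0 = p * (u'^2 + v') + q * (v'^2 + u') + u"
    "c 1 = p * (2 * p' * u' + r') + q * (2 * r' * v' + p')"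
    "c 2 = p * (2 * q' * u' + s') + q * (2 * s' * v' + q')"
    "c 3 = p * p'^2 + q * r'^2" "c 4 = 2 * (p * (p' * q') + q * (r' * s'))" "c 5 = p * q'^2 + q * s'^2"
    "c 6 = r * (u'^2 + v') + s * (v'^2 + u') + v"
    "c 7 = r * (2 * p' * u' + r') + s * (2 * r' * v' + p')"
    "c 8 = r * (2 * q' * u' + s') + s * (2 * s' * v' + q')"
    "c 9 = r * p'^2 + s * r'^2" "c 10 = 2 * (r * (p' * q') + s * (r' * s'))" "c 11 = r * q'^2 + s * s'^2"
proof -
  have expand: "p * ((p' * x + q' * y + u')^2 + (r' * x + s' * y + v')) + q * ((r' * x + s' * y + v')^2 + (p' * x + q' * y + u')) + u
    = (p * (u'^2 + v') + q * (v'^2 + u') + u) + (p * (2 * p' * u' + r') + q * (2 * r' * v' + p')) * x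
      + (p * (2 * q' * u' + s') + q * (2 * s' * v' + q')) * y + (p * p'^2 + q * r'^2) * x^2
      + 2 * (p * (p' * q') + q * (r' * s')) * (x * y) + (p * q'^2 + q * s'^2) * y^2" for x y p q u
    by (simp add: algebra_simps power2_eq_square)
  have "c 0 + c 1 * x + c 2 * y + c 3 * x^2 + c 4 * (x * y) + c 5 * y^2 =
     (p * (u'^2 + v') + q * (v'^2 + u') + u) + (p * (2 * p' * u' + r') + q * (2 * r' * v' + p')) * x
      + (p * (2 * q' * u' + s') + q * (2 * s' * v' + q')) * y + (p * p'^2 + q * r'^2) * x^2
      + 2 * (p * (p' * q') + q * (r' * s')) * (x * y) + (p * q'^2 + q * s'^2) * y^2" for x y
    using fun_cong[OF assms, of "vector [x, y]"] unfolding expand[symmetric]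
    by (simp add: vec2_eq_iff quad_map_def f1_def)
  from quadratic_coeffs_unique[OF this]
  show "c 0 = p * (u'^2 + v') + q * (v'^2 + u') + u"
    "c 1 = p * (2 * p' * u' + r') + q * (2 * r' * v' + p')"
    "c 2 = p * (2 * q' * u' + s') + q * (2 * s' * v' + q')"
    "c 3 = p * p'^2 + q * r'^2" "c 4 = 2 * (p * (p' * q') + q * (r' * s'))" "c 5 = p * q'^2 + q * s'^2"
    by simp_all
  have "c 6 + c 7 * x + c 8 * y + c 9 * x^2 + c 10 * (x * y) + c 11 * y^2 =
     (r * (u'^2 + v') + s * (v'^2 + u') + v) + (r * (2 * p' * u' + r') + s * (2 * r' * v' + p')) * x
      + (r * (2 * q' * u' + s') + s * (2 * s' * v' + q')) * y + (r * p'^2 + s * r'^2) * x^2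
      + 2 * (r * (p' * q') + s * (r' * s')) * (x * y) + (r * q'^2 + s * s'^2) * y^2" for x y
    using fun_cong[OF assms, of "vector [x, y]"] unfolding expand[symmetric]
    by (simp add: vec2_eq_iff quad_map_def f1_def)
  from quadratic_coeffs_unique[OF this]
  show "c 6 = r * (u'^2 + v') + s * (v'^2 + u') + v"
    "c 7 = r * (2 * p' * u' + r') + s * (2 * r' * v' + p')"
    "c 8 = r * (2 * q' * u' + s') + s * (2 * s' * v' + q')"
    "c 9 = r * p'^2 + s * r'^2" "c 10 = 2 * (r * (p' * q') + s * (r' * s'))" "c 11 = r * q'^2 + s * s'^2"
    by simp_all
qed

text \<open>With U, V the components of the right factor, the Jacobian is k (4 U V - 1); its
  coefficients are read off by comparison.\<close>

lemma jac_coeffs: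
  assumes "quad_map c = aff p q r s u v \<circ> f1 \<circ> aff p' q' r' s' u' v'"
  defines "k \<equiv> (p * s - q * r) * (p' * s' - q' * r')"
  shows "jac c x y = k * (4 * (p' * x + q' * y + u') * (r' * x + s' * y + v') - 1)"
    "jac0 c = k * (4 * u' * v' - 1)"
    "jacx c = 4 * k * (p' * v' + r' * u')" "jacy c = 4 * k * (q' * v' + s' * u')"
    "jacxx c = 4 * k * (p' * r')" "jacxy c = 4 * k * (p' * s' + q' * r')" "jacyy c = 4 * k * (q' * s')"
proof -
  have j: "jac c x y = k * (4 * (p' * x + q' * y + u') * (r' * x + s' * y + v') - 1)" for x y
    using jacobian_orbit[of p q r s u v f1_coeffs p' q' r' s' u' v' "vector [x, y]"]
    by (simp add: quad_map_f1_coeffs assms(1)[symmetric] jacobian_quad_map jac_f1_coeffs k_def)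
  show "jac c x y = k * (4 * (p' * x + q' * y + u') * (r' * x + s' * y + v') - 1)" by (rule j)
  have "jac0 c + jacx c * x + jacy c * y + jacxx c * x^2 + jacxy c * (x * y) + jacyy c * y^2
    = k * (4 * u' * v' - 1) + 4 * k * (p' * v' + r' * u') * x + 4 * k * (q' * v' + s' * u') * y
      + 4 * k * (p' * r') * x^2 + 4 * k * (p' * s' + q' * r') * (x * y) + 4 * k * (q' * s') * y^2" for x y
    using j[of x y] unfolding jac_qpoly qpoly_def by (simp add: algebra_simps power2_eq_square)
  from quadratic_coeffs_unique[OF this]
  show "jac0 c = k * (4 * u' * v' - 1)"
    "jacx c = 4 * k * (p' * v' + r' * u')" "jacy c = 4 * k * (q' * v' + s' * u')"
    "jacxx c = 4 * k * (p' * r')" "jacxy c = 4 * k * (p' * s' + q' * r')" "jacyy c = 4 * k * (q' * s')"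
    by blast+
qed

text \<open>Both invariants equal 16 for 4 x y - 1. The factor k enters with their degrees 2 and 3
  in the coefficients, and the substitution contributes the square of its determinant.\<close>

lemma jac_disc_orbit:
  assumes "quad_map c = aff p q r s u v \<circ> f1 \<circ> aff p' q' r' s' u' v'"
  shows "jac_disc c = 16 * (p * s - q * r)^2 * (p' * s' - q' * r')^4"
    and "jac_det c = 16 * (p * s - q * r)^3 * (p' * s' - q' * r')^5"
proof -
  define k where "k = (p * s - q * r) * (p' * s' - q' * r')"
  note j = jac_coeffs(2-7)[OF assms, folded k_def]
  have "jac_disc c = 16 * k^2 * (p' * s' - q' * r')^2"
    unfolding jac_disc_def conic_disc_def j by (simp add: algebra_simps power2_eq_square)
  then show "jac_disc c = 16 * (p * s - q * r)^2 * (p' * s' - q' * r')^4"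
    by (simp add: k_def power_mult_distrib eval_nat_numeral)
  have "jac_det c = 16 * k^3 * (p' * s' - q' * r')^2"
    unfolding jac_det_def conic_det_def j by (simp add: algebra_simps eval_nat_numeral)
  then show "jac_det c = 16 * (p * s - q * r)^3 * (p' * s' - q' * r')^5"
    by (simp add: k_def power_mult_distrib eval_nat_numeral)
qed

text \<open>The centre of the critical hyperbola, by the Cramer formula for the critical point of
  the Jacobian. It is a rational function of the coefficients and the point that R sends to the
  origin.\<close>

definition center_x where
  "center_x c = (2 * jacx c * jacyy c - jacy c * jacxy c) / jac_disc c"
definition center_y where
  "center_y c = (2 * jacy c * jacxx c - jacx c * jacxy c) / jac_disc c"
definition center_jac where
  "center_jac c = jac c (center_x c) (center_y c)"
definition dgx where
  "dgx c = c 1 + 2 * c 3 * center_x c + c 4 * center_y c"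
definition dgy where
  "dgy c = c 2 + c 4 * center_x c + 2 * c 5 * center_y c"
definition dhx where
  "dhx c = c 7 + 2 * c 9 * center_x c + c 10 * center_y c"
definition dhy where
  "dhy c = c 8 + c 10 * center_x c + 2 * c 11 * center_y c"

lemma center_jac_eq: "center_jac c = dgx c * dhy c - dgy c * dhx c"
  by (simp add: center_jac_def jac_def dgx_def dgy_def dhx_def dhy_def)

text \<open>If \<open>f = L \<circ> f1 \<circ> R\<close> and \<open>u\<close>, \<open>v\<close> are the components of the linear part of \<open>R\<close>, then
  \<open>asymptotes c\<close> is \<open>u v\<close> and \<open>cubic_square c\<close> is \<open>(u\<^sup>3 - v\<^sup>3)\<^sup>2\<close>. The pair \<open>(u, v)\<close> itself is determined
  by \<open>f\<close> only up to the symmetries of \<open>f1\<close>, but \<open>|u|\<^sup>2 + |v|\<^sup>2\<close> is a continuous function of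
  these two quantities.\<close>

definition asymptotes :: "(nat \<Rightarrow> complex) \<Rightarrow> complex \<Rightarrow> complex \<Rightarrow> complex" where
  "asymptotes c x y = - (jacxx c * x^2 + jacxy c * (x * y) + jacyy c * y^2) / (4 * center_jac c)"

text \<open>The determinant of the derivative at the centre, applied to (x, y), against the
  quadratic part of the map. For \<open>L \<circ> f1 \<circ> R\<close> it is det L (V^3 - U^3), with
  U, V the linear forms of R.\<close>

definition cubic :: "(nat \<Rightarrow> complex) \<Rightarrow> complex \<Rightarrow> complex \<Rightarrow> complex" where
  "cubic c x y = (dgx c * x + dgy c * y) * (c 9 * x^2 + c 10 * (x * y) + c 11 * y^2)
     - (dhx c * x + dhy c * y) * (c 3 * x^2 + c 4 * (x * y) + c 5 * y^2)"
text \<open>Dividing \<open>cubic\<close> by \<open>center_jac\<close> leaves (U^3 - V^3) / det R,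
  and the last factor is (det R)^2. The square is taken because swapping the coordinates changes the
  sign of det R, so that only its square is a function of the map.\<close>

definition cubic_square :: "(nat \<Rightarrow> complex) \<Rightarrow> complex \<Rightarrow> complex \<Rightarrow> complex" where
  "cubic_square c x y = (cubic c x y / center_jac c)^2 * (jac_disc c / (16 * (center_jac c)^2))"
text \<open>Let S = (u^3 - v^3)^2, m = u v, a = |u|^2 and b = |v|^2. By the parallelogram law (|S| +
  |S + 4 m^3|) / 4 is half of a^3 + b^3, and |m|^6 is a^3 b^3. So the two radicands are the roots
  a^3, b^3 of a quadratic equation.\<close>

definition norm_sum :: "complex \<Rightarrow> complex \<Rightarrow> real" where
  "norm_sum S m = root 3 ((norm S + norm (S + 4 * m^3)) / 4 + sqrt (((norm S + norm (S + 4 * m^3)) / 4)^2 - norm m ^ 6))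
     + root 3 ((norm S + norm (S + 4 * m^3)) / 4 - sqrt (((norm S + norm (S + 4 * m^3)) / 4)^2 - norm m ^ 6))"
definition hermitian :: "(nat \<Rightarrow> complex) \<Rightarrow> complex \<Rightarrow> complex \<Rightarrow> real" where
  "hermitian c x y = norm_sum (cubic_square c x y) (asymptotes c x y)"

lemma parallelogram: "norm (x - y)^2 + norm (x + y)^2 = 2 * (norm x^2 + norm y^2)" for x y :: complex
  unfolding cmod_power2 by (simp add: algebra_simps power2_eq_square)

lemma norm_sum_eq: "norm_sum ((u^3 - v^3)^2) (u * v) = norm u ^ 2 + norm v ^ 2"
proof -
  define a where "a = norm u ^ 2"
  define b where "b = norm v ^ 2"
  have ab: "a \<ge> 0" "b \<ge> 0" by (simp_all add: a_def b_def)
  have "(u^3 - v^3)^2 + 4 * (u * v)^3 = (u^3 + v^3)^2"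
    by (simp add: algebra_simps power2_eq_square power_mult_distrib)
  then have "norm ((u^3 - v^3)^2) + norm ((u^3 - v^3)^2 + 4 * (u * v)^3) = 2 * (norm (u^3)^2 + norm (v^3)^2)"
    using parallelogram[of "u^3" "v^3"] by (simp add: norm_power)
  also have "norm (u^3)^2 = a^3"
    by (simp add: a_def norm_power power_mult[symmetric])
  also have "norm (v^3)^2 = b^3"
    by (simp add: b_def norm_power power_mult[symmetric])
  finally have A: "(norm ((u^3 - v^3)^2) + norm ((u^3 - v^3)^2 + 4 * (u * v)^3)) / 4 = (a^3 + b^3) / 2"
    by simp
  have "norm (u * v) ^ 6 = a^3 * b^3"
    by (simp add: a_def b_def norm_mult power_mult_distrib power_mult[symmetric])
  then have "((a^3 + b^3) / 2)^2 - norm (u * v) ^ 6 = ((a^3 - b^3) / 2)^2"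
    by (simp add: power2_eq_square field_simps)
  then have sq: "sqrt (((a^3 + b^3) / 2)^2 - norm (u * v) ^ 6) = \<bar>(a^3 - b^3) / 2\<bar>" by simp
  have r: "root 3 (a^3) = a" "root 3 (b^3) = b" using ab by (simp_all add: real_root_power_cancel)
  have "norm_sum ((u^3 - v^3)^2) (u * v) = root 3 ((a^3 + b^3) / 2 + \<bar>(a^3 - b^3) / 2\<bar>) + root 3 ((a^3 + b^3) / 2 - \<bar>(a^3 - b^3) / 2\<bar>)"
    unfolding norm_sum_def A sq ..
  also have "\<dots> = a + b"
  proof (cases "a^3 \<ge> b^3")
    case True
    then have "(a^3 + b^3) / 2 + \<bar>(a^3 - b^3) / 2\<bar> = a^3" "(a^3 + b^3) / 2 - \<bar>(a^3 - b^3) / 2\<bar> = b^3" by (simp_all add: field_simps)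
    then show ?thesis using r by simp
  next
    case False
    then have "(a^3 + b^3) / 2 + \<bar>(a^3 - b^3) / 2\<bar> = b^3" "(a^3 + b^3) / 2 - \<bar>(a^3 - b^3) / 2\<bar> = a^3" by (simp_all add: field_simps)
    then show ?thesis using r by simp
  qed
  finally show ?thesis by (simp add: a_def b_def)
qed

text \<open>R sends the centre to the origin, where the derivative of \<open>f1\<close> is the swap
  of coordinates. The derivative of the map at the centre is therefore the product of the linear
  part of L, the swap and the linear part of R.\<close>

lemma center_orbit:
  assumes c: "quad_map c = aff p q r s u v \<circ> f1 \<circ> aff p' q' r' s' u' v'"
    and n: "p * s - q * r \<noteq> 0" "p' * s' - q' * r' \<noteq> 0"
  shows "p' * center_x c + q' * center_y c + u' = 0" "r' * center_x c + s' * center_y c + v' = 0"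
    "center_jac c = - ((p * s - q * r) * (p' * s' - q' * r'))"
    "dgx c = p * r' + q * p'" "dgy c = p * s' + q * q'" "dhx c = r * r' + s * p'" "dhy c = r * s' + s * q'"
proof -
  define k where "k = (p * s - q * r) * (p' * s' - q' * r')"
  define d where "d = p' * s' - q' * r'"
  have k: "k \<noteq> 0" and d: "d \<noteq> 0" using n by (auto simp: k_def d_def)
  note j = jac_coeffs(2-7)[OF c, folded k_def]
  have disc: "jac_disc c = 16 * k^2 * d^2"
    unfolding jac_disc_def conic_disc_def j by (simp add: d_def algebra_simps power2_eq_square)
  have nd: "jac_disc c \<noteq> 0" using disc k d by simp
  have x: "jac_disc c * center_x c = 2 * jacx c * jacyy c - jacy c * jacxy c"
    and y: "jac_disc c * center_y c = 2 * jacy c * jacxx c - jacx c * jacxy c"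
    using nd by (simp_all add: center_x_def center_y_def)
  have "jac_disc c * (p' * center_x c + q' * center_y c + u')
      = p' * (jac_disc c * center_x c) + q' * (jac_disc c * center_y c) + jac_disc c * u'"
    by (simp add: algebra_simps)
  also have "\<dots> = 0"
    unfolding x y unfolding disc unfolding j d_def by (simp add: algebra_simps power2_eq_square)
  finally show U: "p' * center_x c + q' * center_y c + u' = 0" using nd by simp
  have "jac_disc c * (r' * center_x c + s' * center_y c + v')
      = r' * (jac_disc c * center_x c) + s' * (jac_disc c * center_y c) + jac_disc c * v'"
    by (simp add: algebra_simps)
  also have "\<dots> = 0"
    unfolding x y unfolding disc unfolding j d_def by (simp add: algebra_simps power2_eq_square)
  finally show V: "r' * center_x c + s' * center_y c + v' = 0" using nd by simp
  show "center_jac c = - ((p * s - q * r) * (p' * s' - q' * r'))"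
    unfolding center_jac_def jac_coeffs(1)[OF c] U V by simp
  note g = gradient_coeffs[OF c]
  have "dgx c = p * (2 * p' * (p' * center_x c + q' * center_y c + u') + r') + q * (2 * r' * (r' * center_x c + s' * center_y c + v') + p')"
    "dgy c = p * (2 * q' * (p' * center_x c + q' * center_y c + u') + s') + q * (2 * s' * (r' * center_x c + s' * center_y c + v') + q')"
    "dhx c = r * (2 * p' * (p' * center_x c + q' * center_y c + u') + r') + s * (2 * r' * (r' * center_x c + s' * center_y c + v') + p')"
    "dhy c = r * (2 * q' * (p' * center_x c + q' * center_y c + u') + s') + s * (2 * s' * (r' * center_x c + s' * center_y c + v') + q')"
    unfolding dgx_def dgy_def dhx_def dhy_def g by (simp_all add: algebra_simps power2_eq_square)
  then show "dgx c = p * r' + q * p'" "dgy c = p * s' + q * q'" "dhx c = r * r' + s * p'" "dhy c = r * s' + s * q'"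
    unfolding U V by simp_all
qed

lemma hermitian_orbit:
  assumes c: "quad_map c = aff p q r s u v \<circ> f1 \<circ> aff p' q' r' s' u' v'"
    and n: "p * s - q * r \<noteq> 0" "p' * s' - q' * r' \<noteq> 0"
  shows "hermitian c x y = norm (p' * x + q' * y)^2 + norm (r' * x + s' * y)^2"
proof -
  define l where "l = p * s - q * r"
  define d where "d = p' * s' - q' * r'"
  have l: "l \<noteq> 0" and d: "d \<noteq> 0" using n by (auto simp: l_def d_def)
  define U where "U = p' * x + q' * y"
  define V where "V = r' * x + s' * y"
  note j = jac_coeffs(2-7)[OF c, folded l_def d_def]
  note z = center_orbit(3-7)[OF c n, folded l_def d_def]
  have "jacxx c * x^2 + jacxy c * (x * y) + jacyy c * y^2 = 4 * (l * d) * (U * V)"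
    unfolding j U_def V_def by (simp add: algebra_simps power2_eq_square)
  then have m: "asymptotes c x y = U * V"
    unfolding asymptotes_def z using l d by simp
  have "dgx c * x + dgy c * y = p * V + q * U" "dhx c * x + dhy c * y = r * V + s * U"
    unfolding z U_def V_def by (simp_all add: algebra_simps)
  moreover have "c 3 * x^2 + c 4 * (x * y) + c 5 * y^2 = p * U^2 + q * V^2"
    "c 9 * x^2 + c 10 * (x * y) + c 11 * y^2 = r * U^2 + s * V^2"
    unfolding gradient_coeffs[OF c] U_def V_def by (simp_all add: algebra_simps power2_eq_square)
  ultimately have "cubic c x y = (p * V + q * U) * (r * U^2 + s * V^2) - (r * V + s * U) * (p * U^2 + q * V^2)"
    unfolding cubic_def by simp
  also have "\<dots> = l * (V^3 - U^3)"
    by (simp add: l_def algebra_simps eval_nat_numeral)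
  finally have "cubic_square c x y = (l * (V^3 - U^3) / - (l * d))^2 * (16 * l^2 * d^4 / (16 * (- (l * d))^2))"
    unfolding cubic_square_def z jac_disc_orbit(1)[OF c, folded l_def d_def] by simp
  also have "\<dots> = (U^3 - V^3)^2"
  proof -
    have "l * (V^3 - U^3) / - (l * d) = (U^3 - V^3) / d"
      using l by (simp add: minus_divide_left[symmetric] diff_divide_distrib)
    moreover have "16 * l^2 * d^4 / (16 * (- (l * d))^2) = d^2"
      using l d by (simp add: power_mult_distrib eval_nat_numeral)
    ultimately show ?thesis using d by (simp add: power_divide)
  qed
  finally have S: "cubic_square c x y = (U^3 - V^3)^2" .
  show ?thesis
    unfolding hermitian_def m S norm_sum_eq by (simp add: U_def V_def)
qed

text \<open>Entries of the upper triangular matrix (\<open>gs1\<close>, \<open>gs2\<close>; 0,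
  \<open>gs3\<close>) that orthonormalizes two columns with squared norms a and d and inner product
  b. They depend on the Gram matrix only.\<close>

definition gs1 :: "real \<Rightarrow> complex" where "gs1 a = of_real (1 / sqrt a)"
definition gs2 :: "real \<Rightarrow> real \<Rightarrow> complex \<Rightarrow> complex" where
  "gs2 a d b = - b / of_real (a * sqrt (d - norm b ^ 2 / a))"
definition gs3 :: "real \<Rightarrow> real \<Rightarrow> complex \<Rightarrow> complex" where
  "gs3 a d b = of_real (1 / sqrt (d - norm b ^ 2 / a))"

text \<open>By Lagrange's identity the Gram determinant a d - |b|^2 is |p s - q r|^2, so both
  radicands are positive. Bounds on the entries and the modulus of the determinant are all that the
  compactness argument takes from unitarity.\<close>

lemma gram_schmidt:
  fixes p q r s b :: complex and a d :: real
  assumes n: "p * s - q * r \<noteq> 0"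
    and a: "a = norm p ^ 2 + norm r ^ 2" and d: "d = norm q ^ 2 + norm s ^ 2" and b: "b = cnj p * q + cnj r * s"
  shows "a > 0" "d - norm b ^ 2 / a > 0"
    "norm (p * gs1 a) \<le> 1" "norm (r * gs1 a) \<le> 1"
    "norm (p * gs2 a d b + q * gs3 a d b) \<le> 1" "norm (r * gs2 a d b + s * gs3 a d b) \<le> 1"
    "norm (p * gs1 a * (r * gs2 a d b + s * gs3 a d b) - (p * gs2 a d b + q * gs3 a d b) * (r * gs1 a)) = 1"
proof -
  define D where "D = p * s - q * r"
  have D: "norm D > 0" using n by (simp add: D_def)
  have "p \<noteq> 0 \<or> r \<noteq> 0" using n by auto
  then show a0: "a > 0" unfolding a by (auto intro: add_pos_nonneg add_nonneg_pos)
  have ac: "of_real a = p * cnj p + r * cnj r" and dc: "of_real d = q * cnj q + s * cnj s"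
    unfolding a d by (simp_all add: complex_norm_square del: of_real_power)
  have "of_real (a * d - norm b ^ 2) = (of_real (norm D ^ 2) :: complex)"
    unfolding of_real_diff of_real_mult ac dc complex_norm_square b D_def
    by (simp add: algebra_simps)
  then have "a * d - norm b ^ 2 = norm D ^ 2" by (simp only: of_real_eq_iff)
  then have \<sigma>2: "d - norm b ^ 2 / a = norm D ^ 2 / a" using a0 by (simp add: field_simps)
  then show "d - norm b ^ 2 / a > 0" using a0 D by simp
  define \<sigma> where "\<sigma> = sqrt (d - norm b ^ 2 / a)"
  have \<sigma>: "\<sigma> = norm D / sqrt a" unfolding \<sigma>_def \<sigma>2 by (simp add: real_sqrt_divide)
  have \<sigma>0: "\<sigma> > 0" using a0 D by (simp add: \<sigma>)
  have a\<sigma>: "a * \<sigma> = sqrt a * norm D" 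
  proof -
    have "a * \<sigma> = (a / sqrt a) * norm D" by (simp add: \<sigma>)
    then show ?thesis using a0 by (simp add: real_div_sqrt)
  qed
  have pa: "norm p \<le> sqrt a" "norm r \<le> sqrt a"
    unfolding a by (auto intro!: real_le_rsqrt)
  then show "norm (p * gs1 a) \<le> 1" "norm (r * gs1 a) \<le> 1"
    using a0 by (simp_all add: gs1_def norm_mult norm_divide)
  \<comment> \<open>The second column becomes a multiple of (- cnj r, cnj p), the vector orthogonal
    to (p, r).\<close>
  have e1: "p * gs2 a d b + q * gs3 a d b = - (cnj r * D) / of_real (a * \<sigma>)"
  proof -
    have "p * gs2 a d b + q * gs3 a d b = (of_real a * q - p * b) / of_real (a * \<sigma>)"
      using a0 unfolding gs2_def gs3_def \<sigma>_def[symmetric] by (simp add: diff_divide_distrib)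
    also have "of_real a * q - p * b = - (cnj r * D)"
      unfolding ac b D_def by (simp add: algebra_simps)
    finally show ?thesis .
  qed
  have e2: "r * gs2 a d b + s * gs3 a d b = cnj p * D / of_real (a * \<sigma>)"
  proof -
    have "r * gs2 a d b + s * gs3 a d b = (of_real a * s - r * b) / of_real (a * \<sigma>)"
      using a0 unfolding gs2_def gs3_def \<sigma>_def[symmetric] by (simp add: diff_divide_distrib)
    also have "of_real a * s - r * b = cnj p * D"
      unfolding ac b D_def by (simp add: algebra_simps)
    finally show ?thesis .
  qed
  have pos: "sqrt a * norm D > 0" using a0 D by simp
  show "norm (p * gs2 a d b + q * gs3 a d b) \<le> 1" "norm (r * gs2 a d b + s * gs3 a d b) \<le> 1"
    unfolding e1 e2 a\<sigma> using pos pa D a0 by (simp_all add: norm_divide norm_mult)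
  have "p * gs1 a * (r * gs2 a d b + s * gs3 a d b) - (p * gs2 a d b + q * gs3 a d b) * (r * gs1 a)
     = (p * cnj p + r * cnj r) * D / of_real (a * \<sigma>) * gs1 a"
    unfolding e1 e2 by (simp add: algebra_simps add_divide_distrib)
  also have "norm \<dots> = a * norm D / (a * \<sigma>) / sqrt a"
    using a0 \<sigma>0 unfolding ac[symmetric] by (simp add: norm_mult norm_divide gs1_def)
  also have "\<dots> = 1"
    using a0 D by (simp add: \<sigma>)
  finally show "norm (p * gs1 a * (r * gs2 a d b + s * gs3 a d b) - (p * gs2 a d b + q * gs3 a d b) * (r * gs1 a)) = 1" .
qed

section \<open>The deformation by Gram-Schmidt\<close>

definition f1_orbit_coeffs :: "(nat \<Rightarrow> complex) set" where
  "f1_orbit_coeffs = {c \<in> affine_space 12. jac_disc c * jac_det c \<noteq> 0}"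

lemma f1_orbit_coeffs_iff: "c \<in> f1_orbit_coeffs \<longleftrightarrow> c \<in> affine_space 12 \<and> quad_map c \<in> orbit f1"
  using coeff_set_orbit_f1 unfolding f1_orbit_coeffs_def coeff_set_def by blast

lemma f1_orbit_coeffsE:
  assumes "c \<in> f1_orbit_coeffs"
  obtains p q r s u v p' q' r' s' u' v' where
    "quad_map c = aff p q r s u v \<circ> f1 \<circ> aff p' q' r' s' u' v'" "p * s - q * r \<noteq> 0" "p' * s' - q' * r' \<noteq> 0"
proof -
  obtain L R where LR: "quad_map c = L \<circ> f1 \<circ> R" "L \<in> GA2" "R \<in> GA2"
    using assms unfolding f1_orbit_coeffs_iff orbit_def by blast
  obtain p q r s u v where L: "p * s - q * r \<noteq> 0" "L = aff p q r s u v"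
    using LR(2) unfolding GA2_iff by blast
  obtain p' q' r' s' u' v' where R: "p' * s' - q' * r' \<noteq> 0" "R = aff p' q' r' s' u' v'"
    using LR(3) unfolding GA2_iff by blast
  show thesis using that[OF _ L(1) R(1)] LR(1) L(2) R(2) by blast
qed

lemma continuous_on_Complex_fun:
  assumes "continuous_on S f" "continuous_on S g"
  shows "continuous_on S (\<lambda>x. Complex (f x) (g x))"
  unfolding Complex_eq using assms by (intro continuous_intros)

definition col1 where "col1 c = hermitian c 1 0"
definition col2 where "col2 c = hermitian c 0 1"
text \<open>Polarization of \<open>hermitian\<close>: the value at (1, 1) contains twice the real
  part of the inner product of the columns of R, the value at (1, \<i>) minus twice its imaginary
  part.\<close>

definition col12 where
  "col12 c = Complex ((hermitian c 1 1 - col1 c - col2 c) / 2) (- (hermitian c 1 \<i> - col1 c - col2 c) / 2)"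
definition rn1 where "rn1 c = gs1 (col1 c)"
definition rn2 where "rn2 c = gs2 (col1 c) (col2 c) (col12 c)"
definition rn3 where "rn3 c = gs3 (col1 c) (col2 c) (col12 c)"
text \<open>The derivative at the centre after R has been normalized. Its rows are those of L times
  the swap and an essentially unitary matrix, so the left normalizer is found by Gram-Schmidt on
  rows and is lower triangular.\<close>

definition lin1 where "lin1 c = dgx c * rn1 c"
definition lin2 where "lin2 c = dgx c * rn2 c + dgy c * rn3 c"
definition lin3 where "lin3 c = dhx c * rn1 c"
definition lin4 where "lin4 c = dhx c * rn2 c + dhy c * rn3 c"
definition row1 where "row1 c = norm (lin1 c) ^ 2 + norm (lin2 c) ^ 2"
definition row2 where "row2 c = norm (lin3 c) ^ 2 + norm (lin4 c) ^ 2"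
definition row12 where "row12 c = cnj (lin1 c) * lin3 c + cnj (lin2 c) * lin4 c"
definition ln1 where "ln1 c = gs1 (row1 c)"
definition ln2 where "ln2 c = gs2 (row1 c) (row2 c) (row12 c)"
definition ln3 where "ln3 c = gs3 (row1 c) (row2 c) (row12 c)"
text \<open>Since R sends the centre to 0 and \<open>f1\<close> fixes 0, the value at the centre is
  the translation part of L, which \<open>left_map\<close> removes at t = 1.\<close>

definition val1 where "val1 c = quad_map c (vector [center_x c, center_y c]) $ 1"
definition val2 where "val2 c = quad_map c (vector [center_x c, center_y c]) $ 2"

definition left_map :: "real \<Rightarrow> (nat \<Rightarrow> complex) \<Rightarrow> complex^2 \<Rightarrow> complex^2" where
  "left_map t c = aff (1 - t + t * ln1 c) 0 (t * ln2 c) (1 - t + t * ln3 c)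
     (- (t * ((1 - t + t * ln1 c) * val1 c))) (- (t * (t * ln2 c * val1 c + (1 - t + t * ln3 c) * val2 c)))"
definition right_map :: "real \<Rightarrow> (nat \<Rightarrow> complex) \<Rightarrow> complex^2 \<Rightarrow> complex^2" where
  "right_map t c = aff (1 - t + t * rn1 c) (t * rn2 c) 0 (1 - t + t * rn3 c) (t * center_x c) (t * center_y c)"

text \<open>A linear homotopy of triangular matrices with positive diagonal, ending at the Gram-Schmidt
  normalization of both sides of \<open>f = L \<circ> f1 \<circ> R\<close>.\<close>

definition deform :: "real \<times> (nat \<Rightarrow> complex) \<Rightarrow> nat \<Rightarrow> complex" where
  "deform = (\<lambda>(t, c). coeffs_of (left_map t c \<circ> quad_map c \<circ> right_map t c))"

lemma col_orbit:
  assumes c: "quad_map c = aff p q r s u v \<circ> f1 \<circ> aff p' q' r' s' u' v'"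
    and n: "p * s - q * r \<noteq> 0" "p' * s' - q' * r' \<noteq> 0"
  shows "col1 c = norm p' ^ 2 + norm r' ^ 2" "col2 c = norm q' ^ 2 + norm s' ^ 2"
    "col12 c = cnj p' * q' + cnj r' * s'"
proof -
  note h = hermitian_orbit[OF c n]
  show 12: "col1 c = norm p' ^ 2 + norm r' ^ 2" "col2 c = norm q' ^ 2 + norm s' ^ 2"
    unfolding col1_def col2_def h by simp_all
  show "col12 c = cnj p' * q' + cnj r' * s'"
    unfolding col12_def 12 h cmod_power2
    by (simp add: complex_eq_iff field_simps power2_eq_square)
qed

lemma lin_orbit:
  assumes c: "quad_map c = aff p q r s u v \<circ> f1 \<circ> aff p' q' r' s' u' v'"
    and n: "p * s - q * r \<noteq> 0" "p' * s' - q' * r' \<noteq> 0"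
  shows "lin1 c = p * (r' * rn1 c) + q * (p' * rn1 c)"
    "lin2 c = p * (r' * rn2 c + s' * rn3 c) + q * (p' * rn2 c + q' * rn3 c)"
    "lin3 c = r * (r' * rn1 c) + s * (p' * rn1 c)"
    "lin4 c = r * (r' * rn2 c + s' * rn3 c) + s * (p' * rn2 c + q' * rn3 c)"
  unfolding lin1_def lin2_def lin3_def lin4_def center_orbit[OF c n] by (simp_all add: algebra_simps)

lemma normalizers:
  assumes "c \<in> f1_orbit_coeffs"
  shows "col1 c > 0" "col2 c - norm (col12 c) ^ 2 / col1 c > 0" "row1 c > 0" "row2 c - norm (row12 c) ^ 2 / row1 c > 0"
    "center_jac c \<noteq> 0" "jac_disc c \<noteq> 0"
proof -
  obtain p q r s u v p' q' r' s' u' v' where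
    c: "quad_map c = aff p q r s u v \<circ> f1 \<circ> aff p' q' r' s' u' v'"
    and n: "p * s - q * r \<noteq> 0" "p' * s' - q' * r' \<noteq> 0"
    using assms by (rule f1_orbit_coeffsE)
  show "center_jac c \<noteq> 0" unfolding center_orbit(3)[OF c n] using n by simp
  then have cj: "dgx c * dhy c - dgy c * dhx c \<noteq> 0" by (simp add: center_jac_eq)
  show "jac_disc c \<noteq> 0" using assms by (simp add: f1_orbit_coeffs_def)
  note g = gram_schmidt(1,2)[OF n(2) col_orbit[OF c n]]
  show pos: "col1 c > 0" "col2 c - norm (col12 c) ^ 2 / col1 c > 0" by (rule g)+
  have rn: "rn1 c \<noteq> 0" "rn3 c \<noteq> 0"
    using pos unfolding rn1_def rn3_def gs1_def gs3_def by simp_all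
  have "lin1 c * lin4 c - lin3 c * lin2 c = (dgx c * dhy c - dgy c * dhx c) * (rn1 c * rn3 c)"
    unfolding lin1_def lin2_def lin3_def lin4_def by (simp add: algebra_simps)
  then have "lin1 c * lin4 c - lin3 c * lin2 c \<noteq> 0" using rn cj by simp
  from gram_schmidt(1,2)[OF this row1_def row2_def row12_def]
  show "row1 c > 0" "row2 c - norm (row12 c) ^ 2 / row1 c > 0" .
qed

lemma continuous_jac:
  fixes X :: "(nat \<Rightarrow> complex) set"
  shows "continuous_on X jac0" "continuous_on X jacx" "continuous_on X jacy"
    "continuous_on X jacxx" "continuous_on X jacxy" "continuous_on X jacyy"
proof -
  have c: "continuous_on X (\<lambda>c. c i)" for i
    by (rule continuous_on_subset[OF continuous_on_product_coordinates]) simp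
  show "continuous_on X jac0" "continuous_on X jacx" "continuous_on X jacy"
    "continuous_on X jacxx" "continuous_on X jacxy" "continuous_on X jacyy"
    unfolding jac0_def jacx_def jacy_def jacxx_def jacxy_def jacyy_def
    by (intro continuous_intros c)+
qed

lemma continuous_jac_disc: "continuous_on X jac_disc"
  and continuous_jac_det: "continuous_on X jac_det"
  unfolding jac_disc_def jac_det_def conic_disc_def conic_det_def
  by (intro continuous_intros continuous_jac)+

lemma continuous_normalizers:
  "continuous_on f1_orbit_coeffs center_x" "continuous_on f1_orbit_coeffs center_y"
  "continuous_on f1_orbit_coeffs rn1" "continuous_on f1_orbit_coeffs rn2" "continuous_on f1_orbit_coeffs rn3"
  "continuous_on f1_orbit_coeffs ln1" "continuous_on f1_orbit_coeffs ln2" "continuous_on f1_orbit_coeffs ln3"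
proof -
  let ?X = f1_orbit_coeffs
  have c: "continuous_on ?X (\<lambda>c. c i)" for i
    by (rule continuous_on_subset[OF continuous_on_product_coordinates]) simp
  have disc: "jac_disc c \<noteq> 0" "center_jac c \<noteq> 0" if "c \<in> ?X" for c using normalizers[OF that] by simp_all
  show xy: "continuous_on ?X center_x" "continuous_on ?X center_y"
    unfolding center_x_def center_y_def using disc
    by (auto intro!: continuous_intros continuous_jac continuous_jac_disc)
  have grad: "continuous_on ?X dgx" "continuous_on ?X dgy" "continuous_on ?X dhx" "continuous_on ?X dhy"
    unfolding dgx_def dgy_def dhx_def dhy_def by (intro continuous_intros c xy)+
  have cj: "continuous_on ?X center_jac"
    unfolding center_jac_eq by (intro continuous_intros grad)
  have asy: "continuous_on ?X (\<lambda>c. asymptotes c x y)" for x y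
    unfolding asymptotes_def using disc by (auto intro!: continuous_intros continuous_jac cj)
  have cub: "continuous_on ?X (\<lambda>c. cubic_square c x y)" for x y
    unfolding cubic_square_def cubic_def using disc
    by (auto intro!: continuous_intros c grad continuous_jac_disc cj)
  have herm: "continuous_on ?X (\<lambda>c. hermitian c x y)" for x y
    unfolding hermitian_def norm_sum_def by (intro continuous_intros asy cub) auto
  have col: "continuous_on ?X col1" "continuous_on ?X col2" "continuous_on ?X col12"
    unfolding col1_def col2_def col12_def by (intro continuous_on_Complex_fun continuous_intros herm)+ auto
  have pos: "col1 c > 0" "col2 c - norm (col12 c) ^ 2 / col1 c > 0" "row1 c > 0" "row2 c - norm (row12 c) ^ 2 / row1 c > 0"
    if "c \<in> ?X" for c using normalizers[OF that] by simp_all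
  have gs: "continuous_on ?X (\<lambda>c. gs1 (a c))" "continuous_on ?X (\<lambda>c. gs2 (a c) (d c) (b c))"
      "continuous_on ?X (\<lambda>c. gs3 (a c) (d c) (b c))"
    if "continuous_on ?X a" "continuous_on ?X d" "continuous_on ?X b"
      and 1: "\<And>c. c \<in> ?X \<Longrightarrow> a c > 0" and 2: "\<And>c. c \<in> ?X \<Longrightarrow> d c - norm (b c) ^ 2 / a c > 0"
    for a d :: "(nat \<Rightarrow> complex) \<Rightarrow> real" and b
  proof -
    have nz: "a c \<noteq> 0" "sqrt (a c) \<noteq> 0" "sqrt (d c - norm (b c) ^ 2 / a c) \<noteq> 0" if "c \<in> ?X" for c
      using 1[OF that] 2[OF that] by simp_all
    show "continuous_on ?X (\<lambda>c. gs1 (a c))" "continuous_on ?X (\<lambda>c. gs2 (a c) (d c) (b c))"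
      "continuous_on ?X (\<lambda>c. gs3 (a c) (d c) (b c))"
      unfolding gs1_def gs2_def gs3_def using that(1-3) nz
      by (intro continuous_intros; simp)+
  qed
  show rn: "continuous_on ?X rn1" "continuous_on ?X rn2" "continuous_on ?X rn3"
    unfolding rn1_def rn2_def rn3_def by (rule gs[OF col]; rule pos; assumption)+
  have lin: "continuous_on ?X lin1" "continuous_on ?X lin2" "continuous_on ?X lin3" "continuous_on ?X lin4"
    unfolding lin1_def lin2_def lin3_def lin4_def by (intro continuous_intros grad rn)+
  have row: "continuous_on ?X row1" "continuous_on ?X row2" "continuous_on ?X row12"
    unfolding row1_def row2_def row12_def by (intro continuous_intros lin)+
  show "continuous_on ?X ln1" "continuous_on ?X ln2" "continuous_on ?X ln3"
    unfolding ln1_def ln2_def ln3_def by (rule gs[OF row]; rule pos; assumption)+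
qed

lemma continuous_deform: "continuous_on ({0..1} \<times> f1_orbit_coeffs) deform"
proof -
  let ?X = "{0..1} \<times> f1_orbit_coeffs"
  have snd: "continuous_on ?X (\<lambda>z. g (snd z))" if "continuous_on f1_orbit_coeffs g" for g :: "(nat \<Rightarrow> complex) \<Rightarrow> complex"
    by (rule continuous_on_compose2[OF that continuous_on_snd[OF continuous_on_id]]) auto
  have c: "continuous_on ?X (\<lambda>z. snd z i)" for i :: nat
  proof -
    have "continuous_on ?X (\<lambda>z. snd z)" by (intro continuous_on_snd continuous_on_id)
    then show ?thesis by (rule continuous_on_product_then_coordinatewise)
  qed
  note intros = continuous_intros c snd[OF continuous_normalizers(1)] snd[OF continuous_normalizers(2)]
    snd[OF continuous_normalizers(3)] snd[OF continuous_normalizers(4)] snd[OF continuous_normalizers(5)]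
    snd[OF continuous_normalizers(6)] snd[OF continuous_normalizers(7)] snd[OF continuous_normalizers(8)]
  have val: "continuous_on ?X (\<lambda>z. val1 (snd z))" "continuous_on ?X (\<lambda>z. val2 (snd z))"
    unfolding val1_def val2_def quad_map_def vector_2 by (intro intros)+
  show ?thesis
    unfolding deform_def case_prod_beta
  proof (rule continuous_on_coeffs_of)
    fix w :: "complex^2" and i :: 2
    have "i = 1 \<or> i = 2" by (rule exhaust_2)
    then show "continuous_on ?X (\<lambda>z. (left_map (fst z) (snd z) \<circ> quad_map (snd z) \<circ> right_map (fst z) (snd z)) w $ i)"
      unfolding left_map_def right_map_def o_def
      by (elim disjE; simp only: aff_nth quad_map_def vector_2) (intro intros val)+
  qed
qed

lemma left_right_in_GA2:
  assumes "c \<in> f1_orbit_coeffs" "t \<in> {0..1}"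
  shows "left_map t c \<in> GA2" "right_map t c \<in> GA2"
proof -
  have pos: "complex_of_real (1 - t) + of_real t * of_real x \<noteq> 0" if "x > 0" for x :: real
  proof -
    have "1 - t + t * x > 0" using that assms(2) by (cases "t = 0") (auto intro: add_nonneg_pos)
    then have "complex_of_real (1 - t + t * x) \<noteq> 0" by (simp only: of_real_eq_0_iff)
    then show ?thesis by simp
  qed
  note n = normalizers[OF assms(1)]
  have "1 - t + t * ln1 c \<noteq> 0" "1 - t + t * ln3 c \<noteq> 0" "1 - t + t * rn1 c \<noteq> 0" "1 - t + t * rn3 c \<noteq> 0"
    unfolding ln1_def ln3_def rn1_def rn3_def gs1_def gs3_def using n(1-4) by (intro pos; simp)+
  then show "left_map t c \<in> GA2" "right_map t c \<in> GA2"
    unfolding left_map_def right_map_def by (intro aff_in_GA2; simp)+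
qed

lemma quad_map_deform:
  assumes "c \<in> f1_orbit_coeffs" "t \<in> {0..1}"
  shows "quad_map (deform (t, c)) = left_map t c \<circ> quad_map c \<circ> right_map t c"
    "left_map t c \<circ> quad_map c \<circ> right_map t c \<in> orbit (quad_map c)"
proof -
  have c: "quad_map c \<in> Omega 2 2"
    using assms(1) bij_betw_quad_map by (auto simp: f1_orbit_coeffs_def bij_betw_def)
  show *: "left_map t c \<circ> quad_map c \<circ> right_map t c \<in> orbit (quad_map c)"
    unfolding orbit_def using left_right_in_GA2[OF assms] by blast
  show "quad_map (deform (t, c)) = left_map t c \<circ> quad_map c \<circ> right_map t c"
    using Omega_orbit[OF c *] by (simp add: deform_def quad_map_coeffs_of)
qed

lemma deform_in:
  assumes "c \<in> f1_orbit_coeffs" "t \<in> {0..1}"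
  shows "deform (t, c) \<in> f1_orbit_coeffs"
proof -
  have "quad_map (deform (t, c)) \<in> orbit f1"
    using quad_map_deform[OF assms] assms(1) orbit_trans by (auto simp: f1_orbit_coeffs_iff)
  then show ?thesis by (simp add: f1_orbit_coeffs_iff) (simp add: deform_def coeffs_of_in)
qed

lemma deform_0:
  assumes "c \<in> f1_orbit_coeffs"
  shows "deform (0, c) = c"
proof -
  have "left_map 0 c = id" "right_map 0 c = id"
    by (simp_all add: left_map_def right_map_def aff_id)
  then show ?thesis using assms by (simp add: deform_def coeffs_of_quad_map f1_orbit_coeffs_def)
qed

text \<open>The equations with 16 hold when both determinants have modulus 1; they are closed
  conditions that keep the set inside the orbit. The bound 8 is attained as an estimate by the
  xy-coefficients, which carry a factor 2, while the others are at most 4.\<close>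

definition unitary_coeffs :: "(nat \<Rightarrow> complex) set" where
  "unitary_coeffs = {c \<in> affine_space 12. (\<forall>i. norm (c i) \<le> 8) \<and> norm (jac_disc c) = 16 \<and> norm (jac_det c) = 16}"

lemma compact_unitary_coeffs: "compact unitary_coeffs"
proof -
  have "compactin (product_topology (\<lambda>i::nat. euclidean :: complex topology) UNIV) (PiE UNIV (\<lambda>i. cball 0 8))"
    unfolding compactin_PiE by (intro disjI2 ballI) simp
  then have B: "compact (PiE UNIV (\<lambda>i::nat. cball 0 8 :: complex set))"
    by (simp add: euclidean_product_topology)
  have "closed {c :: nat \<Rightarrow> complex. \<forall>i. i \<ge> 12 \<longrightarrow> c i = 0}"
  proof -
    have "{c :: nat \<Rightarrow> complex. \<forall>i. i \<ge> 12 \<longrightarrow> c i = 0} = (\<Inter>i\<in>{12..}. {c. c i = 0})" by auto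
    then show ?thesis by (auto intro!: closed_INT closed_Collect_eq continuous_intros)
  qed
  moreover have "closed {c. norm (jac_disc c) = 16}" "closed {c. norm (jac_det c) = 16}"
    by (intro closed_Collect_eq continuous_intros continuous_jac_disc continuous_jac_det)+
  ultimately have "compact (PiE UNIV (\<lambda>i::nat. cball 0 8 :: complex set) \<inter>
      ({c. \<forall>i. i \<ge> 12 \<longrightarrow> c i = 0} \<inter> ({c. norm (jac_disc c) = 16} \<inter> {c. norm (jac_det c) = 16})))"
    by (intro compact_Int_closed B closed_Int)
  also have "\<dots> = unitary_coeffs"
    by (auto simp: unitary_coeffs_def affine_space_def)
  finally show ?thesis .
qed

lemma unitary_coeffs_subset: "unitary_coeffs \<subseteq> f1_orbit_coeffs"
  by (auto simp: unitary_coeffs_def f1_orbit_coeffs_def)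

lemma norm_le_4:
  fixes P Q x y :: complex
  assumes "norm P \<le> 2" "norm Q \<le> 2" "norm x \<le> 1" "norm y \<le> 1"
  shows "norm (P * x + Q * y) \<le> 4"
proof -
  have "norm (P * x) \<le> 2 * 1" "norm (Q * y) \<le> 2 * 1"
    unfolding norm_mult by (intro mult_mono assms; simp)+
  then show ?thesis using norm_triangle_ineq[of "P * x" "Q * y"] by simp
qed

lemma norm_le_1_mult: "norm x \<le> 1 \<Longrightarrow> norm y \<le> 1 \<Longrightarrow> norm (x * y) \<le> 1" for x y :: complex
  unfolding norm_mult by (intro mult_le_one) simp_all

lemma norm_le_2_cross:
  fixes v w x y :: complex
  assumes "norm v \<le> 1" "norm w \<le> 1" "norm x \<le> 1" "norm y \<le> 1"
  shows "norm (v * x - w * y) \<le> 2"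
  using norm_triangle_ineq4[of "v * x" "w * y"] norm_le_1_mult[of v x] norm_le_1_mult[of w y] assms by simp

text \<open>At time 1 the map is
  \<open>aff P Q R T 0 0 \<circ> f1 \<circ> aff a1 a2 a3 a4 0 0\<close>. The right matrix has
  entries of norm at most 1 and determinant of modulus 1, and so has its product with the left
  matrix and the swap. Hence the left entries, and with them all coefficients, are bounded.\<close>

lemma deform_1:
  assumes "c \<in> f1_orbit_coeffs"
  shows "deform (1, c) \<in> unitary_coeffs"
proof -
  obtain p q r s u v p' q' r' s' u' v' where
    c: "quad_map c = aff p q r s u v \<circ> f1 \<circ> aff p' q' r' s' u' v'"
    and n: "p * s - q * r \<noteq> 0" "p' * s' - q' * r' \<noteq> 0"
    using assms by (rule f1_orbit_coeffsE)
  define a1 where "a1 = p' * rn1 c"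
  define a2 where "a2 = p' * rn2 c + q' * rn3 c"
  define a3 where "a3 = r' * rn1 c"
  define a4 where "a4 = r' * rn2 c + s' * rn3 c"
  have U: "norm a1 \<le> 1" "norm a3 \<le> 1" "norm a2 \<le> 1" "norm a4 \<le> 1" "norm (a1 * a4 - a2 * a3) = 1"
    using gram_schmidt(3-7)[OF n(2) col_orbit[OF c n]]
    unfolding a1_def a2_def a3_def a4_def rn1_def rn2_def rn3_def by simp_all
  have lin: "lin1 c = p * a3 + q * a1" "lin2 c = p * a4 + q * a2" "lin3 c = r * a3 + s * a1" "lin4 c = r * a4 + s * a2"
    unfolding lin_orbit[OF c n] a1_def a2_def a3_def a4_def by simp_all
  \<comment> \<open>The minus sign is the determinant of the swap.\<close>
  have "lin1 c * lin4 c - lin3 c * lin2 c = - ((p * s - q * r) * (a1 * a4 - a2 * a3))"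
    unfolding lin by (simp add: algebra_simps)
  moreover have "a1 * a4 - a2 * a3 \<noteq> 0" using U(5) by auto
  ultimately have "lin1 c * lin4 c - lin3 c * lin2 c \<noteq> 0" using n(1) by simp
  note V = gram_schmidt(3-7)[OF this row1_def row2_def row12_def, folded ln1_def ln2_def ln3_def]
  define P where "P = ln1 c * p"
  define Q where "Q = ln1 c * q"
  define R where "R = ln2 c * p + ln3 c * r"
  define T where "T = ln2 c * q + ln3 c * s"
  have v1: "lin1 c * ln1 c = P * a3 + Q * a1" and v2: "lin2 c * ln1 c = P * a4 + Q * a2"
    and v3: "lin1 c * ln2 c + lin3 c * ln3 c = R * a3 + T * a1"
    and v4: "lin2 c * ln2 c + lin4 c * ln3 c = R * a4 + T * a2"
    unfolding lin P_def Q_def R_def T_def by (simp_all add: algebra_simps)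
  note V = V[unfolded v1 v2 v3 v4]
  \<comment> \<open>The entries P, Q, R, T are recovered by Cramer's rule, and dividing by a
    determinant of modulus 1 leaves norms unchanged.\<close>
  have cancel: "norm x \<le> 2" if "x * (a1 * a4 - a2 * a3) = y" "norm y \<le> 2" for x y
    using that U(5) by (metis mult.right_neutral norm_mult)
  have "P * (a1 * a4 - a2 * a3) = (P * a4 + Q * a2) * a1 - (P * a3 + Q * a1) * a2"
    "Q * (a1 * a4 - a2 * a3) = (P * a3 + Q * a1) * a4 - (P * a4 + Q * a2) * a3"
    "R * (a1 * a4 - a2 * a3) = (R * a4 + T * a2) * a1 - (R * a3 + T * a1) * a2"
    "T * (a1 * a4 - a2 * a3) = (R * a3 + T * a1) * a4 - (R * a4 + T * a2) * a3"
    by (simp_all add: algebra_simps)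
  note cancel[OF this(1)] cancel[OF this(2)] cancel[OF this(3)] cancel[OF this(4)]
  then have bound: "norm P \<le> 2" "norm Q \<le> 2" "norm R \<le> 2" "norm T \<le> 2"
    using V(1-4) U(1-4) norm_le_2_cross by blast+
  have "(P * a3 + Q * a1) * (R * a4 + T * a2) - (R * a3 + T * a1) * (P * a4 + Q * a2)
      = - ((P * T - Q * R) * (a1 * a4 - a2 * a3))"
    by (simp add: algebra_simps)
  then have det: "norm (P * T - Q * R) = 1"
    using V(5) U(5) by (simp add: norm_mult)
  have F: "val1 c = u" "val2 c = v"
  proof -
    have "aff p' q' r' s' u' v' (vector [center_x c, center_y c]) = vector [0, 0]"
      using center_orbit(1,2)[OF c n] by (simp add: vec2_eq_iff)
    then have "quad_map c (vector [center_x c, center_y c]) = vector [u, v]"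
      unfolding c o_def by (simp add: vec2_eq_iff f1_def)
    then show "val1 c = u" "val2 c = v" by (simp_all add: val1_def val2_def)
  qed
  have L: "left_map 1 c \<circ> aff p q r s u v = aff P Q R T 0 0"
    unfolding left_map_def aff_comp F P_def Q_def R_def T_def
    by (simp add: algebra_simps)
  have Rm: "aff p' q' r' s' u' v' \<circ> right_map 1 c = aff a1 a2 a3 a4 0 0"
    unfolding right_map_def aff_comp using center_orbit(1,2)[OF c n]
    by (simp add: a1_def a2_def a3_def a4_def)
  have "quad_map (deform (1, c)) = left_map 1 c \<circ> quad_map c \<circ> right_map 1 c"
    using quad_map_deform(1)[OF assms, of 1] by simp
  also have "\<dots> = (left_map 1 c \<circ> aff p q r s u v) \<circ> f1 \<circ> (aff p' q' r' s' u' v' \<circ> right_map 1 c)"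
    unfolding c by (simp add: o_assoc)
  finally have d: "quad_map (deform (1, c)) = aff P Q R T 0 0 \<circ> f1 \<circ> aff a1 a2 a3 a4 0 0"
    unfolding L Rm .
  note g = gradient_coeffs[OF d]
  have disc: "norm (jac_disc (deform (1, c))) = 16" "norm (jac_det (deform (1, c))) = 16"
    unfolding jac_disc_orbit[OF d] using det U(5) by (simp_all add: norm_mult norm_power)
  have four: "norm x \<le> 8" if "norm x \<le> 4" for x :: complex using that by simp
  have in12: "deform (1, c) \<in> affine_space 12"
    by (simp add: deform_def coeffs_of_in)
  have "norm (deform (1, c) i) \<le> 8" for i
  proof -
    have lin: "norm (A * a3 + B * a1) \<le> 8" "norm (A * a4 + B * a2) \<le> 8"
      "norm (A * a1^2 + B * a3^2) \<le> 8" "norm (A * (a1 * a2) + B * (a3 * a4)) \<le> 4" "norm (A * a2^2 + B * a4^2) \<le> 8"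
      if "norm A \<le> 2" "norm B \<le> 2" for A B
      unfolding power2_eq_square by (intro four norm_le_4 that U(1-4) norm_le_1_mult)+
    have sm: "norm (deform (1, c) j) \<le> 8" if "j = 0 \<or> j = 1 \<or> j = 2 \<or> j = 3 \<or> j = 4 \<or> j = (5::nat)" for j
      using that
      by (elim disjE; simp add: g lin bound del: One_nat_def distrib_left_numeral)
    have sm': "norm (deform (1, c) j) \<le> 8" if "j = 6 \<or> j = 7 \<or> j = 8 \<or> j = 9 \<or> j = 10 \<or> j = (11::nat)" for j
      using that
      by (elim disjE; simp add: g lin bound del: One_nat_def distrib_left_numeral)
    consider "i < 6" | "i \<ge> 6" "i < 12" | "i \<ge> 12" by linarith
    then show ?thesis
    proof cases
      case 1
      then show ?thesis using sm less_6_cases by blast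
    next
      case 2
      then have "i = 6 \<or> i = 7 \<or> i = 8 \<or> i = 9 \<or> i = 10 \<or> i = 11" by presburger
      then show ?thesis by (rule sm')
    next
      case 3
      then show ?thesis using in12 by (simp add: affine_space_def)
    qed
  qed
  then show ?thesis using in12 disc by (simp add: unitary_coeffs_def)
qed

section \<open>The scaling action and the equivalences\<close>

definition scale_first :: "complex \<Rightarrow> (nat \<Rightarrow> complex) \<Rightarrow> nat \<Rightarrow> complex" where
  "scale_first l c i = (if i < 6 then l * c i else c i)"

lemma jac_scale_first:
  "jac_disc (scale_first l c) = l^2 * jac_disc c" "jac_det (scale_first l c) = l^3 * jac_det c"
proof -
  have j: "jac0 (scale_first l c) = l * jac0 c" "jacx (scale_first l c) = l * jacx c"
    "jacy (scale_first l c) = l * jacy c" "jacxx (scale_first l c) = l * jacxx c"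
    "jacxy (scale_first l c) = l * jacxy c" "jacyy (scale_first l c) = l * jacyy c"
    by (simp_all add: jac0_def jacx_def jacy_def jacxx_def jacxy_def jacyy_def scale_first_def algebra_simps)
  show "jac_disc (scale_first l c) = l^2 * jac_disc c" "jac_det (scale_first l c) = l^3 * jac_det c"
    unfolding jac_disc_def jac_det_def conic_disc_def conic_det_def j
    by (simp_all add: algebra_simps eval_nat_numeral)
qed

theorem theorem2p3:
  fixes f :: "complex^2 \<Rightarrow> complex^2"
  assumes "f \<in> Omega 2 2"
  shows "(is_hyperbola (critical_set f) \<longleftrightarrow> zariski_open_dense (orbit f))
    \<and> (is_hyperbola (critical_set f) \<longleftrightarrow> euclidean_open_dense (orbit f))
    \<and> (is_hyperbola (critical_set f) \<longleftrightarrow> orbit f = orbit f1)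
    \<and> (orbit f = orbit f1 \<longleftrightarrow> linearly_equivalent f f1)
    \<and> smooth_variety 12 (coeff_set (orbit f1))
    \<and> affine_variety 12 (coeff_set (orbit f1))
    \<and> variety_dim 12 (coeff_set (orbit f1)) = 12
    \<and> has_euler_characteristic (top_of_set (coeff_set (orbit f1))) 0"
proof -
  interpret O: principal_open 12 "\<lambda>c. jac_disc c * jac_det c" f1_coeffs
  proof
    show "(\<lambda>c. jac_disc c * jac_det c) \<in> poly_funs 12"
      unfolding jac_disc_def jac_det_def conic_disc_def conic_det_def
        jac0_def jacx_def jacy_def jacxx_def jacxy_def jacyy_def
      by (intro poly_funs_diff poly_funs.add poly_funs.mult poly_funs_power poly_funs.const poly_funs.coord; simp)
    show "f1_coeffs \<in> affine_space 12" by (rule f1_coeffs_in)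
    then have "f1_coeffs \<in> f1_orbit_coeffs"
      by (simp add: f1_orbit_coeffs_iff quad_map_f1_coeffs orbit_refl)
    then show "jac_disc f1_coeffs * jac_det f1_coeffs \<noteq> 0" by (simp add: f1_orbit_coeffs_def)
  qed
  have S: "coeff_set (orbit f1) = O.S"
    by (simp add: coeff_set_orbit_f1 O.S_def)
  have X: "O.S = f1_orbit_coeffs"
    by (simp add: f1_orbit_coeffs_def O.S_def)
  have hyp: "is_hyperbola (critical_set f) \<longleftrightarrow> orbit f = orbit f1"
    using hyperbola_iff_orbit_f1[OF assms] orbit_eq_iff by simp
  \<comment> \<open>Stated for an arbitrary topology T to serve the Zariski and the Euclidean case
    at once: a dense orbit meets the nonempty open orbit of \<open>f1\<close>, and orbits that meet
    coincide.\<close>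
  have meet: "orbit f = orbit f1"
    if T: "openin T (coeff_set (orbit f))" "T closure_of (coeff_set (orbit f)) = affine_space 12"
      and open_f1: "openin T O.S" and x: "f1_coeffs \<in> topspace T" for T
  proof -
    have f1S: "f1_coeffs \<in> O.S" using O.x0 by (simp add: O.S_def)
    have "f1_coeffs \<in> T closure_of (coeff_set (orbit f))" unfolding T(2) by (rule f1_coeffs_in)
    then obtain c where c: "c \<in> coeff_set (orbit f)" "c \<in> O.S"
      using open_f1 f1S unfolding in_closure_of by blast
    then have "quad_map c \<in> orbit f" "quad_map c \<in> orbit f1"
      unfolding S[symmetric] by (simp_all add: coeff_set_def)
    then show ?thesis using orbit_eq_iff by blast
  qed
  have zar: "zariski_open_dense (orbit f) \<longleftrightarrow> orbit f = orbit f1"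
  proof
    assume "zariski_open_dense (orbit f)"
    then show "orbit f = orbit f1"
      unfolding zariski_open_dense_def
      by (intro meet[of "zariski 12"] O.openin_zariski_S) (simp_all add: topspace_zariski f1_coeffs_in)
  qed (simp add: zariski_open_dense_def S O.openin_zariski_S O.zariski_dense)
  have euc: "euclidean_open_dense (orbit f) \<longleftrightarrow> orbit f = orbit f1"
  proof
    assume "euclidean_open_dense (orbit f)"
    then show "orbit f = orbit f1"
      unfolding euclidean_open_dense_def
      by (intro meet[of "top_of_set (affine_space 12)"] O.openin_euclidean) (simp_all add: f1_coeffs_in)
  qed (simp add: euclidean_open_dense_def S O.openin_euclidean O.euclidean_dense)
  have lin: "orbit f = orbit f1 \<longleftrightarrow> linearly_equivalent f f1"
    using linearly_equivalent_iff[OF assms] orbit_eq_iff by simp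
  have "finite_type (top_of_set f1_orbit_coeffs)"
  proof (rule finite_type_deformable_to_compact)
    show "openin (top_of_set (affine_space 12)) f1_orbit_coeffs"
      using O.openin_euclidean by (simp only: X)
  qed (use continuous_deform deform_in deform_0 compact_unitary_coeffs unitary_coeffs_subset deform_1 in auto)
  moreover have "punctured_plane_action f1_orbit_coeffs scale_first (\<lambda>c. jac_det c / jac_disc c)"
  proof
    fix c l m :: complex and x :: "nat \<Rightarrow> complex" assume x: "x \<in> f1_orbit_coeffs"
    show "scale_first l x \<in> f1_orbit_coeffs" if "l \<noteq> 0" for l
      using x that by (auto simp: f1_orbit_coeffs_def jac_scale_first affine_space_def scale_first_def)
    show "scale_first 1 x = x" "scale_first l (scale_first m x) = scale_first (l * m) x" for l m
      by (auto simp: scale_first_def)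
    show "jac_det x / jac_disc x \<noteq> 0" using x by (simp add: f1_orbit_coeffs_def)
    show "jac_det (scale_first l x) / jac_disc (scale_first l x) = l * (jac_det x / jac_disc x)" if "l \<noteq> 0" for l
      using that by (simp add: jac_scale_first eval_nat_numeral)
  next
    show "continuous_on f1_orbit_coeffs (\<lambda>c. jac_det c / jac_disc c)"
      by (intro continuous_intros continuous_jac_det continuous_jac_disc) (simp add: f1_orbit_coeffs_def)
    let ?Y = "(- {0}) \<times> f1_orbit_coeffs :: (complex \<times> (nat \<Rightarrow> complex)) set"
    have snd: "continuous_on ?Y (\<lambda>z. snd z i)" for i
      by (rule continuous_on_product_then_coordinatewise[OF continuous_on_snd[OF continuous_on_id]])
    have "continuous_on ?Y (\<lambda>z. if i < 6 then fst z * snd z i else snd z i)" for i :: nat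
      by (cases "i < 6") (simp_all add: continuous_on_mult continuous_on_fst snd)
    then show "continuous_on ?Y (\<lambda>(l, x). scale_first l x)"
      unfolding case_prod_beta
      by (intro continuous_on_coordinatewise_then_product) (simp only: scale_first_def)
  qed
  ultimately have "has_euler_characteristic (top_of_set f1_orbit_coeffs) 0"
    by (intro punctured_plane_action.euler_characteristic_zero)
  then show ?thesis
    using hyp zar euc lin O.smooth_variety_S O.affine_variety_S O.variety_dim_S unfolding S
    by (simp add: X)
qed

end
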